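(* For a generic knot $K\subset\mathbb{R}^3$ and a generic framing $\nu:S^1\to S^2$ of $K$, the set $F^s\subset K\times K$ of cords that intersect the framing at their startpoint is a one-dimensional submanifold with boundary of $K\times K$, and $\partial F^s=\partial^s S$.
   Context: Let $K\subset\mathbb{R}^3$ be a smooth knot of length $L$ and $\gamma:S^1\cong\mathbb{R}/L\mathbb{Z}\to\mathbb{R}^3$ an arclength parametrization of $K$. A cord of $K$ is a straight segment starting at $\gamma(s)$ (startpoint) and ending at $\gamma(t)$ (endpoint), with $s=t$ allowed; the space of cords is identified with $K\times K\cong T^2=(\mathbb{R}/L\mathbb{Z})^2$ and the cord is written $(s,t)$. A framing of $K$ is a smooth map $\nu:S^1\to S^2$ such that $\nu(t)$ is a unit normal vector to $K$ at $\gamma(t)$ for all $t$. Let $N(t)$ be the normal plane to $K$ at $\gamma(t)$ and $\pi_t:\mathbb{R}^3\to N(t)$ the orthogonal projection. The cord $(s,t)$ intersects the framing at its startpoint if $\pi_s(\gamma(t)-\gamma(s))=\alpha\nu(s)$ for some $\alpha>0$. $F^s\subset K\times K$ denotes the set of cords that intersect the framing at their startpoint. This condition makes no sense at cords whose projection $\pi_s(\gamma(t)-\gamma(s))$ vanishes (cords on the diagonal and cords tangent to $K$ at their startpoint); $F^s$ is understood to be extended to such cords by taking its closure in $K\times K$. $S\subset K\times K$ is the set of cords that intersect $K$ in their interior; for a generic knot, $S$ is an immersed curve with boundary, the boundary $\partial S$ consisting of finitely many cords tangent to $K$ at one endpoint. $\partial^s S\subset\partial S$ is the set of those (nonconstant)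 cords that are tangent to $K$ at their startpoint. "Generic" means: for all elements of a residual subset of the respective space of smooth objects (smooth knots, respectively smooth framings of $K$). *)

theory Defs
  imports "HOL-Analysis.Analysis"
begin

section \<open>Smooth maps\<close>

text \<open>Intended for open \<open>S\<close> in a finite-dimensional space, where it is the usual notion of a
  \<open>C^n\<close> map.\<close>

fun differentiable_of_order ::
  "nat \<Rightarrow> 'a::real_normed_vector set \<Rightarrow> ('a \<Rightarrow> 'b::real_normed_vector) \<Rightarrow> bool" where
  "differentiable_of_order 0 S f \<longleftrightarrow> continuous_on S f"
| "differentiable_of_order (Suc n) S f \<longleftrightarrow>
     (\<forall>x\<in>S. f differentiable (at x)) \<and>
     (\<forall>v. differentiable_of_order n S (\<lambda>x. frechet_derivative f (at x) v))"

definition smooth_on ::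
  "'a::real_normed_vector set \<Rightarrow> ('a \<Rightarrow> 'b::real_normed_vector) \<Rightarrow> bool" where
  "smooth_on S f \<longleftrightarrow> (\<forall>n. differentiable_of_order n S f)"

abbreviation vderiv :: "(real \<Rightarrow> 'a::real_normed_vector) \<Rightarrow> real \<Rightarrow> 'a" where
  "vderiv f \<equiv> (\<lambda>x. vector_derivative f (at x))"


section \<open>Genericity\<close>

definition residual_in :: "'a topology \<Rightarrow> 'a set \<Rightarrow> bool" where
  "residual_in T R \<longleftrightarrow> R \<subseteq> topspace T \<and>
     (\<exists>\<U>. countable \<U> \<and> (\<forall>U\<in>\<U>. openin T U \<and> T closure_of U = topspace T) \<and>
           topspace T \<inter> \<Inter>\<U> \<subseteq> R)"

text \<open>The \<open>C\<^sup>\<infinity>\<close> topology on a set \<open>X\<close> of smooth periodic maps: uniform convergence of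
  all derivatives. Maps on a circle \<open>\<real>/L\<int>\<close> are represented by \<open>L\<close>-periodic maps on \<open>\<real>\<close>.\<close>

definition Cinf_ball ::
  "(real \<Rightarrow> 'a::real_normed_vector) set \<Rightarrow> nat \<Rightarrow> real \<Rightarrow> (real \<Rightarrow> 'a) \<Rightarrow> (real \<Rightarrow> 'a) set" where
  "Cinf_ball X n e f =
     {g \<in> X. \<forall>k\<le>n. \<forall>x. norm ((vderiv ^^ k) g x - (vderiv ^^ k) f x) < e}"

definition Cinf_topology :: "(real \<Rightarrow> 'a::real_normed_vector) set \<Rightarrow> (real \<Rightarrow> 'a) topology" where
  "Cinf_topology X = topology_generated_by {Cinf_ball X n e f |n e f. 0 < e \<and> f \<in> X}"

lemma topspace_Cinf_topology [simp]: "topspace (Cinf_topology X) = X"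
proof -
  have "\<Union>{Cinf_ball X n e f |n e f. 0 < e \<and> f \<in> X} = X" (is "\<Union>?B = X")
  proof
    show "\<Union>?B \<subseteq> X"
      by (rule Union_least) (auto simp: Cinf_ball_def)
    show "X \<subseteq> \<Union>?B"
    proof
      fix f assume f: "f \<in> X"
      have "f \<in> Cinf_ball X 0 1 f"
        using f by (simp add: Cinf_ball_def)
      moreover have "Cinf_ball X 0 1 f \<in> ?B"
        by (rule CollectI, rule exI[of _ 0], rule exI[of _ 1], rule exI[of _ f]) (simp add: f)
      ultimately show "f \<in> \<Union>?B"
        by (rule UnionI[rotated])
    qed
  qed
  then show ?thesis
    unfolding Cinf_topology_def by (simp only: topology_generated_by_topspace)
qed


section \<open>Knots and framings\<close>

text \<open>The space of smooth knots is the space of smooth embeddings of \<open>\<real>/\<int>\<close>; the knot itself is the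
  range of such an embedding.\<close>

definition knot_embeddings :: "(real \<Rightarrow> real^3) set" where
  "knot_embeddings = {c. smooth_on UNIV c \<and> (\<forall>x. c (x + 1) = c x) \<and>
     (\<forall>x. vderiv c x \<noteq> 0) \<and> (\<forall>x y. c x = c y \<longrightarrow> x - y \<in> \<int>)}"

text \<open>The injectivity clause forces \<open>L\<close> to be the length of \<open>K\<close>.\<close>

definition arclength_parametrization :: "real \<Rightarrow> (real \<Rightarrow> real^3) \<Rightarrow> (real^3) set \<Rightarrow> bool" where
  "arclength_parametrization L \<gamma> K \<longleftrightarrow> 0 < L \<and> smooth_on UNIV \<gamma> \<and> (\<forall>x. \<gamma> (x + L) = \<gamma> x) \<and>
     (\<forall>x. norm (vderiv \<gamma> x) = 1) \<and>
     (\<forall>x y. \<gamma> x = \<gamma> y \<longrightarrow> (\<exists>k::int. x - y = of_int k * L)) \<and> range \<gamma> = K"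

definition framings :: "real \<Rightarrow> (real \<Rightarrow> real^3) \<Rightarrow> (real \<Rightarrow> real^3) set" where
  "framings L \<gamma> = {\<nu>. smooth_on UNIV \<nu> \<and> (\<forall>t. \<nu> (t + L) = \<nu> t) \<and>
     (\<forall>t. norm (\<nu> t) = 1 \<and> \<nu> t \<bullet> vderiv \<gamma> t = 0)}"


section \<open>Curves in the torus\<close>

text \<open>A subset of the torus \<open>K \<times> K = (\<real>/L\<int>)\<^sup>2\<close> is represented throughout by its preimage in \<open>\<real>\<^sup>2\<close>
  under the covering \<open>(s, t) \<mapsto> (\<gamma> s, \<gamma> t)\<close>. Since the covering is a local diffeomorphism, closures,
  the submanifold property and boundaries may all be computed upstairs.

  \<open>local_arc H p v A\<close> says that a smooth chart at \<open>p\<close> carries \<open>A\<close> to the subset \<open>H\<close> of the first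
  coordinate axis and \<open>p\<close> to the origin; \<open>v\<close> is the resulting tangent vector to \<open>A\<close> at \<open>p\<close>.\<close>

definition local_arc :: "real set \<Rightarrow> real \<times> real \<Rightarrow> real \<times> real \<Rightarrow> (real \<times> real) set \<Rightarrow> bool" where
  "local_arc H p v A \<longleftrightarrow> (\<exists>U V (\<phi> :: real \<times> real \<Rightarrow> real \<times> real) \<psi>. open U \<and> open V \<and> p \<in> U \<and>
     homeomorphism U V \<phi> \<psi> \<and> smooth_on U \<phi> \<and> smooth_on V \<psi> \<and>
     \<phi> p = 0 \<and> \<phi> ` (A \<inter> U) = V \<inter> (H \<times> {0}) \<and>
     v = frechet_derivative \<psi> (at 0) (1, 0))"

definition curve_interior :: "(real \<times> real) set \<Rightarrow> (real \<times> real) set" where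
  "curve_interior A = {p. \<exists>v. local_arc UNIV p v A}"

definition curve_boundary :: "(real \<times> real) set \<Rightarrow> (real \<times> real) set" where
  "curve_boundary A = {p. \<exists>v. local_arc {0..} p v A}"

definition one_dim_submanifold_with_boundary :: "(real \<times> real) set \<Rightarrow> bool" where
  "one_dim_submanifold_with_boundary A \<longleftrightarrow> A \<subseteq> curve_interior A \<union> curve_boundary A"

text \<open>Boundary points of an immersed curve: near \<open>p\<close> the set \<open>A\<close> is a finite union of embedded
  branches through \<open>p\<close> in pairwise different directions, and at least one of them ends at \<open>p\<close>. The
  branches are indexed by their tangent vectors; transversality keeps one branch from being
  counted as two half-branches.\<close>

definition immersed_curve_boundary :: "(real \<times> real) set \<Rightarrow> (real \<times> real) set" where
  "immersed_curve_boundary A = {p. \<exists>U T C H. open U \<and> p \<in> U \<and> finite T \<and>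
     pairwise (\<lambda>v w. independent {v, w}) T \<and>
     A \<inter> U = (\<Union>v\<in>T. C v) \<inter> U \<and>
     (\<forall>v\<in>T. (H v = UNIV \<or> H v = {0..}) \<and> local_arc (H v) p v (C v)) \<and>
     (\<exists>v\<in>T. H v = {0..})}"


section \<open>Sets of cords\<close>

text \<open>Projection to the normal plane at \<open>\<gamma> s\<close>; this formula requires \<open>\<gamma>\<close> to have unit speed.\<close>

definition normal_proj :: "(real \<Rightarrow> real^3) \<Rightarrow> real \<Rightarrow> real^3 \<Rightarrow> real^3" where
  "normal_proj \<gamma> s v = v - (v \<bullet> vderiv \<gamma> s) *\<^sub>R vderiv \<gamma> s"

text \<open>A cord with vanishing projection never satisfies the equation below, as \<open>\<nu> s\<close> is a unit
  vector; such cords enter only through the closure.\<close>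

definition F_start :: "(real \<Rightarrow> real^3) \<Rightarrow> (real \<Rightarrow> real^3) \<Rightarrow> (real \<times> real) set" where
  "F_start \<gamma> \<nu> = closure {(s, t). \<exists>\<alpha>>0. normal_proj \<gamma> s (\<gamma> t - \<gamma> s) = \<alpha> *\<^sub>R \<nu> s}"

definition S_cords :: "(real \<Rightarrow> real^3) \<Rightarrow> (real \<times> real) set" where
  "S_cords \<gamma> = {(s, t). \<exists>r. \<gamma> r \<in> open_segment (\<gamma> s) (\<gamma> t)}"

text \<open>The endpoints of the curve \<open>S_cords\<close> are limits of cords meeting \<open>K\<close> in their interior, where
  the intersection point has moved to an end of the cord; hence the closure.\<close>

definition boundary_S :: "(real \<Rightarrow> real^3) \<Rightarrow> (real \<times> real) set" where
  "boundary_S \<gamma> = immersed_curve_boundary (closure (S_cords \<gamma>))"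

definition tangent_at_start :: "(real \<Rightarrow> real^3) \<Rightarrow> (real \<times> real) set" where
  "tangent_at_start \<gamma> = {(s, t). \<gamma> s \<noteq> \<gamma> t \<and> (\<exists>a. \<gamma> t - \<gamma> s = a *\<^sub>R vderiv \<gamma> s)}"

definition boundary_S_start :: "(real \<Rightarrow> real^3) \<Rightarrow> (real \<times> real) set" where
  "boundary_S_start \<gamma> = boundary_S \<gamma> \<inter> tangent_at_start \<gamma>"

end

theory Submission
  imports Defs
begin

text \<open>The framing condition says \<open>q = 0\<close> and \<open>p > 0\<close>, where \<open>p\<close>, \<open>q\<close> are the components of the cord along
  \<open>\<nu> s\<close> and \<open>\<gamma>' s \<times> \<nu> s\<close>. A knot is generic if its curvature never vanishes, no tangent cord has \<open>\<gamma>' t\<close> in the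
  osculating plane at its startpoint, and no tangent cord is a trisecant. Each failure imposes one condition too
  many on the points involved, so after perturbing by trigonometric polynomials the bad parameters form the
  image of a space of lower dimension. For framings, a degenerate zero of \<open>q\<close> prescribes the turning function
  and its derivative at \<open>s\<close>, and the bad parameters are critical values of a plane map.

  For generic data \<open>{q = 0}\<close> is regular wherever \<open>p > 0\<close>, and on the diagonal after division by \<open>(t - s)\<^sup>2\<close>.
  At a tangent cord \<open>(p, q)\<close> is a chart in which the set is the half-axis \<open>{p > 0, q = 0}\<close>, so tangent cords are
  exactly the boundary points. There the cords meeting the knot also form a half-arc, since all
  intersection points are close to the startpoint.\<close>

section \<open>Calculus of smooth maps\<close>

text \<open>The conditions on knots are tested on configurations that form noncompact sets (pairs
  off the diagonal, arbitrary multipliers), while openness is available only over compact pieces.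
  Hence countably many closed balls are used, each contributing an open dense set.

  No general transversality theorem enters. A perturbation of the knot occurs linearly in the jet
  conditions, so each configuration has at most one bad parameter, depending smoothly on it; the
  dimension counts are 2 < 3 for curvature and 5 < 6 for tangent cords. A framing can only be turned
  by an angle. Two parameters then face the two-dimensional family of cords, and this equality of
  dimensions is the reason for Sard's theorem.

  Genericity is imposed on embeddings of R/Z, whereas cords are measured in arclength. The
  conditions are therefore phrased through the spans of c' and of c', c'', which do not depend on
  the parametrization.

  On the side of \<open>S_cords\<close>, \<open>boundary_S_start\<close> lies in
  \<open>tangent_at_start\<close> by definition, so it suffices that the closure ends at every
  tangent cord, and a single embedded half-branch is enough for that.\<close>

lemma differentiable_of_order_cong:
  fixes f g :: "'a::real_normed_vector \<Rightarrow> 'b::real_normed_vector"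
  assumes S: "open S" and eq: "\<And>x. x \<in> S \<Longrightarrow> f x = g x"
  shows "differentiable_of_order n S f = differentiable_of_order n S g"
proof -
  have "differentiable_of_order n S g"
    if "differentiable_of_order n S f" "\<And>x. x \<in> S \<Longrightarrow> f x = g x" for f g :: "'a \<Rightarrow> 'b"
    using that
  proof (induction n arbitrary: f g)
    case 0
    then show ?case using continuous_on_cong by fastforce
  next
    case (Suc n)
    have d: "(f has_derivative frechet_derivative f (at x)) (at x)" if "x \<in> S" for x
      using Suc.prems(1) that by (simp add: frechet_derivative_works)
    have d2: "(g has_derivative frechet_derivative f (at x)) (at x)" if "x \<in> S" for x
      using has_derivative_transform_within_open[OF d[OF that] S that] Suc.prems(2) by blast
    have "differentiable_of_order n S (\<lambda>x. frechet_derivative g (at x) v)" for v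
    proof (rule Suc.IH)
      show "differentiable_of_order n S (\<lambda>x. frechet_derivative f (at x) v)"
        using Suc.prems(1) by simp
      show "frechet_derivative f (at x) v = frechet_derivative g (at x) v" if "x \<in> S" for x
        using frechet_derivative_at[OF d2[OF that]] by simp
    qed
    moreover have "g differentiable (at x)" if "x \<in> S" for x
      using d2[OF that] by (auto simp: differentiable_def)
    ultimately show ?case by simp
  qed
  from this[of f g] this[of g f] show ?thesis using eq by auto
qed

text \<open>Derivatives are unique, so any explicit formula may stand in for
  \<open>frechet_derivative\<close> in the recursion. The inductions on the order below rest on
  this.\<close>

lemma differentiable_of_order_Suc_intro:
  assumes S: "open S"
    and der: "\<And>x. x \<in> S \<Longrightarrow> (f has_derivative f' x) (at x)"
    and ord: "\<And>v. differentiable_of_order n S (\<lambda>x. f' x v)"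
  shows "differentiable_of_order (Suc n) S f"
proof -
  have "f differentiable (at x)" if "x \<in> S" for x
    using der[OF that] by (auto simp: differentiable_def)
  moreover have "differentiable_of_order n S (\<lambda>x. frechet_derivative f (at x) v)" for v
  proof -
    have "frechet_derivative f (at x) v = f' x v" if "x \<in> S" for x
      using frechet_derivative_at[OF der[OF that]] by simp
    then show ?thesis using ord[of v] by (subst differentiable_of_order_cong[OF S]) auto
  qed
  ultimately show ?thesis by simp
qed

lemma differentiable_of_order_has_derivative:
  assumes "differentiable_of_order (Suc n) S f" "x \<in> S"
  shows "(f has_derivative frechet_derivative f (at x)) (at x)"
  using assms by (simp add: frechet_derivative_works)

lemma differentiable_of_order_derivative:
  assumes "differentiable_of_order (Suc n) S f"
  shows "differentiable_of_order n S (\<lambda>x. frechet_derivative f (at x) v)"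
  using assms by simp

lemma differentiable_of_order_Suc_imp:
  "differentiable_of_order (Suc n) S f \<Longrightarrow> differentiable_of_order n S f"
proof (induction n arbitrary: f)
  case 0
  then show ?case
    by (auto intro!: continuous_at_imp_continuous_on differentiable_imp_continuous_within)
next
  case (Suc n)
  then show ?case by (metis differentiable_of_order.simps(2))
qed

lemma differentiable_of_order_const: "differentiable_of_order n S (\<lambda>x. c)"
  by (induction n arbitrary: c) simp_all

lemma differentiable_of_order_add:
  assumes S: "open S"
  shows "differentiable_of_order n S f \<Longrightarrow> differentiable_of_order n S g \<Longrightarrow>
    differentiable_of_order n S (\<lambda>x. f x + g x)"
proof (induction n arbitrary: f g)
  case 0
  then show ?case by (simp add: continuous_on_add)
next
  case (Suc n)
  show ?case
    by (rule differentiable_of_order_Suc_intro[OF S])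
      (auto intro!: has_derivative_add Suc.IH differentiable_of_order_has_derivative[OF Suc.prems(1)]
        differentiable_of_order_has_derivative[OF Suc.prems(2)]
        differentiable_of_order_derivative[OF Suc.prems(1)] differentiable_of_order_derivative[OF Suc.prems(2)])
qed

lemma differentiable_of_order_sum:
  assumes S: "open S" and "\<And>i. i \<in> I \<Longrightarrow> differentiable_of_order n S (f i)"
  shows "differentiable_of_order n S (\<lambda>x. \<Sum>i\<in>I. f i x)"
  using assms(2)
  by (induction I rule: infinite_finite_induct)
    (auto intro!: differentiable_of_order_add[OF S] differentiable_of_order_const)

lemma (in bounded_linear) differentiable_of_order_linear:
  assumes S: "open S"
  shows "differentiable_of_order n S g \<Longrightarrow> differentiable_of_order n S (\<lambda>x. f (g x))"
proof (induction n arbitrary: g)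
  case 0
  then show ?case by (simp add: continuous_on)
next
  case (Suc n)
  show ?case
    by (rule differentiable_of_order_Suc_intro[OF S])
      (auto intro!: has_derivative Suc.IH differentiable_of_order_has_derivative[OF Suc.prems(1)]
        differentiable_of_order_derivative[OF Suc.prems(1)])
qed

lemma (in bounded_bilinear) differentiable_of_order_bilinear:
  assumes S: "open S"
  shows "differentiable_of_order n S f \<Longrightarrow> differentiable_of_order n S g \<Longrightarrow>
    differentiable_of_order n S (\<lambda>x. prod (f x) (g x))"
proof (induction n arbitrary: f g)
  case 0
  then show ?case by (simp add: continuous_on)
next
  case (Suc n)
  show ?case
    by (rule differentiable_of_order_Suc_intro[OF S])
      (auto intro!: FDERIV Suc.IH differentiable_of_order_add[OF S]
        differentiable_of_order_has_derivative[OF Suc.prems(1)]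
        differentiable_of_order_has_derivative[OF Suc.prems(2)]
        differentiable_of_order_Suc_imp[OF Suc.prems(1)] differentiable_of_order_Suc_imp[OF Suc.prems(2)]
        differentiable_of_order_derivative[OF Suc.prems(1)] differentiable_of_order_derivative[OF Suc.prems(2)])
qed

lemma differentiable_of_order_compose:
  fixes g :: "'a::real_normed_vector \<Rightarrow> 'b::euclidean_space" and f :: "'b \<Rightarrow> 'c::real_normed_vector"
  assumes S: "open S" and T: "open T" and gS: "g ` S \<subseteq> T"
  shows "differentiable_of_order n S g \<Longrightarrow> differentiable_of_order n T f \<Longrightarrow>
    differentiable_of_order n S (\<lambda>x. f (g x))"
proof (induction n arbitrary: f)
  case 0
  then show ?case using gS by (auto intro: continuous_on_compose2)
next
  case (Suc n)
  have dg: "(g has_derivative frechet_derivative g (at x)) (at x)" if "x \<in> S" for x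
    using differentiable_of_order_has_derivative[OF Suc.prems(1) that] .
  have df: "(f has_derivative frechet_derivative f (at (g x))) (at (g x))" if "x \<in> S" for x
    using differentiable_of_order_has_derivative[OF Suc.prems(2)] gS that by blast
  \<comment> \<open>The recursion differentiates in a fixed direction, but the chain rule evaluates
    the derivative of \<open>f\<close> in a direction that moves with \<open>x\<close>. Expansion in
    a basis leaves fixed directions with scalar coefficients, to which the induction hypothesis and
    the product rule apply.\<close>
  have rep: "frechet_derivative f (at (g x)) (frechet_derivative g (at x) v) =
    (\<Sum>i\<in>Basis. (frechet_derivative g (at x) v \<bullet> i) *\<^sub>R frechet_derivative f (at (g x)) i)" if "x \<in> S" for x v
  proof -
    have l: "linear (frechet_derivative f (at (g x)))"
      using df[OF that] by (rule has_derivative_linear)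
    show ?thesis
      by (subst euclidean_representation[symmetric, of "frechet_derivative g (at x) v"],
        subst linear_sum[OF l], simp add: linear_scale[OF l])
  qed
  have ord: "differentiable_of_order n S (\<lambda>x. \<Sum>i\<in>Basis. (frechet_derivative g (at x) v \<bullet> i) *\<^sub>R
      frechet_derivative f (at (g x)) i)" for v
  proof (rule differentiable_of_order_sum[OF S])
    fix i :: 'b
    show "differentiable_of_order n S (\<lambda>x. (frechet_derivative g (at x) v \<bullet> i) *\<^sub>R
      frechet_derivative f (at (g x)) i)"
    proof (rule bounded_bilinear.differentiable_of_order_bilinear[OF bounded_bilinear_scaleR S])
      show "differentiable_of_order n S (\<lambda>x. frechet_derivative g (at x) v \<bullet> i)"
        by (rule bounded_linear.differentiable_of_order_linear[OF bounded_linear_inner_left S])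
          (rule differentiable_of_order_derivative[OF Suc.prems(1)])
      show "differentiable_of_order n S (\<lambda>x. frechet_derivative f (at (g x)) i)"
        by (rule Suc.IH[OF differentiable_of_order_Suc_imp[OF Suc.prems(1)]])
          (rule differentiable_of_order_derivative[OF Suc.prems(2)])
    qed
  qed
  show ?case
  proof (rule differentiable_of_order_Suc_intro[OF S])
    show "((\<lambda>x. f (g x)) has_derivative (\<lambda>v. frechet_derivative f (at (g x)) (frechet_derivative g (at x) v))) (at x)"
      if "x \<in> S" for x
      using has_derivative_compose[OF dg[OF that] df[OF that]] .
    show "differentiable_of_order n S (\<lambda>x. frechet_derivative f (at (g x)) (frechet_derivative g (at x) v))" for v
      using ord[of v] rep by (subst differentiable_of_order_cong[OF S]) auto
  qed
qed

section \<open>Closure properties of smooth maps\<close>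

lemma smooth_on_cong:
  "open S \<Longrightarrow> (\<And>x. x \<in> S \<Longrightarrow> f x = g x) \<Longrightarrow> smooth_on S f = smooth_on S g"
  unfolding smooth_on_def using differentiable_of_order_cong by metis

lemma smooth_on_subset: "smooth_on S f \<Longrightarrow> T \<subseteq> S \<Longrightarrow> smooth_on T f"
proof -
  have "differentiable_of_order n S f \<Longrightarrow> T \<subseteq> S \<Longrightarrow> differentiable_of_order n T f" for n
    by (induction n arbitrary: f) (auto intro: continuous_on_subset)
  then show "smooth_on S f \<Longrightarrow> T \<subseteq> S \<Longrightarrow> smooth_on T f"
    by (auto simp: smooth_on_def)
qed

lemma smooth_on_has_derivative:
  "smooth_on S f \<Longrightarrow> x \<in> S \<Longrightarrow> (f has_derivative frechet_derivative f (at x)) (at x)"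
  unfolding smooth_on_def using differentiable_of_order_has_derivative by blast

lemma smooth_on_differentiable_on: "smooth_on S f \<Longrightarrow> f differentiable_on S"
  unfolding differentiable_on_def differentiable_def
  by (intro ballI exI) (rule has_derivative_at_withinI[OF smooth_on_has_derivative])

lemma smooth_on_derivative:
  "smooth_on S f \<Longrightarrow> smooth_on S (\<lambda>x. frechet_derivative f (at x) v)"
  unfolding smooth_on_def using differentiable_of_order_derivative by blast

lemma smooth_on_continuous_on: "smooth_on S f \<Longrightarrow> continuous_on S f"
  unfolding smooth_on_def using differentiable_of_order.simps(1) by blast

lemma smooth_on_const [simp]: "smooth_on S (\<lambda>x. c)"
  by (simp add: smooth_on_def differentiable_of_order_const)

lemma smooth_on_add:
  "open S \<Longrightarrow> smooth_on S f \<Longrightarrow> smooth_on S g \<Longrightarrow> smooth_on S (\<lambda>x. f x + g x)"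
  by (simp add: smooth_on_def differentiable_of_order_add)

lemma (in bounded_linear) smooth_on_linear:
  "open S \<Longrightarrow> smooth_on S g \<Longrightarrow> smooth_on S (\<lambda>x. f (g x))"
  by (simp add: smooth_on_def differentiable_of_order_linear)

lemma (in bounded_bilinear) smooth_on_bilinear:
  "open S \<Longrightarrow> smooth_on S f \<Longrightarrow> smooth_on S g \<Longrightarrow> smooth_on S (\<lambda>x. prod (f x) (g x))"
  by (simp add: smooth_on_def differentiable_of_order_bilinear)

lemma smooth_on_compose:
  fixes g :: "'a::real_normed_vector \<Rightarrow> 'b::euclidean_space"
  shows "open S \<Longrightarrow> open T \<Longrightarrow> smooth_on T f \<Longrightarrow> smooth_on S g \<Longrightarrow> g ` S \<subseteq> T \<Longrightarrow>
    smooth_on S (\<lambda>x. f (g x))"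
  by (simp add: smooth_on_def differentiable_of_order_compose)

lemma smooth_on_id: "open S \<Longrightarrow> smooth_on S (\<lambda>x. x)"
proof -
  assume S: "open S"
  have "differentiable_of_order n S (\<lambda>x. x)" for n
  proof (cases n)
    case (Suc m)
    show ?thesis unfolding Suc
      by (rule differentiable_of_order_Suc_intro[OF S, where f' = "\<lambda>x v. v"])
        (auto simp: differentiable_of_order_const)
  qed (simp add: continuous_on_id)
  then show ?thesis by (simp add: smooth_on_def)
qed

lemmas smooth_on_scaleR = bounded_bilinear.smooth_on_bilinear[OF bounded_bilinear_scaleR]
lemmas smooth_on_mult = bounded_bilinear.smooth_on_bilinear[OF bounded_bilinear_mult]
lemmas smooth_on_inner = bounded_bilinear.smooth_on_bilinear[OF bounded_bilinear_inner]
lemmas smooth_on_fst = bounded_linear.smooth_on_linear[OF bounded_linear_fst]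
lemmas smooth_on_snd = bounded_linear.smooth_on_linear[OF bounded_linear_snd]
lemmas smooth_on_minus = bounded_linear.smooth_on_linear[OF bounded_linear_minus[OF bounded_linear_ident]]

lemma smooth_on_diff:
  "open S \<Longrightarrow> smooth_on S f \<Longrightarrow> smooth_on S g \<Longrightarrow> smooth_on S (\<lambda>x. f x - g x)"
  using smooth_on_add[of S f "\<lambda>x. - g x"] smooth_on_minus[of S g] by simp

lemma smooth_on_Pair:
  "open S \<Longrightarrow> smooth_on S f \<Longrightarrow> smooth_on S g \<Longrightarrow> smooth_on S (\<lambda>x. (f x, g x))"
proof -
  assume S: "open S" and f: "smooth_on S f" and g: "smooth_on S g"
  have "smooth_on S (\<lambda>x. (f x, 0) + (0, g x))"
    by (intro smooth_on_add S bounded_linear.smooth_on_linear[OF _ S f] bounded_linear.smooth_on_linear[OF _ S g]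
       bounded_linear_Pair bounded_linear_ident bounded_linear_zero)
  then show ?thesis by simp
qed

lemma bounded_bilinear_cross3: "bounded_bilinear (cross3)"
  using bilinear_conv_bounded_bilinear bilinear_cross by blast

lemmas smooth_on_cross3 = bounded_bilinear.smooth_on_bilinear[OF bounded_bilinear_cross3]

text \<open>The derivative of \<open>inverse\<close> is a polynomial in \<open>inverse\<close>, so
  each order of differentiability produces the next one; composition then takes care of
  \<open>f\<close>.\<close>

lemma smooth_on_inverse:
  fixes f :: "'a::real_normed_vector \<Rightarrow> real"
  assumes S: "open S" and f: "smooth_on S f" and nz: "\<And>x. x \<in> S \<Longrightarrow> f x \<noteq> 0"
  shows "smooth_on S (\<lambda>x. inverse (f x))"
proof -
  let ?T = "- {0::real}"
  have T: "open ?T" by auto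
  have "differentiable_of_order n ?T inverse" for n
  proof (induction n)
    case 0
    then show ?case by (auto intro!: continuous_intros)
  next
    case (Suc n)
    show ?case
    proof (rule differentiable_of_order_Suc_intro[OF T])
      show "(inverse has_derivative (\<lambda>v. - (inverse x * v * inverse x))) (at x)" if "x \<in> ?T" for x :: real
        using that by (auto intro!: has_derivative_inverse')
      show "differentiable_of_order n ?T (\<lambda>x. - (inverse x * v * inverse x))" for v :: real
        by (intro bounded_linear.differentiable_of_order_linear[OF bounded_linear_minus[OF bounded_linear_ident]]
          bounded_bilinear.differentiable_of_order_bilinear[OF bounded_bilinear_mult] T Suc.IH
          differentiable_of_order_const)
    qed
  qed
  then have "smooth_on ?T inverse" by (simp add: smooth_on_def)
  then show ?thesis using smooth_on_compose[OF S T _ f] nz by force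
qed

lemma smooth_on_divide:
  fixes f g :: "'a::real_normed_vector \<Rightarrow> real"
  assumes "open S" "smooth_on S f" "smooth_on S g" "\<And>x. x \<in> S \<Longrightarrow> g x \<noteq> 0"
  shows "smooth_on S (\<lambda>x. f x / g x)"
  unfolding divide_inverse by (intro smooth_on_mult smooth_on_inverse assms) auto

lemma smooth_on_sqrt:
  fixes f :: "'a::real_normed_vector \<Rightarrow> real"
  assumes S: "open S" and f: "smooth_on S f" and pos: "\<And>x. x \<in> S \<Longrightarrow> f x > 0"
  shows "smooth_on S (\<lambda>x. sqrt (f x))"
proof -
  let ?T = "{0::real<..}"
  have T: "open ?T" by auto
  have "differentiable_of_order n ?T sqrt" for n
  proof (induction n)
    case 0
    then show ?case by (auto intro!: continuous_intros)
  next
    case (Suc n)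
    have inv: "differentiable_of_order n (- {0::real}) inverse"
      using smooth_on_inverse[of "- {0::real}" "\<lambda>x. x"] smooth_on_id[of "-{0::real}"] by (auto simp: smooth_on_def)
    show ?case
    proof (rule differentiable_of_order_Suc_intro[OF T])
      show "(sqrt has_derivative (\<lambda>v. v * (inverse (sqrt x) * (1/2)))) (at x)" if "x \<in> ?T" for x :: real
        using that by (auto intro!: derivative_eq_intros simp: field_simps)
      have "differentiable_of_order n ?T (\<lambda>x. inverse (sqrt x))"
        by (rule differentiable_of_order_compose[OF T _ _ Suc.IH inv]) auto
      then show "differentiable_of_order n ?T (\<lambda>x. v * (inverse (sqrt x) * (1/2)))" for v :: real
        by (intro bounded_bilinear.differentiable_of_order_bilinear[OF bounded_bilinear_mult] T
          differentiable_of_order_const)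
    qed
  qed
  then have "smooth_on ?T sqrt" by (simp add: smooth_on_def)
  then show ?thesis using smooth_on_compose[OF S T _ f] pos by force
qed

lemma smooth_on_sin_cos:
  fixes f :: "'a::real_normed_vector \<Rightarrow> real"
  assumes S: "open S" and f: "smooth_on S f"
  shows "smooth_on S (\<lambda>x. sin (f x))" "smooth_on S (\<lambda>x. cos (f x))"
proof -
  let ?T = "UNIV :: real set"
  \<comment> \<open>Sine and cosine are treated together because their linear combinations are
    closed under differentiation.\<close>
  have "differentiable_of_order n ?T (\<lambda>x. a * sin x + b * cos x)" for n a b
  proof (induction n arbitrary: a b)
    case 0
    then show ?case by (auto intro!: continuous_intros)
  next
    case (Suc n)
    show ?case
    proof (rule differentiable_of_order_Suc_intro[OF open_UNIV])
      show "((\<lambda>x. a * sin x + b * cos x) has_derivative (\<lambda>v. (- (v * b)) * sin x + (v * a) * cos x)) (at x)" for x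
        by (auto intro!: derivative_eq_intros simp: field_simps)
      show "differentiable_of_order n UNIV (\<lambda>x. (- (v * b)) * sin x + (v * a) * cos x)" for v :: real
        by (rule Suc.IH)
    qed
  qed
  from this[of _ 1 0] this[of _ 0 1] have "smooth_on ?T sin" "smooth_on ?T cos" by (simp_all add: smooth_on_def)
  then show "smooth_on S (\<lambda>x. sin (f x))" "smooth_on S (\<lambda>x. cos (f x))"
    using smooth_on_compose[OF S open_UNIV _ f] by force+
qed

lemma smooth_on_vderiv:
  fixes f :: "real \<Rightarrow> 'a::real_normed_vector"
  assumes "smooth_on S f" "open S"
  shows "smooth_on S (vderiv f)"
proof -
  have "smooth_on S (\<lambda>x. frechet_derivative f (at x) 1)" by (rule smooth_on_derivative[OF assms(1)])
  moreover have "frechet_derivative f (at x) 1 = vderiv f x" if "x \<in> S" for x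
  proof -
    have "f differentiable (at x)"
      using smooth_on_has_derivative[OF assms(1) that] by (auto simp: differentiable_def)
    then show ?thesis
      using frechet_derivative_at vector_derivative_works[of f "at x"]
      by (metis has_vector_derivative_def scaleR_one)
  qed
  ultimately show ?thesis using smooth_on_cong[OF assms(2)] by (metis (no_types, lifting))
qed

lemma smooth_on_has_vderiv:
  fixes f :: "real \<Rightarrow> 'a::real_normed_vector"
  assumes "smooth_on S f" "x \<in> S"
  shows "(f has_vector_derivative vderiv f x) (at x)"
  using smooth_on_has_derivative[OF assms] vector_derivative_works[of f "at x"]
  by (auto simp: differentiable_def)

lemma smooth_on_vderiv_funpow:
  "smooth_on UNIV f \<Longrightarrow> smooth_on UNIV ((vderiv ^^ k) f)"
  by (induction k) (auto intro: smooth_on_vderiv)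

subsection \<open>Hadamard's lemma\<close>

text \<open>In finite dimension, continuity of the derivative in operator norm follows from
  continuity of its values on the basis vectors. This is the form in which the inverse function
  theorem takes its hypothesis.\<close>

lemma continuous_on_derivative_blinfun:
  fixes f :: "'a::euclidean_space \<Rightarrow> 'b::real_normed_vector"
  assumes "smooth_on S f"
  shows "continuous_on S (\<lambda>x. Blinfun (frechet_derivative f (at x)))"
proof (rule continuous_on_blinfun_componentwise)
  fix i :: 'a assume "i \<in> Basis"
  have "blinfun_apply (Blinfun (frechet_derivative f (at x))) i = frechet_derivative f (at x) i" if "x \<in> S" for x
    using smooth_on_has_derivative[OF assms that] by (simp add: bounded_linear_Blinfun_apply has_derivative_bounded_linear)
  then show "continuous_on S (\<lambda>x. blinfun_apply (Blinfun (frechet_derivative f (at x))) i)"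
    using smooth_on_continuous_on[OF smooth_on_derivative[OF assms, of i]] continuous_on_cong by fastforce
qed

lemma linear_real2:
  fixes l :: "real \<times> real \<Rightarrow> 'a::real_vector"
  assumes "linear l"
  shows "l v = fst v *\<^sub>R l (1, 0) + snd v *\<^sub>R l (0, 1)"
proof -
  have "v = fst v *\<^sub>R (1, 0) + snd v *\<^sub>R (0, 1)" by simp
  then have "l v = l (fst v *\<^sub>R (1, 0) + snd v *\<^sub>R (0, 1))" by simp
  also have "\<dots> = fst v *\<^sub>R l (1, 0) + snd v *\<^sub>R l (0, 1)"
    by (simp only: linear_add[OF assms] linear_scale[OF assms])
  finally show ?thesis .
qed

text \<open>The weight \<open>w\<close> closes the induction: differentiating under the integral in
  the second variable brings out a factor \<open>x\<close>, which is absorbed into the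
  weight.\<close>

lemma smooth_on_param_integral:
  fixes k :: "real \<times> real \<Rightarrow> 'b::banach"
  assumes "smooth_on UNIV k" "continuous_on {0..1} w"
  shows "smooth_on UNIV (\<lambda>z. integral {0..1} (\<lambda>x. w x *\<^sub>R k (fst z, x * snd z)))"
proof -
  have "differentiable_of_order n UNIV (\<lambda>z. integral {0..1} (\<lambda>x. w x *\<^sub>R k (fst z, x * snd z)))" for n
    using assms
  proof (induction n arbitrary: k w)
    case 0
    have "continuous_on (UNIV \<times> cbox 0 1) (\<lambda>(z, x). w x *\<^sub>R k (fst z, x * snd z))"
      unfolding split_beta
      by (intro continuous_intros continuous_on_compose2[OF 0(2)]
          continuous_on_compose2[OF smooth_on_continuous_on[OF 0(1)]]) auto
    from integral_continuous_on_param[OF this] show ?case by simp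
  next
    case (Suc n)
    let ?D = "\<lambda>z. frechet_derivative k (at z)"
    let ?L = "\<lambda>x::real. \<lambda>z::real\<times>real. (fst z, x * snd z)"
    have bl: "bounded_linear (?L x)" for x
      by (intro bounded_linear_Pair bounded_linear_fst bounded_linear_compose[OF bounded_linear_mult_right bounded_linear_snd])
    have dk: "(k has_derivative ?D z) (at z)" for z
      using smooth_on_has_derivative[OF Suc.prems(1)] by simp
    have blD: "bounded_linear (?D z)" for z using dk has_derivative_bounded_linear by blast
    define fx where "fx z x = Blinfun (\<lambda>v. w x *\<^sub>R ?D (?L x z) (?L x v))" for z x
    have fx: "blinfun_apply (fx z x) = (\<lambda>v. w x *\<^sub>R ?D (?L x z) (?L x v))" for z x
      unfolding fx_def
      by (intro bounded_linear_Blinfun_apply bounded_linear_const_scaleR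
        bounded_linear_compose[OF blD bl])
    have split: "?D z (v1, x * v2) = v1 *\<^sub>R ?D z (1, 0) + (x * v2) *\<^sub>R ?D z (0, 1)" for z v1 v2 x
      using linear_real2[OF bounded_linear.linear[OF blD], of z "(v1, x * v2)"] by simp
    have cD: "continuous_on UNIV (\<lambda>z. ?D z v)" for v
      using smooth_on_continuous_on[OF smooth_on_derivative[OF Suc.prems(1)]] .
    have contfx: "continuous_on (UNIV \<times> cbox 0 1) (\<lambda>(z, x). fx z x)"
    proof (rule continuous_on_blinfun_componentwise)
      fix i :: "real \<times> real" assume "i \<in> Basis"
      show "continuous_on (UNIV \<times> cbox 0 1) (\<lambda>p. blinfun_apply (case p of (z, x) \<Rightarrow> fx z x) i)"
        unfolding split_beta fx split
        by (intro continuous_intros continuous_on_compose2[OF Suc.prems(2)]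
          continuous_on_compose2[OF cD]) auto
    qed
    have der: "((\<lambda>z. w x *\<^sub>R k (?L x z)) has_derivative blinfun_apply (fx z x)) (at z)" for z x
      unfolding fx
      by (intro has_derivative_scaleR_right has_derivative_compose[OF bounded_linear_imp_has_derivative[OF bl] dk])
    have ck: "continuous_on UNIV k" using smooth_on_continuous_on[OF Suc.prems(1)] .
    have int1: "(\<lambda>x. w x *\<^sub>R k (?L x z)) integrable_on cbox 0 1" for z
      by (intro integrable_continuous continuous_intros continuous_on_compose2[OF ck])
        (use Suc.prems(2) in auto)
    have leib: "((\<lambda>z. integral (cbox 0 1) (\<lambda>x. w x *\<^sub>R k (?L x z))) has_derivative
        integral (cbox 0 1) (fx z)) (at z)" for z
      by (rule leibniz_rule[where U = UNIV]) (use der int1 contfx in auto)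
    have intfx: "fx z integrable_on cbox 0 1" for z
      by (intro integrable_continuous continuous_on_compose2[OF contfx, of _ "\<lambda>x. (z, x)", simplified])
        (auto intro!: continuous_intros)
    have w': "continuous_on {0..1} (\<lambda>x. w x * x)" using Suc.prems(2) by (intro continuous_intros)
    have eq: "blinfun_apply (integral (cbox 0 1) (fx z)) v =
       fst v *\<^sub>R integral {0..1} (\<lambda>x. w x *\<^sub>R ?D (?L x z) (1,0)) +
       snd v *\<^sub>R integral {0..1} (\<lambda>x. (w x * x) *\<^sub>R ?D (?L x z) (0,1))" for z v
    proof -
      have i1: "(\<lambda>x. w x *\<^sub>R ?D (?L x z) (1,0)) integrable_on {0..1}"
        by (intro integrable_continuous_real continuous_intros continuous_on_compose2[OF cD] Suc.prems(2)) auto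
      have i2: "(\<lambda>x. (w x * x) *\<^sub>R ?D (?L x z) (0,1)) integrable_on {0..1}"
        by (intro integrable_continuous_real continuous_intros continuous_on_compose2[OF cD] w') auto
      have "blinfun_apply (integral (cbox 0 1) (fx z)) v = integral (cbox 0 1) (\<lambda>x. blinfun_apply (fx z x) v)"
        using blinfun_apply_integral[OF intfx] by simp
      also have "\<dots> = integral {0..1} (\<lambda>x. fst v *\<^sub>R (w x *\<^sub>R ?D (?L x z) (1,0)) + snd v *\<^sub>R ((w x * x) *\<^sub>R ?D (?L x z) (0,1)))"
        by (simp add: fx split scaleR_add_right mult_ac)
      also have "\<dots> = integral {0..1} (\<lambda>x. fst v *\<^sub>R (w x *\<^sub>R ?D (?L x z) (1,0))) + integral {0..1} (\<lambda>x. snd v *\<^sub>R ((w x * x) *\<^sub>R ?D (?L x z) (0,1)))"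
        by (rule integral_add) (intro integrable_cmul i1 i2)+
      finally show ?thesis by (simp only: integral_cmul)
    qed
    show ?case
    proof (rule differentiable_of_order_Suc_intro[OF open_UNIV])
      show "((\<lambda>z. integral {0..1} (\<lambda>x. w x *\<^sub>R k (?L x z))) has_derivative
        blinfun_apply (integral (cbox 0 1) (fx z))) (at z)" for z
        using leib[of z] by simp
      show "differentiable_of_order n UNIV (\<lambda>z. blinfun_apply (integral (cbox 0 1) (fx z)) v)" for v
        unfolding eq
        by (intro differentiable_of_order_add open_UNIV
           bounded_linear.differentiable_of_order_linear[OF bounded_linear_scaleR_right] Suc.IH
           smooth_on_derivative Suc.prems w')
    qed
  qed
  then show ?thesis by (simp add: smooth_on_def)
qed

text \<open>The quotient by \<open>u\<close> is the mean of the partial derivative over the segment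
  from \<open>(s, 0)\<close> to \<open>(s, u)\<close>, an expression that is smooth across
  \<open>u = 0\<close>.\<close>

lemma Hadamard:
  fixes f :: "real \<times> real \<Rightarrow> 'b::banach"
  assumes f: "smooth_on UNIV f" and zero: "\<And>s. f (s, 0) = 0"
  obtains g where "smooth_on UNIV g" "\<And>s u. f (s, u) = u *\<^sub>R g (s, u)"
    "\<And>s. g (s, 0) = frechet_derivative f (at (s, 0)) (0, 1)"
proof
  let ?D = "\<lambda>z. frechet_derivative f (at z) (0, 1)"
  let ?g = "\<lambda>z. integral {0..1} (\<lambda>x. 1 *\<^sub>R ?D (fst z, x * snd z))"
  show "smooth_on UNIV ?g"
    by (rule smooth_on_param_integral[OF smooth_on_derivative[OF f]]) auto
  show "?g (s, 0) = ?D (s, 0)" for s by simp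
  show "f (s, u) = u *\<^sub>R ?g (s, u)" for s u
  proof -
    have df: "(f has_derivative frechet_derivative f (at z)) (at z)" for z
      using smooth_on_has_derivative[OF f] by simp
    have vd: "((\<lambda>x. f (s, x * u)) has_vector_derivative u *\<^sub>R ?D (s, x * u)) (at x within {0..1})" for x
    proof -
      have "((\<lambda>x. (s, x * u)) has_derivative (\<lambda>v. (0, v * u))) (at x within {0..1})"
        by (auto intro!: derivative_eq_intros)
      from has_derivative_compose[OF this df] have
        *: "((\<lambda>x. f (s, x * u)) has_derivative (\<lambda>v. frechet_derivative f (at (s, x * u)) (0, v * u))) (at x within {0..1})" .
      have "frechet_derivative f (at (s, x * u)) (0, v * u) = v *\<^sub>R u *\<^sub>R ?D (s, x * u)" for v
        using linear_real2[OF has_derivative_linear[OF df], of "(s, x * u)" "(0, v * u)"] by simp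
      then show ?thesis using * by (simp add: has_vector_derivative_def)
    qed
    have "((\<lambda>x. u *\<^sub>R ?D (s, x * u)) has_integral f (s, 1 * u) - f (s, 0 * u)) {0..1}"
      by (rule fundamental_theorem_of_calculus) (use vd in auto)
    then have "integral {0..1} (\<lambda>x. u *\<^sub>R ?D (s, x * u)) = f (s, u)"
      using zero by (auto dest: integral_unique simp del: integral_cmul)
    then show ?thesis by simp
  qed
qed

subsection \<open>The smooth inverse function theorem in the plane\<close>

text \<open>The inverse function theorem gives a differentiable inverse \<open>g\<close>. By
  Cramer's rule its derivative is rational in the partial derivatives of \<open>f\<close> at
  \<open>g y\<close>, so order n of \<open>g\<close> yields order n + 1.\<close>

lemma smooth_inverse_function:
  fixes f :: "real \<times> real \<Rightarrow> real \<times> real"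
  assumes U: "open U" and f: "smooth_on U f" and z0: "z0 \<in> U"
    and inj: "\<And>v. frechet_derivative f (at z0) v = 0 \<Longrightarrow> v = 0"
  obtains U' V g where "open U'" "U' \<subseteq> U" "z0 \<in> U'" "open V" "homeomorphism U' V f g" "smooth_on V g"
proof -
  let ?D = "\<lambda>z. frechet_derivative f (at z)"
  let ?f' = "\<lambda>z. Blinfun (?D z)"
  have df: "(f has_derivative ?D z) (at z)" if "z \<in> U" for z
    using smooth_on_has_derivative[OF f that] .
  have ap: "blinfun_apply (?f' z) = ?D z" if "z \<in> U" for z
    using df[OF that] by (simp add: bounded_linear_Blinfun_apply has_derivative_bounded_linear)
  have lin: "linear (?D z0)" using df[OF z0] has_derivative_linear by blast
  have "inj (?D z0)" using inj lin linear_injective_0 by blast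
  then obtain k where k: "linear k" "k \<circ> ?D z0 = id" using linear_injective_left_inverse[OF lin] by blast
  have inv: "Blinfun k o\<^sub>L ?f' z0 = id_blinfun"
  proof (rule blinfun_eqI)
    fix v
    have "k (?D z0 v) = v" using k(2) by (metis comp_apply id_apply)
    then show "blinfun_apply (Blinfun k o\<^sub>L ?f' z0) v = blinfun_apply id_blinfun v"
      using k(1) by (simp add: ap[OF z0] bounded_linear_Blinfun_apply linear_conv_bounded_linear)
  qed
  obtain U' V g g' where *: "open U'" "U' \<subseteq> U" "z0 \<in> U'" "open V" "f z0 \<in> V" "homeomorphism U' V f g"
    and dg: "\<And>y. y \<in> V \<Longrightarrow> (g has_derivative (g' y)) (at y)"
    and g': "\<And>y. y \<in> V \<Longrightarrow> g' y = inv (blinfun_apply (?f'(g y)))"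
    and bij: "\<And>y. y \<in> V \<Longrightarrow> bij (blinfun_apply (?f'(g y)))"
    using inverse_function_theorem[OF U, of f ?f' z0 "Blinfun k"] df ap inv z0
      continuous_on_derivative_blinfun[OF f] by (metis (no_types, lifting))
  have gU: "g y \<in> U" if "y \<in> V" for y
    using *(2,6) that by (auto simp: homeomorphism_def)
  define a where "a z = ?D z (1, 0)" for z
  define b where "b z = ?D z (0, 1)" for z
  define dt where "dt z = fst (a z) * snd (b z) - snd (a z) * fst (b z)" for z
  have rep: "?D z v = fst v *\<^sub>R a z + snd v *\<^sub>R b z" if "z \<in> U" for z v
    unfolding a_def b_def using df[OF that] has_derivative_linear linear_real2 by blast
  have dt: "dt (g y) \<noteq> 0" if y: "y \<in> V" for y
  proof
    assume d0: "dt (g y) = 0"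
    have i: "inj (?D (g y))" using bij[OF y] ap[OF gU[OF y]] by (simp add: bij_is_inj)
    \<comment> \<open>If the determinant vanished, these two vectors would lie in the kernel.
      Injectivity makes both zero, so the column \<open>a\<close> is zero, and then
      \<open>(1, 0)\<close> is a nonzero kernel vector.\<close>
    have "?D (g y) (snd (b (g y)), - snd (a (g y))) = 0" "?D (g y) (fst (b (g y)), - fst (a (g y))) = 0"
      using d0 unfolding dt_def by (simp_all add: rep[OF gU[OF y]] prod_eq_iff algebra_simps)
    moreover have nul: "v = 0" if "?D (g y) v = 0" for v
    proof (rule injD[OF i])
      show "?D (g y) v = ?D (g y) 0" using that by (simp add: rep[OF gU[OF y]])
    qed
    ultimately have "(snd (b (g y)), - snd (a (g y))) = 0" "(fst (b (g y)), - fst (a (g y))) = 0"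
      by (blast intro: nul)+
    then have "a (g y) = 0" by (simp add: prod_eq_iff)
    then have "?D (g y) (1, 0) = 0" by (simp add: rep[OF gU[OF y]])
    then have "(1::real, 0::real) = 0" by (rule nul)
    then show False by (simp add: prod_eq_iff)
  qed
  define I where "I y w = ((fst w * snd (b (g y)) - snd w * fst (b (g y))) / dt (g y),
      (fst (a (g y)) * snd w - snd (a (g y)) * fst w) / dt (g y))" for y w
  have g'I: "g' y w = I y w" if y: "y \<in> V" for y w
  proof -
    have "?D (g y) (I y w) = w"
      using dt[OF y] unfolding rep[OF gU[OF y]] I_def
      by (simp add: prod_eq_iff field_simps) (simp add: dt_def algebra_simps)
    moreover have "bij (?D (g y))" "g' y = inv (?D (g y))"
      using g'[OF y] bij[OF y] by (simp_all add: ap[OF gU[OF y]])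
    ultimately show ?thesis using inv_f_f[OF bij_is_inj] by metis
  qed
  have "differentiable_of_order n V g" for n
  proof (induction n)
    case 0
    then show ?case using *(6) by (simp add: homeomorphism_def)
  next
    case (Suc n)
    have gV: "g ` V \<subseteq> U" using gU by auto
    have ord: "differentiable_of_order n V (\<lambda>y. h (g y))" if "smooth_on U h" for h :: "real \<times> real \<Rightarrow> real"
      by (rule differentiable_of_order_compose[OF *(4) U gV Suc.IH]) (use that in \<open>simp add: smooth_on_def\<close>)
    have sa: "smooth_on U a" "smooth_on U b" unfolding a_def b_def by (rule smooth_on_derivative[OF f])+
    note sm = smooth_on_fst[OF U sa(1)] smooth_on_fst[OF U sa(2)] smooth_on_snd[OF U sa(1)] smooth_on_snd[OF U sa(2)]
    have sdt: "smooth_on U dt" unfolding dt_def by (intro smooth_on_diff smooth_on_mult U sm)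
    have odt: "differentiable_of_order n V (\<lambda>y. inverse (dt (g y)))"
    proof (rule differentiable_of_order_compose[OF *(4) _ _ ord[OF sdt]])
      show "differentiable_of_order n (- {0::real}) inverse"
        using smooth_on_inverse[of "- {0::real}" "\<lambda>x. x"] smooth_on_id[of "-{0::real}"] by (auto simp: smooth_on_def)
    qed (use dt in auto)
    have rr: "(\<lambda>y. I y w) = (\<lambda>y. ((fst w * snd (b (g y)) + - (snd w * fst (b (g y)))) * inverse (dt (g y))) *\<^sub>R (1, 0) +
      ((snd w * fst (a (g y)) + - (fst w * snd (a (g y)))) * inverse (dt (g y))) *\<^sub>R (0, 1))" for w
      by (auto simp: I_def divide_inverse fun_eq_iff algebra_simps)
    show ?case
    proof (rule differentiable_of_order_Suc_intro[OF *(4)])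
      show "(g has_derivative I y) (at y)" if "y \<in> V" for y
        using dg[OF that] g'I[OF that] by (metis (no_types, lifting) ext)
      show "differentiable_of_order n V (\<lambda>y. I y w)" for w
        unfolding rr
        by (intro differentiable_of_order_add *(4) differentiable_of_order_const ord sm odt
           bounded_bilinear.differentiable_of_order_bilinear[OF bounded_bilinear_scaleR]
           bounded_bilinear.differentiable_of_order_bilinear[OF bounded_bilinear_mult]
           bounded_linear.differentiable_of_order_linear[OF bounded_linear_minus[OF bounded_linear_ident]])
    qed
  qed
  then show ?thesis using that * by (auto simp: smooth_on_def)
qed

section \<open>Local arcs\<close>

lemma curve_boundaryE:
  assumes "p \<in> curve_boundary A"
  obtains U V and \<phi> \<psi> :: "real \<times> real \<Rightarrow> real \<times> real"
    where "homeomorphism U V \<phi> \<psi>" "open U" "open V" "p \<in> U" "\<phi> p = 0"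
    "\<phi> ` (A \<inter> U) = V \<inter> ({0..} \<times> {0})"
  using assms unfolding curve_boundary_def local_arc_def
  by (elim CollectE exE conjE) (rule that, assumption+)

lemma plane_chart:
  fixes x h :: "real \<times> real \<Rightarrow> real"
  assumes U: "open U" and x: "smooth_on U x" and h: "smooth_on U h" and z0: "z0 \<in> U"
    and indep: "\<And>v. frechet_derivative x (at z0) v = 0 \<Longrightarrow> frechet_derivative h (at z0) v = 0 \<Longrightarrow> v = 0"
  obtains U' V \<psi> where "open U'" "U' \<subseteq> U" "z0 \<in> U'" "open V" "homeomorphism U' V (\<lambda>z. (x z, h z)) \<psi>"
    "smooth_on U' (\<lambda>z. (x z, h z))" "smooth_on V \<psi>"
proof -
  have sm: "smooth_on U (\<lambda>z. (x z, h z))" by (rule smooth_on_Pair[OF U x h])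
  have "((\<lambda>z. (x z, h z)) has_derivative (\<lambda>v. (frechet_derivative x (at z0) v, frechet_derivative h (at z0) v))) (at z0)"
    by (intro has_derivative_Pair smooth_on_has_derivative[OF x z0] smooth_on_has_derivative[OF h z0])
  from frechet_derivative_at[OF this, symmetric]
  have "v = 0" if "frechet_derivative (\<lambda>z. (x z, h z)) (at z0) v = 0" for v
    using that indep[of v] by (simp add: prod_eq_iff)
  then obtain U' V \<psi> where "open U'" "U' \<subseteq> U" "z0 \<in> U'" "open V"
    "homeomorphism U' V (\<lambda>z. (x z, h z)) \<psi>" "smooth_on V \<psi>"
    by (rule smooth_inverse_function[OF U sm z0])
  then show ?thesis using smooth_on_subset[OF sm] by (intro that)
qed

text \<open>In the chart \<open>(x, h)\<close> the set \<open>A\<close> is the open positive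
  half-axis, and closing it adds precisely the origin. The lemma serves both for the cords meeting
  the framing and for the cords meeting the knot.\<close>

lemma half_arc_closure:
  fixes x h :: "real \<times> real \<Rightarrow> real"
  assumes U: "open U" and x: "smooth_on U x" and h: "smooth_on U h" and z0: "z0 \<in> U"
    and x0: "x z0 = 0" and h0: "h z0 = 0"
    and indep: "\<And>v. frechet_derivative x (at z0) v = 0 \<Longrightarrow> frechet_derivative h (at z0) v = 0 \<Longrightarrow> v = 0"
    and A: "\<And>z. z \<in> U \<Longrightarrow> z \<in> A \<longleftrightarrow> x z > 0 \<and> h z = 0"
  shows "z0 \<in> curve_boundary (closure A)"
proof -
  obtain U' V \<psi> where *: "open U'" "U' \<subseteq> U" "z0 \<in> U'" "open V" "homeomorphism U' V (\<lambda>z. (x z, h z)) \<psi>"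
    "smooth_on U' (\<lambda>z. (x z, h z))" "smooth_on V \<psi>"
    by (rule plane_chart[OF U x h z0 indep])
  let ?\<phi> = "\<lambda>z. (x z, h z)"
  have cx: "continuous_on U' x" "continuous_on U' h"
    using smooth_on_continuous_on x h continuous_on_subset[OF _ *(2)] by blast+
  have "?\<phi> ` (closure A \<inter> U') = V \<inter> ({0..} \<times> {0})"
  proof (intro equalityI subsetI)
    fix y assume "y \<in> ?\<phi> ` (closure A \<inter> U')"
    then obtain z where z: "z \<in> closure A" "z \<in> U'" "y = ?\<phi> z" by auto
    have o: "open (U' \<inter> h -` (- {0}))" "open (U' \<inter> x -` {..<0})"
      using cx *(1) by (auto intro!: continuous_open_preimage)
    have "A \<inter> (U' \<inter> h -` (- {0})) = {}" "A \<inter> (U' \<inter> x -` {..<0}) = {}" using A *(2) by force+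
    with o have "h z = 0" "\<not> x z < 0"
      using z(1,2) unfolding closure_iff_nhds_not_empty by blast+
    then show "y \<in> V \<inter> ({0..} \<times> {0})" using z *(5) by (auto simp: homeomorphism_def)
  next
    fix y assume y: "y \<in> V \<inter> ({0..} \<times> {0::real})"
    define z where "z = \<psi> y"
    have z: "z \<in> U'" "?\<phi> z = y" using y *(5) by (auto simp: homeomorphism_def z_def)
    have "z \<in> closure A"
      unfolding closure_iff_nhds_not_empty
    proof safe
      fix N W assume N: "W \<subseteq> N" "open W" "z \<in> W" and e: "A \<inter> N = {}"
      have "open (V \<inter> \<psi> -` (U' \<inter> W))"
        by (intro continuous_open_preimage homeomorphism_cont2[OF *(5)] open_Int N *)
      moreover have "y \<in> V \<inter> \<psi> -` (U' \<inter> W)" using y z N z_def by auto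
      ultimately obtain e where e: "e > 0" "ball y e \<subseteq> V \<inter> \<psi> -` (U' \<inter> W)" by (meson openE)
      \<comment> \<open>A step to the right reaches the open half-axis even when \<open>y\<close> is
        its endpoint.\<close>
      let ?y = "(fst y + e/2, 0)"
      have "?y \<in> ball y e" using y e by (auto simp: dist_Pair_Pair dist_real_def)
      then have w: "?y \<in> V" "\<psi> ?y \<in> U'" "\<psi> ?y \<in> W" using e by auto
      then have "?\<phi> (\<psi> ?y) = ?y" using *(5) by (auto simp: homeomorphism_def)
      then have "\<psi> ?y \<in> A" using A[of "\<psi> ?y"] w *(2) y e by auto
      then show False using w N(1) \<open>A \<inter> N = {}\<close> by auto
    qed
    then show "y \<in> ?\<phi> ` (closure A \<inter> U')" using z by force
  qed
  then have "local_arc {0..} z0 (frechet_derivative \<psi> (at 0) (1, 0)) (closure A)"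
    unfolding local_arc_def using * x0 h0 
    by (intro exI[of _ U'] exI[of _ V] exI[of _ ?\<phi>] exI[of _ \<psi>]) (auto simp: zero_prod_def)
  then show ?thesis unfolding curve_boundary_def by (intro CollectI exI)
qed

text \<open>The second claim is that an arc has no end at an interior point. A half-line stays
  connected when its end is removed, while a line does not: a coordinate that is nonzero on the
  punctured half-arc cannot take both signs.\<close>

lemma regular_point_arc:
  fixes h :: "real \<times> real \<Rightarrow> real"
  assumes U: "open U" and h: "smooth_on U h" and z0: "z0 \<in> U" and h0: "h z0 = 0"
    and dh: "frechet_derivative h (at z0) v0 \<noteq> 0"
    and A: "\<And>z. z \<in> U \<Longrightarrow> z \<in> A \<longleftrightarrow> h z = 0"
  shows "z0 \<in> curve_interior A" "z0 \<notin> curve_boundary A"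
proof -
  let ?h' = "frechet_derivative h (at z0)"
  have lin: "linear ?h'" using smooth_on_has_derivative[OF h z0] has_derivative_linear by blast
  note rep = linear_real2[OF lin]
  \<comment> \<open>A complementary coordinate: one of the two translated projections has a
    differential independent of that of \<open>h\<close>.\<close>
  obtain x :: "real \<times> real \<Rightarrow> real" where x: "smooth_on U x" "x z0 = 0"
    "\<And>v. frechet_derivative x (at z0) v = 0 \<Longrightarrow> ?h' v = 0 \<Longrightarrow> v = 0"
  proof (cases "?h' (1, 0) = 0")
    case True
    have ax: "frechet_derivative (\<lambda>z. fst z - fst z0) (at z0) = fst"
      by (rule frechet_derivative_at[symmetric]) (auto intro!: derivative_eq_intros)
    show ?thesis
    proof (rule that[of "\<lambda>z. fst z - fst z0"])
      fix v assume v: "frechet_derivative (\<lambda>z. fst z - fst z0) (at z0) v = 0" "?h' v = 0"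
      have "?h' (0, 1) \<noteq> 0" using dh True rep[of v0] by auto
      then show "v = 0" using v True rep[of v] by (simp add: ax prod_eq_iff)
    qed (auto intro!: smooth_on_diff smooth_on_fst smooth_on_id U)
  next
    case False
    have ax: "frechet_derivative (\<lambda>z. snd z - snd z0) (at z0) = snd"
      by (rule frechet_derivative_at[symmetric]) (auto intro!: derivative_eq_intros)
    show ?thesis
    proof (rule that[of "\<lambda>z. snd z - snd z0"])
      fix v assume v: "frechet_derivative (\<lambda>z. snd z - snd z0) (at z0) v = 0" "?h' v = 0"
      then show "v = 0" using False rep[of v] by (simp add: ax prod_eq_iff)
    qed (auto intro!: smooth_on_diff smooth_on_snd smooth_on_id U)
  qed
  obtain U' V \<psi> where *: "open U'" "U' \<subseteq> U" "z0 \<in> U'" "open V" "homeomorphism U' V (\<lambda>z. (x z, h z)) \<psi>"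
    "smooth_on U' (\<lambda>z. (x z, h z))" "smooth_on V \<psi>"
    by (rule plane_chart[OF U x(1) h z0 x(3)])
  let ?\<phi> = "\<lambda>z. (x z, h z)"
  have \<psi>: "\<psi> y \<in> U'" "x (\<psi> y) = fst y" "h (\<psi> y) = snd y" if "y \<in> V" for y
    using homeomorphism_apply2[OF *(5) that] homeomorphism_image2[OF *(5)] that by (auto simp: prod_eq_iff)
  have \<phi>: "?\<phi> z \<in> V" "\<psi> (?\<phi> z) = z" if "z \<in> U'" for z
    using homeomorphism_apply1[OF *(5) that] homeomorphism_image1[OF *(5)] that by auto
  have AV: "?\<phi> ` (A \<inter> U') = V \<inter> (UNIV \<times> {0})"
  proof (intro equalityI subsetI)
    fix y assume "y \<in> ?\<phi> ` (A \<inter> U')"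
    then show "y \<in> V \<inter> (UNIV \<times> {0})" using \<phi> A *(2) by auto
  next
    fix y assume "y \<in> V \<inter> (UNIV \<times> {0::real})"
    then show "y \<in> ?\<phi> ` (A \<inter> U')"
      using \<psi>[of y] A[of "\<psi> y"] *(2) by (intro image_eqI[of _ _ "\<psi> y"]) auto
  qed
  then have "local_arc UNIV z0 (frechet_derivative \<psi> (at 0) (1, 0)) A"
    unfolding local_arc_def using * x(2) h0
    by (intro exI[of _ U'] exI[of _ V] exI[of _ ?\<phi>] exI[of _ \<psi>]) (auto simp: zero_prod_def)
  then show "z0 \<in> curve_interior A" unfolding curve_interior_def by (intro CollectI exI)
  show "z0 \<notin> curve_boundary A"
  proof
    assume "z0 \<in> curve_boundary A"
    then obtain U2 V2 and \<phi>2 \<psi>2 :: "real \<times> real \<Rightarrow> real \<times> real" where 2: "open U2" "open V2" "z0 \<in> U2" "homeomorphism U2 V2 \<phi>2 \<psi>2"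
      "\<phi>2 z0 = 0" and A2: "\<phi>2 ` (A \<inter> U2) = V2 \<inter> ({0..} \<times> {0})"
      by (rule curve_boundaryE)
    have \<psi>2: "\<psi>2 y \<in> U2" "\<phi>2 (\<psi>2 y) = y" if "y \<in> V2" for y
      using homeomorphism_apply2[OF 2(4) that] homeomorphism_image2[OF 2(4)] that by auto
    have \<phi>2: "\<phi>2 z \<in> V2" "\<psi>2 (\<phi>2 z) = z" if "z \<in> U2" for z
      using homeomorphism_apply1[OF 2(4) that] homeomorphism_image1[OF 2(4)] that by auto
    have c2: "continuous_on V2 \<psi>2" "continuous_on U2 \<phi>2" using 2(4) by (auto simp: homeomorphism_def)
    have cx: "continuous_on U x" using smooth_on_continuous_on x by blast
    have c\<psi>: "continuous_on V \<psi>" using *(5) by (auto simp: homeomorphism_def)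
    have o2: "open (V2 \<inter> \<psi>2 -` (U2 \<inter> U'))"
      by (intro continuous_open_preimage c2 2 open_Int *(1))
    have z00: "0 \<in> V2" "\<psi>2 0 = z0" using \<phi>2[OF 2(3)] 2(5) by simp_all
    then have "0 \<in> V2 \<inter> \<psi>2 -` (U2 \<inter> U')" using *(3) 2(3) by simp
    then obtain e where e: "e > 0" "ball 0 e \<subseteq> V2 \<inter> \<psi>2 -` (U2 \<inter> U')"
      by (rule openE[OF o2])
    \<comment> \<open>The transition from the half-line chart to the coordinate \<open>x\<close>
      along the arc, considered on the punctured half-line only.\<close>
    define k where "k \<xi> = x (\<psi>2 (\<xi>, 0))" for \<xi>
    have in_e: "(\<xi>, 0) \<in> V2" "\<psi>2 (\<xi>, 0) \<in> U2" "\<psi>2 (\<xi>, 0) \<in> U'" if "\<xi> \<in> {0<..<e}" for \<xi>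
    proof -
      have "(\<xi>, 0) \<in> ball 0 e" using that by (auto simp: zero_prod_def dist_Pair_Pair)
      then have "(\<xi>, 0) \<in> V2 \<inter> \<psi>2 -` (U2 \<inter> U')" by (rule subsetD[OF e(2)])
      then show "(\<xi>, 0) \<in> V2" "\<psi>2 (\<xi>, 0) \<in> U2" "\<psi>2 (\<xi>, 0) \<in> U'" by simp_all
    qed
    have k0: "k \<xi> \<noteq> 0" if "\<xi> \<in> {0<..<e}" for \<xi>
    proof
      assume k: "k \<xi> = 0"
      have "(\<xi>, 0) \<in> \<phi>2 ` (A \<inter> U2)" using in_e[OF that] that A2 by auto
      then have "\<psi>2 (\<xi>, 0) \<in> A" using \<phi>2 by auto
      then have "h (\<psi>2 (\<xi>, 0)) = 0" using A[of "\<psi>2 (\<xi>, 0)"] in_e[OF that] *(2) by blast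
      then have "?\<phi> (\<psi>2 (\<xi>, 0)) = ?\<phi> z0" using k x(2) h0 by (simp add: k_def)
      then have "\<psi>2 (\<xi>, 0) = z0" using \<phi>[OF *(3)] \<phi>[OF in_e(3)[OF that]] by simp
      then have "(\<xi>, 0) = (0 :: real \<times> real)" using \<psi>2(2)[OF in_e(1)[OF that]] 2(5) by simp
      then show False using that by (simp add: zero_prod_def)
    qed
    have ck: "continuous_on {0<..<e} k"
      unfolding k_def
      by (rule continuous_on_compose2[OF cx], rule continuous_on_compose2[OF c2(1)])
        (use in_e *(2) in \<open>auto intro!: continuous_intros\<close>)
    have o1: "open (V \<inter> \<psi> -` (U' \<inter> U2 \<inter> \<phi>2 -` ball 0 e))"
    proof -
      have "open (U2 \<inter> \<phi>2 -` ball 0 e)" by (intro continuous_open_preimage c2 2 open_ball)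
      then have "open (U' \<inter> (U2 \<inter> \<phi>2 -` ball 0 e))" using *(1) by blast
      then have "open (V \<inter> \<psi> -` (U' \<inter> (U2 \<inter> \<phi>2 -` ball 0 e)))"
        by (intro continuous_open_preimage c\<psi> *(4))
      then show ?thesis by (simp add: Int_assoc)
    qed
    have "(0, 0) \<in> V" "\<psi> (0, 0) = z0" using \<phi>[OF *(3)] x(2) h0 by simp_all
    then have "0 \<in> V \<inter> \<psi> -` (U' \<inter> U2 \<inter> \<phi>2 -` ball 0 e)"
      using *(3) 2(3,5) e(1) by (simp add: zero_prod_def)
    then obtain d where d: "d > 0" "ball 0 d \<subseteq> V \<inter> \<psi> -` (U' \<inter> U2 \<inter> \<phi>2 -` ball 0 e)"
      by (rule openE[OF o1])
    \<comment> \<open>Both charts describe the same set near \<open>z0\<close>, so every small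
      nonzero coordinate, of either sign, comes from a positive parameter of the half-line.\<close>
    have hit: "\<exists>\<xi>\<in>{0<..<e}. k \<xi> = \<eta>" if \<eta>: "\<bar>\<eta>\<bar> < d" "\<eta> \<noteq> 0" for \<eta>
    proof -
      have "(\<eta>, 0) \<in> ball 0 d" using \<eta> by (auto simp: zero_prod_def dist_Pair_Pair)
      then have "(\<eta>, 0) \<in> V \<inter> \<psi> -` (U' \<inter> U2 \<inter> \<phi>2 -` ball 0 e)" by (rule subsetD[OF d(2)])
      then have w: "(\<eta>, 0) \<in> V" "\<psi> (\<eta>, 0) \<in> U'" "\<psi> (\<eta>, 0) \<in> U2" "\<phi>2 (\<psi> (\<eta>, 0)) \<in> ball 0 e"
        by simp_all
      have "\<psi> (\<eta>, 0) \<in> A" using A[of "\<psi> (\<eta>, 0)"] \<psi>[OF w(1)] *(2) by auto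
      then have "\<phi>2 (\<psi> (\<eta>, 0)) \<in> V2 \<inter> ({0..} \<times> {0})" using A2 w by auto
      then obtain \<xi> where \<xi>: "\<phi>2 (\<psi> (\<eta>, 0)) = (\<xi>, 0)" "\<xi> \<ge> 0" by auto
      have "k \<xi> = \<eta>" unfolding k_def \<xi>(1)[symmetric] using \<phi>2[OF w(3)] \<psi>[OF w(1)] by simp
      moreover have "\<xi> < e" using w(4) \<xi> by (auto simp: zero_prod_def dist_Pair_Pair)
      moreover have "\<xi> \<noteq> 0"
      proof
        assume "\<xi> = 0"
        then have "k \<xi> = x z0" using z00 by (simp add: k_def zero_prod_def)
        then show False using x(2) \<open>k \<xi> = \<eta>\<close> \<eta> by simp
      qed
      ultimately show ?thesis using \<xi> by force
    qed
    obtain p q where pq: "p \<in> {0<..<e}" "q \<in> {0<..<e}" "k p < 0" "0 < k q"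
      using hit[of "d/2"] hit[of "-d/2"] d(1) by auto
    have "connected (k ` {0<..<e})" by (intro connected_continuous_image ck connected_Ioo)
    then have "0 \<in> k ` {0<..<e}"
      using connectedD_interval[of "k ` {0<..<e}" "k p" "k q" 0] pq by auto
    then show False using k0 by auto
  qed
qed

text \<open>A single branch is a legitimate family \<open>T\<close>, for which pairwise
  transversality is vacuous.\<close>

lemma curve_boundary_subset_immersed: "curve_boundary A \<subseteq> immersed_curve_boundary A"
proof
  fix p assume "p \<in> curve_boundary A"
  then obtain v where "local_arc {0..} p v A" by (auto simp: curve_boundary_def)
  then show "p \<in> immersed_curve_boundary A"
    unfolding immersed_curve_boundary_def
    by (intro CollectI exI[of _ UNIV] exI[of _ "{v}"] exI[of _ "\<lambda>_. A"] exI[of _ "\<lambda>_. {0..}"]) auto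
qed

text \<open>Membership is not demanded by \<open>local_arc\<close>; it follows because the origin
  belongs to the half-axis and the chart is injective.\<close>

lemma curve_boundary_subset:
  "curve_boundary A \<subseteq> A"
proof
  fix p assume "p \<in> curve_boundary A"
  then obtain U V and \<phi> \<psi> :: "real \<times> real \<Rightarrow> real \<times> real" where *: "p \<in> U" "homeomorphism U V \<phi> \<psi>" "\<phi> p = 0" "\<phi> ` (A \<inter> U) = V \<inter> ({0..} \<times> {0})"
    by (rule curve_boundaryE)
  have "0 \<in> V" using homeomorphism_image1[OF *(2)] *(1,3) by (metis imageI)
  then have "\<phi> p \<in> \<phi> ` (A \<inter> U)" using *(3,4) by (auto simp: zero_prod_def)
  then obtain q where q: "\<phi> p = \<phi> q" "q \<in> A" "q \<in> U" by (elim imageE IntE)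
  have "p = \<psi> (\<phi> p)" using homeomorphism_apply1[OF *(2,1)] by (rule sym)
  also have "\<dots> = q" unfolding q(1) by (rule homeomorphism_apply1[OF *(2) q(3)])
  finally show "p \<in> A" using q(2) by simp
qed

section \<open>Genericity in the $C^\infty$ topology\<close>

lemma periodic_int:
  fixes f :: "real \<Rightarrow> 'a"
  assumes "\<And>x. f (x + T) = f x"
  shows "f (x + of_int k * T) = f x"
proof -
  have n: "f (x + of_nat n * T) = f x" for n x
  proof (induction n)
    case (Suc n)
    have "f (x + of_nat (Suc n) * T) = f ((x + of_nat n * T) + T)" by (simp add: algebra_simps)
    then show ?case using Suc assms by simp
  qed simp
  show ?thesis
  proof (cases k)
    case (nonneg n)
    then show ?thesis using n by simp
  next
    case (neg n)
    have "f (x + of_int k * T) = f ((x + of_int k * T) + of_nat (Suc n) * T)" by (rule n[symmetric])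
    also have "(x + of_int k * T) + of_nat (Suc n) * T = x"
    proof -
      have z: "(of_int k + of_nat (Suc n) :: real) = 0" using neg by simp
      have "(x + of_int k * T) + of_nat (Suc n) * T = x + (of_int k + of_nat (Suc n)) * T"
        by (simp only: distrib_right add.assoc)
      then show ?thesis by (simp only: z mult_zero_left add_0_right)
    qed
    finally show ?thesis .
  qed
qed

lemma periodic_reduce:
  fixes x T :: real
  assumes "T > 0"
  obtains k :: int where "x + of_int k * T \<in> {0..T}"
proof
  have "of_int \<lfloor>x / T\<rfloor> * T \<le> x" "x \<le> (of_int \<lfloor>x / T\<rfloor> + 1) * T"
    using floor_divide_lower[OF assms, of x] floor_divide_upper[OF assms, of x] by simp_all
  then show "x + of_int (- \<lfloor>x / T\<rfloor>) * T \<in> {0..T}" by (simp add: algebra_simps)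
qed

lemma vderiv_periodic:
  fixes f :: "real \<Rightarrow> 'a::real_normed_vector"
  assumes f: "smooth_on UNIV f" and per: "\<And>x. f (x + T) = f x"
  shows "vderiv f (x + T) = vderiv f x"
proof -
  have "((\<lambda>y. y + T) has_vector_derivative 1) (at x)" by (auto intro!: derivative_eq_intros)
  moreover have "(f has_vector_derivative vderiv f (x + T)) (at (x + T))"
    using smooth_on_has_vderiv[OF f] by simp
  ultimately have "(f \<circ> (\<lambda>y. y + T) has_vector_derivative 1 *\<^sub>R vderiv f (x + T)) (at x)"
    by (rule vector_diff_chain_at)
  moreover have "f \<circ> (\<lambda>y. y + T) = f" using per by auto
  ultimately show ?thesis using vector_derivative_at by force
qed

lemma vderiv_funpow_periodic:
  fixes f :: "real \<Rightarrow> 'a::real_normed_vector"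
  assumes "smooth_on UNIV f" "\<And>x. f (x + T) = f x"
  shows "(vderiv ^^ k) f (x + T) = (vderiv ^^ k) f x"
proof (induction k arbitrary: x)
  case (Suc k)
  show ?case
    using vderiv_periodic[OF smooth_on_vderiv_funpow[OF assms(1)] Suc] by simp
qed (simp add: assms)

text \<open>Reduction of a bound on the whole line to one period, where compactness is
  available.\<close>

lemma norm_vderiv_funpow_less:
  fixes f :: "real \<Rightarrow> 'a::real_normed_vector"
  assumes "T > 0" "f \<in> Y" "g \<in> Y"
    and Y: "\<And>f. f \<in> Y \<Longrightarrow> smooth_on UNIV f \<and> (\<forall>x. f (x + T) = f x)"
    and le: "\<And>x. x \<in> {0..T} \<Longrightarrow> norm ((vderiv ^^ k) g x - (vderiv ^^ k) f x) < e"
  shows "norm ((vderiv ^^ k) g x - (vderiv ^^ k) f x) < e"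
proof -
  obtain j where "x + of_int j * T \<in> {0..T}" using periodic_reduce[OF assms(1)] .
  then have "norm ((vderiv ^^ k) g (x + of_int j * T) - (vderiv ^^ k) f (x + of_int j * T)) < e" by (rule le)
  moreover have "(vderiv ^^ k) h (x + of_int j * T) = (vderiv ^^ k) h x" if "h \<in> Y" for h
    by (rule periodic_int, rule vderiv_funpow_periodic) (use Y[OF that] in auto)
  ultimately show ?thesis using assms(2,3) by simp
qed

text \<open>Common ground for knot embeddings (period 1) and framings (period \<open>L\<close>). The
  maps in \<open>X\<close> need not form a vector space, so perturbations are supplied separately in
  each case.\<close>

locale smooth_periodic_maps =
  fixes X :: "(real \<Rightarrow> 'a::real_normed_vector) set" and T :: real
  assumes T: "T > 0" and smooth: "\<And>f. f \<in> X \<Longrightarrow> smooth_on UNIV f"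
    and periodic: "\<And>f x. f \<in> X \<Longrightarrow> f (x + T) = f x"
begin

text \<open>A ball demands a strict bound at each point, not on the supremum. By periodicity the
  supremum is attained on a compact interval, so there is room left, measured by the smallest of
  finitely many gaps \<open>e - m k\<close>. Thus a generating set is a neighbourhood of each of its
  points.\<close>

lemma Cinf_ball_slack:
  assumes f: "f \<in> X" and g: "g \<in> Cinf_ball X n e f"
  shows "\<exists>d>0. Cinf_ball X n d g \<subseteq> Cinf_ball X n e f"
proof -
  have gX: "g \<in> X" and ge: "\<And>k x. k \<le> n \<Longrightarrow> norm ((vderiv ^^ k) g x - (vderiv ^^ k) f x) < e"
    using g by (auto simp: Cinf_ball_def)
  have "\<exists>m<e. \<forall>x\<in>{0..T}. norm ((vderiv ^^ k) g x - (vderiv ^^ k) f x) \<le> m" if k: "k \<le> n" for k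
  proof -
    have c: "continuous_on {0..T} ((vderiv ^^ k) h)" if "h \<in> X" for h
      using smooth_on_continuous_on[OF smooth_on_vderiv_funpow[OF smooth[OF that]]] continuous_on_subset by blast
    have "continuous_on {0..T} (\<lambda>x. norm ((vderiv ^^ k) g x - (vderiv ^^ k) f x))"
      by (intro continuous_intros c f gX)
    from continuous_attains_sup[OF compact_Icc _ this] T obtain x where
      "\<forall>y\<in>{0..T}. norm ((vderiv ^^ k) g y - (vderiv ^^ k) f y) \<le> norm ((vderiv ^^ k) g x - (vderiv ^^ k) f x)"
      by fastforce
    then show ?thesis using ge[OF k, of x] by blast
  qed
  then obtain m where m: "\<And>k. k \<le> n \<Longrightarrow> m k < e"
    "\<And>k x. k \<le> n \<Longrightarrow> x \<in> {0..T} \<Longrightarrow> norm ((vderiv ^^ k) g x - (vderiv ^^ k) f x) \<le> m k" by metis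
  define d where "d = Min ((\<lambda>k. e - m k) ` {..n})"
  have "d > 0" unfolding d_def by (subst Min_gr_iff) (use m in auto)
  moreover have d: "d \<le> e - m k" if "k \<le> n" for k unfolding d_def by (rule Min_le) (use that in auto)
  have "h \<in> Cinf_ball X n e f" if h: "h \<in> Cinf_ball X n d g" for h
  proof -
    have hX: "h \<in> X" and hd: "\<And>k x. k \<le> n \<Longrightarrow> norm ((vderiv ^^ k) h x - (vderiv ^^ k) g x) < d"
      using h by (auto simp: Cinf_ball_def)
    have "norm ((vderiv ^^ k) h x - (vderiv ^^ k) f x) < e" if k: "k \<le> n" for k x
    proof (rule norm_vderiv_funpow_less[OF T f hX])
      fix x assume x: "x \<in> {0..T}"
      have "norm ((vderiv ^^ k) h x - (vderiv ^^ k) f x)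
        \<le> norm ((vderiv ^^ k) h x - (vderiv ^^ k) g x) + norm ((vderiv ^^ k) g x - (vderiv ^^ k) f x)"
        using norm_triangle_ineq[of "(vderiv ^^ k) h x - (vderiv ^^ k) g x" "(vderiv ^^ k) g x - (vderiv ^^ k) f x"] by simp
      then show "norm ((vderiv ^^ k) h x - (vderiv ^^ k) f x) < e"
        using hd[OF k, of x] m(2)[OF k x] d[OF k] by linarith
    qed (use smooth periodic in auto)
    then show ?thesis using hX by (simp add: Cinf_ball_def)
  qed
  ultimately show ?thesis by blast
qed

lemma Cinf_ball_mono: "m \<le> n \<Longrightarrow> d \<le> e \<Longrightarrow> Cinf_ball X n d f \<subseteq> Cinf_ball X m e f"
  unfolding Cinf_ball_def by (auto) (meson less_le_trans order_trans)

lemma Cinf_open_contains_ball: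
  assumes "openin (Cinf_topology X) W" "g \<in> W"
  shows "\<exists>n. \<exists>e>0. Cinf_ball X n e g \<subseteq> W"
proof -
  have "generate_topology_on {Cinf_ball X n e f |n e f. 0 < e \<and> f \<in> X} W"
    using assms(1) by (simp add: Cinf_topology_def openin_topology_generated_by_iff)
  then show ?thesis using assms(2)
  proof (induction arbitrary: g rule: generate_topology_on.induct)
    case (Int a b)
    then obtain n e m d where *: "e > 0" "Cinf_ball X n e g \<subseteq> a" "d > 0" "Cinf_ball X m d g \<subseteq> b"
      by (meson IntE)
    have "Cinf_ball X (max n m) (min e d) g \<subseteq> a \<inter> b"
      using * Cinf_ball_mono[of n "max n m" "min e d" e g] Cinf_ball_mono[of m "max n m" "min e d" d g] by auto
    then show ?case using * by (intro exI[of _ "max n m"] exI[of _ "min e d"]) auto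
  next
    case (UN K)
    then show ?case by (meson Union_iff Union_upper subset_trans)
  next
    case (Basis s)
    then obtain n e f where s: "s = Cinf_ball X n e f" "f \<in> X" by blast
    then show ?case using Cinf_ball_slack[OF s(2)] Basis(2) by blast
  qed simp
qed

lemma Cinf_ball_center: "f \<in> X \<Longrightarrow> e > 0 \<Longrightarrow> f \<in> Cinf_ball X n e f"
  by (simp add: Cinf_ball_def)

lemma Cinf_openI:
  assumes "W \<subseteq> X" "\<And>g. g \<in> W \<Longrightarrow> \<exists>n. \<exists>e>0. Cinf_ball X n e g \<subseteq> W"
  shows "openin (Cinf_topology X) W"
proof (subst openin_subopen, intro ballI)
  fix g assume g: "g \<in> W"
  then obtain n e where e: "e > 0" "Cinf_ball X n e g \<subseteq> W" using assms(2) by blast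
  have "openin (Cinf_topology X) (Cinf_ball X n e g)"
    unfolding Cinf_topology_def
    by (rule topology_generated_by_Basis) (use e g assms(1) in blast)
  then show "\<exists>U. openin (Cinf_topology X) U \<and> g \<in> U \<and> U \<subseteq> W"
    using e g assms(1) Cinf_ball_center by blast
qed

lemma Cinf_dense:
  assumes "W \<subseteq> X" "\<And>g n e. g \<in> X \<Longrightarrow> e > 0 \<Longrightarrow> Cinf_ball X n e g \<inter> W \<noteq> {}"
  shows "Cinf_topology X closure_of W = X"
proof (intro equalityI subsetI)
  show "f \<in> X" if "f \<in> Cinf_topology X closure_of W" for f
    using that closure_of_subset_topspace[of "Cinf_topology X" W] by auto
  show "f \<in> Cinf_topology X closure_of W" if f: "f \<in> X" for f
    unfolding in_closure_of
  proof (intro conjI allI impI)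
    fix U assume U: "f \<in> U \<and> openin (Cinf_topology X) U"
    then obtain n e where "e > 0" "Cinf_ball X n e f \<subseteq> U" using Cinf_open_contains_ball by blast
    then show "\<exists>y. y \<in> W \<and> y \<in> U" using assms(2)[OF f, of e n] by blast
  qed (use f in simp)
qed

text \<open>Over a compact \<open>W\<close> the norm of \<open>\<Phi> c\<close> has a positive
  minimum, and a map close to \<open>c\<close> changes \<open>\<Phi>\<close> by less. The Lipschitz
  factor \<open>K\<close> may vary with the point and is bounded over \<open>W\<close> as
  well.\<close>

lemma open_avoid_compact:
  fixes \<Phi> :: "(real \<Rightarrow> 'a) \<Rightarrow> 'z::metric_space \<Rightarrow> 'e::real_normed_vector"
  assumes W: "compact W" and cont: "\<And>c. c \<in> X \<Longrightarrow> continuous_on W (\<Phi> c)"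
    and K: "continuous_on W K"
    and est: "\<And>c g z e. c \<in> X \<Longrightarrow> g \<in> Cinf_ball X n e c \<Longrightarrow> z \<in> W \<Longrightarrow> 0 < e \<Longrightarrow>
      norm (\<Phi> g z - \<Phi> c z) \<le> K z * e"
  shows "openin (Cinf_topology X) {c\<in>X. \<forall>z\<in>W. \<Phi> c z \<noteq> 0}"
proof (rule Cinf_openI)
  fix c assume "c \<in> {c\<in>X. \<forall>z\<in>W. \<Phi> c z \<noteq> 0}"
  then have c: "c \<in> X" "\<And>z. z \<in> W \<Longrightarrow> \<Phi> c z \<noteq> 0" by auto
  show "\<exists>n. \<exists>e>0. Cinf_ball X n e c \<subseteq> {c\<in>X. \<forall>z\<in>W. \<Phi> c z \<noteq> 0}"
  proof (cases "W = {}")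
    case True
    then show ?thesis by (intro exI[of _ 0] exI[of _ 1]) (auto simp: Cinf_ball_def)
  next
    case False
    obtain w where w: "w \<in> W" "\<And>z. z \<in> W \<Longrightarrow> norm (\<Phi> c w) \<le> norm (\<Phi> c z)"
      using continuous_attains_inf[OF W False continuous_on_norm[OF cont[OF c(1)]]] by blast
    obtain M where M: "\<And>z. z \<in> W \<Longrightarrow> K z \<le> M"
      using continuous_attains_sup[OF W False K] by blast
    \<comment> \<open>The added 1 keeps the quotient defined for \<open>M = 0\<close> and makes the
      final inequality strict.\<close>
    define e where "e = norm (\<Phi> c w) / (\<bar>M\<bar> + 1)"
    have e: "e > 0" "\<bar>M\<bar> * e < norm (\<Phi> c w)"
      using c(2)[OF w(1)] by (simp_all add: e_def field_simps)
    have "g \<in> {c\<in>X. \<forall>z\<in>W. \<Phi> c z \<noteq> 0}" if g: "g \<in> Cinf_ball X n e c" for g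
    proof -
      have "\<Phi> g z \<noteq> 0" if z: "z \<in> W" for z
      proof
        assume "\<Phi> g z = 0"
        then have "norm (\<Phi> c z) \<le> K z * e" using est[OF c(1) g z e(1)] by simp
        also have "\<dots> \<le> \<bar>M\<bar> * e" using M[OF z] e(1) by (intro mult_right_mono) auto
        finally show False using w(2)[OF z] e(2) by linarith
      qed
      then show ?thesis using g by (auto simp: Cinf_ball_def)
    qed
    then show ?thesis using e(1) by blast
  qed
qed auto

text \<open>\<open>D\<close> need be neither open nor closed. Around each of its points density is
  known over an open \<open>W\<close>; shrinking \<open>W\<close> to a closed ball keeps density and
  gains openness, and the Lindelof property leaves countably many balls.\<close>

lemma residual_avoid:
  fixes \<Phi> :: "(real \<Rightarrow> 'a) \<Rightarrow> 'z::euclidean_space \<Rightarrow> 'e::real_normed_vector"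
  assumes cont: "\<And>c. c \<in> X \<Longrightarrow> continuous_on UNIV (\<Phi> c)"
    and K: "continuous_on UNIV K"
    and est: "\<And>c g z e. c \<in> X \<Longrightarrow> g \<in> Cinf_ball X n e c \<Longrightarrow> 0 < e \<Longrightarrow> norm (\<Phi> g z - \<Phi> c z) \<le> K z * e"
    and dense: "\<And>z0. z0 \<in> D \<Longrightarrow> \<exists>W. open W \<and> z0 \<in> W \<and>
      (\<forall>c\<in>X. \<forall>k e. 0 < e \<longrightarrow> (\<exists>g\<in>Cinf_ball X k e c. \<forall>z\<in>W. \<Phi> g z \<noteq> 0))"
  shows "\<exists>R. residual_in (Cinf_topology X) R \<and> (\<forall>c\<in>R. \<forall>z\<in>D. \<Phi> c z \<noteq> 0)"
proof -
  obtain W where W: "\<And>z. z \<in> D \<Longrightarrow> open (W z) \<and> z \<in> W z \<and>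
      (\<forall>c\<in>X. \<forall>k e. 0 < e \<longrightarrow> (\<exists>g\<in>Cinf_ball X k e c. \<forall>w\<in>W z. \<Phi> g w \<noteq> 0))"
    using dense by metis
  have "\<exists>r>0. cball z r \<subseteq> W z" if "z \<in> D" for z
    using W[OF that] open_contains_cball by metis
  then obtain r where r: "\<And>z. z \<in> D \<Longrightarrow> r z > 0 \<and> cball z (r z) \<subseteq> W z" by metis
  define \<F> where "\<F> = (\<lambda>z. ball z (r z)) ` D"
  obtain \<F>' where F': "\<F>' \<subseteq> \<F>" "countable \<F>'" "\<Union>\<F>' = \<Union>\<F>"
  proof (rule Lindelof)
    show "open S" if "S \<in> \<F>" for S using that unfolding \<F>_def by (elim imageE) simp
  qed
  from F'(1,2) have "\<exists>D'. countable D' \<and> D' \<subseteq> D \<and> \<F>' = (\<lambda>z. ball z (r z)) ` D'"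
    unfolding \<F>_def by (simp only: countable_subset_image[symmetric])
  then obtain D' where D': "D' \<subseteq> D" "countable D'" "\<F>' = (\<lambda>z. ball z (r z)) ` D'" by (elim exE conjE)
  have cover: "D \<subseteq> (\<Union>z\<in>D'. ball z (r z))"
  proof
    fix z assume z: "z \<in> D"
    then have "z \<in> \<Union>\<F>" using r[OF z] unfolding \<F>_def by (intro UnionI[OF imageI]) auto
    then show "z \<in> (\<Union>z\<in>D'. ball z (r z))" unfolding F'(3)[symmetric] D'(3) .
  qed
  define G where "G z = {c\<in>X. \<forall>w\<in>cball z (r z). \<Phi> c w \<noteq> 0}" for z
  have "openin (Cinf_topology X) (G z)" for z
    unfolding G_def
    by (rule open_avoid_compact[where K = K and n = n])
      (use cont K est in \<open>auto intro: continuous_on_subset\<close>)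
  moreover have "Cinf_topology X closure_of (G z) = X" if zD: "z \<in> D'" for z
  proof (rule Cinf_dense)
    fix g and k :: nat and e :: real assume "g \<in> X" "e > 0"
    then obtain g' where "g' \<in> Cinf_ball X k e g" "\<forall>w\<in>W z. \<Phi> g' w \<noteq> 0" using W[of z] zD D'(1) by blast
    moreover have "cball z (r z) \<subseteq> W z" using r zD D'(1) by blast
    ultimately have "g' \<in> Cinf_ball X k e g \<inter> G z" by (auto simp: G_def Cinf_ball_def)
    then show "Cinf_ball X k e g \<inter> G z \<noteq> {}" by blast
  qed (auto simp: G_def)
  ultimately have "residual_in (Cinf_topology X) (X \<inter> \<Inter>(G ` D'))"
    unfolding residual_in_def using D'(2)
    by (intro conjI exI[of _ "G ` D'"]) auto
  moreover have "\<Phi> c z \<noteq> 0" if "c \<in> X \<inter> \<Inter>(G ` D')" "z \<in> D" for c z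
  proof -
    have "z \<in> (\<Union>z\<in>D'. ball z (r z))" using that(2) cover by (rule subsetD[rotated])
    then obtain z' where "z' \<in> D'" "z \<in> ball z' (r z')" by (elim UN_E)
    then show ?thesis using that(1) by (auto simp: G_def)
  qed
  ultimately show ?thesis by blast
qed

end

section \<open>Countable intersections and small finite-dimensional perturbations\<close>

lemma residual_in_INT_countable:
  assumes "\<And>n::nat. residual_in T (R n)"
  shows "residual_in T (\<Inter>n. R n)"
proof -
  have "\<forall>n. \<exists>\<U>. countable \<U> \<and> (\<forall>U\<in>\<U>. openin T U \<and> T closure_of U = topspace T) \<and> topspace T \<inter> \<Inter>\<U> \<subseteq> R n"
    using assms unfolding residual_in_def by (intro allI) (rule conjunct2)
  from choice[OF this] obtain \<U> where U0: "\<forall>n. countable (\<U> n) \<and>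
    (\<forall>U\<in>\<U> n. openin T U \<and> T closure_of U = topspace T) \<and> topspace T \<inter> \<Inter>(\<U> n) \<subseteq> R n" by (elim exE)
  have U: "countable (\<U> n)" "topspace T \<inter> \<Inter>(\<U> n) \<subseteq> R n"
    "V \<in> \<U> n \<Longrightarrow> openin T V \<and> T closure_of V = topspace T" for n V
    using spec[OF U0, of n] by simp_all
  show ?thesis
    unfolding residual_in_def
  proof (intro conjI exI[of _ "\<Union>n. \<U> n"] ballI)
    have "R 0 \<subseteq> topspace T" using assms[of 0] unfolding residual_in_def by (rule conjunct1)
    then show "(\<Inter>n. R n) \<subseteq> topspace T" by (rule INF_lower2[OF UNIV_I])
    show "countable (\<Union>n. \<U> n)" by (intro countable_UN countableI_type U)
    show "topspace T \<inter> \<Inter>(\<Union>n. \<U> n) \<subseteq> (\<Inter>n. R n)"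
    proof (rule INF_greatest)
      fix n
      show "topspace T \<inter> \<Inter>(\<Union>n. \<U> n) \<subseteq> R n"
        by (rule order_trans[OF _ U(2)[of n]]) auto
    qed
  qed (elim UN_E, simp add: U(3))+
qed

lemma residual_in_Int:
  assumes "residual_in T R" "residual_in T R'"
  shows "residual_in T (R \<inter> R')"
proof -
  have "(\<Inter>n::nat. if n = 0 then R else R') = R \<inter> R'" by (auto split: if_splits)
  then show ?thesis
    using residual_in_INT_countable[of T "\<lambda>n. if n = 0 then R else R'"] assms by simp
qed

text \<open>Derivatives in \<open>x\<close> of a member of the family are partial derivatives of the
  jointly smooth map, which are uniformly continuous over the unit ball of parameters times one
  period.\<close>

lemma smooth_family_close:
  fixes \<Psi> :: "'p::euclidean_space \<times> real \<Rightarrow> 'a::real_normed_vector"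
  assumes T: "T > 0" and sm: "smooth_on UNIV \<Psi>" and per: "\<And>p x. \<Psi> (p, x + T) = \<Psi> (p, x)" and e: "e > 0"
  shows "\<exists>d>0. \<forall>p. norm p < d \<longrightarrow>
    (\<forall>k\<le>n. \<forall>x. norm ((vderiv ^^ k) (\<lambda>x. \<Psi> (p, x)) x - (vderiv ^^ k) (\<lambda>x. \<Psi> (0, x)) x) < e)"
proof -
  define G where "G = rec_nat \<Psi> (\<lambda>k g z. frechet_derivative g (at z) (0, 1))"
  have G: "G 0 = \<Psi>" "\<And>k. G (Suc k) = (\<lambda>z. frechet_derivative (G k) (at z) (0, 1))" by (simp_all add: G_def)
  have smG: "smooth_on UNIV (G k)" for k by (induction k) (auto simp: G sm intro: smooth_on_derivative)
  have GV: "(vderiv ^^ k) (\<lambda>x. \<Psi> (p, x)) = (\<lambda>x. G k (p, x))" for k p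
  proof (induction k)
    case (Suc k)
    have "((\<lambda>x. G k (p, x)) has_vector_derivative G (Suc k) (p, x)) (at x)" for x
    proof -
      have "((\<lambda>x. (p, x)) has_derivative (\<lambda>v. (0, v))) (at x)" by (auto intro!: derivative_eq_intros)
      moreover have d: "(G k has_derivative frechet_derivative (G k) (at (p, x))) (at (p, x))"
        using smooth_on_has_derivative[OF smG] by simp
      ultimately have "((\<lambda>x. G k (p, x)) has_derivative (\<lambda>v. frechet_derivative (G k) (at (p, x)) (0, v))) (at x)"
        by (rule has_derivative_compose)
      moreover have "frechet_derivative (G k) (at (p, x)) (0, v) = v *\<^sub>R G (Suc k) (p, x)" for v
        using linear_scale[OF has_derivative_linear[OF d], of v "(0, 1)"] by (simp add: G)
      ultimately show ?thesis by (simp add: has_vector_derivative_def)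
    qed
    then have "vderiv (\<lambda>x. G k (p, x)) = (\<lambda>x. G (Suc k) (p, x))" using vector_derivative_at by blast
    then show ?case using Suc by simp
  qed (simp add: G)
  have smp: "smooth_on UNIV (\<lambda>x. \<Psi> (p, x))" for p
    by (rule smooth_on_compose[OF open_UNIV open_UNIV sm])
      (auto intro!: smooth_on_Pair smooth_on_id smooth_on_const)
  have "\<exists>d>0. \<forall>p. norm p < d \<longrightarrow> (\<forall>x\<in>{0..T}. norm (G k (p, x) - G k (0, x)) < e)" for k
  proof -
    have "compact (cball (0::'p) 1 \<times> {0..T})" by (intro compact_Times compact_cball compact_Icc)
    moreover have "continuous_on (cball (0::'p) 1 \<times> {0..T}) (G k)"
      using smooth_on_continuous_on[OF smG] continuous_on_subset by blast
    ultimately have "uniformly_continuous_on (cball (0::'p) 1 \<times> {0..T}) (G k)"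
      by (rule compact_uniformly_continuous[rotated])
    then obtain d where d: "d > 0" "\<And>z w. z \<in> cball (0::'p) 1 \<times> {0..T} \<Longrightarrow> w \<in> cball (0::'p) 1 \<times> {0..T} \<Longrightarrow>
       dist z w < d \<Longrightarrow> dist (G k z) (G k w) < e"
      unfolding uniformly_continuous_on_def using e by metis
    have "norm (G k (p, x) - G k (0, x)) < e" if "norm p < min d 1" "x \<in> {0..T}" for p x
      using d(2)[of "(p, x)" "(0, x)"] that by (simp add: dist_Pair_Pair dist_norm)
    then show ?thesis using d(1) by (intro exI[of _ "min d 1"]) auto
  qed
  then obtain d where d: "\<And>k. d k > 0" "\<And>k p x. norm p < d k \<Longrightarrow> x \<in> {0..T} \<Longrightarrow> norm (G k (p, x) - G k (0, x)) < e"
    by metis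
  define m where "m = Min (d ` {..n})"
  have "m > 0" unfolding m_def by (subst Min_gr_iff) (use d in auto)
  moreover have "norm ((vderiv ^^ k) (\<lambda>x. \<Psi> (p, x)) x - (vderiv ^^ k) (\<lambda>x. \<Psi> (0, x)) x) < e"
    if p: "norm p < m" and k: "k \<le> n" for p k x
  proof (rule norm_vderiv_funpow_less[OF T, of _ "range (\<lambda>p x. \<Psi> (p, x))"])
    fix x assume "x \<in> {0..T}"
    moreover have "m \<le> d k" unfolding m_def using k by (intro Min_le) auto
    ultimately show "norm ((vderiv ^^ k) (\<lambda>x. \<Psi> (p, x)) x - (vderiv ^^ k) (\<lambda>x. \<Psi> (0, x)) x) < e"
      using d(2)[of p k x] p by (simp add: GV)
  qed (use smp per in auto)
  ultimately show ?thesis by blast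
qed

lemma negligible_avoid:
  fixes N :: "'a::euclidean_space set"
  assumes "negligible N" "d > 0"
  obtains p where "norm p < d" "p \<notin> N"
proof -
  have "\<not> ball 0 d \<subseteq> N"
    using assms negligible_subset open_not_negligible[of "ball (0::'a) d"] by auto
  then obtain p where "p \<in> ball 0 d" "p \<notin> N" by blast
  then show ?thesis by (intro that[of p]) simp_all
qed

section \<open>Generic knots\<close>

lemma knot_embeddingsD:
  assumes "c \<in> knot_embeddings"
  shows "smooth_on UNIV c" "c (x + 1) = c x" "vderiv c x \<noteq> 0" "c x = c y \<Longrightarrow> x - y \<in> \<int>"
  using assms by (auto simp: knot_embeddings_def)

interpretation knots: smooth_periodic_maps knot_embeddings 1
  by standard (auto simp: knot_embeddings_def)

text \<open>The mean value inequality for \<open>t \<mapsto> g t - t v\<close>. It rules out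
  coincidences at short distance when the derivative is nearly constant and nonzero.\<close>

lemma secant_bound:
  fixes g :: "real \<Rightarrow> 'a::real_inner"
  assumes g: "smooth_on UNIV g" and B: "\<And>t. t \<in> closed_segment x y \<Longrightarrow> norm (vderiv g t - v) \<le> B"
  shows "norm (g x - g y - (x - y) *\<^sub>R v) \<le> B * \<bar>x - y\<bar>"
proof -
  have *: "norm (g b - g a - (b - a) *\<^sub>R v) \<le> B * (b - a)"
    if ab: "a < b" and B: "\<And>t. t \<in> {a..b} \<Longrightarrow> norm (vderiv g t - v) \<le> B" for a b
  proof -
    define w where "w t = g t - t *\<^sub>R v" for t
    have dw: "(w has_derivative (\<lambda>h. h *\<^sub>R (vderiv g t - v))) (at t)" for t
      using smooth_on_has_vderiv[OF g, of t] unfolding w_def has_vector_derivative_def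
      by (auto intro!: derivative_eq_intros simp: algebra_simps)
    have "continuous_on {a..b} w"
      by (intro continuous_at_imp_continuous_on ballI has_derivative_continuous[OF dw])
    from mvt_general[OF ab this dw] obtain t where t: "t \<in> {a<..<b}"
      "norm (w b - w a) \<le> norm ((b - a) *\<^sub>R (vderiv g t - v))" by (elim bexE)
    have "norm ((b - a) *\<^sub>R (vderiv g t - v)) \<le> (b - a) * B"
      using B[of t] t(1) ab by (simp add: mult_left_mono)
    moreover have "w b - w a = g b - g a - (b - a) *\<^sub>R v" by (simp add: w_def algebra_simps)
    ultimately show ?thesis using t(2) by (simp add: mult.commute)
  qed
  consider "x < y" | "x = y" | "y < x" by linarith
  then show ?thesis
  proof cases
    case 1
    have eq: "g x - g y - (x - y) *\<^sub>R v = - (g y - g x - (y - x) *\<^sub>R v)" by (simp add: algebra_simps)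
    have "norm (g x - g y - (x - y) *\<^sub>R v) = norm (g y - g x - (y - x) *\<^sub>R v)"
      unfolding eq by (rule norm_minus_cancel)
    also have "\<dots> \<le> B * (y - x)"
      by (rule *[OF 1]) (use 1 B in \<open>simp add: closed_segment_eq_real_ivl\<close>)
    finally show ?thesis using 1 by simp
  next
    case 3
    then show ?thesis using *[OF 3 B] by (simp add: closed_segment_eq_real_ivl)
  qed simp
qed

text \<open>Embeddings form a C^1-open set: nearby parameters are separated by the almost constant
  derivative, and distant ones by a lower bound on their distance in space, obtained from
  compactness.\<close>

lemma knot_embeddings_C1_open:
  assumes c: "c \<in> knot_embeddings"
  shows "\<exists>e>0. \<forall>g. smooth_on UNIV g \<and> (\<forall>x. g (x + 1) = g x) \<and>
    (\<forall>x. norm (g x - c x) < e \<and> norm (vderiv g x - vderiv c x) < e) \<longrightarrow> g \<in> knot_embeddings"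
proof -
  note cD = knot_embeddingsD[OF c]
  have sm1: "smooth_on UNIV (vderiv c)" using smooth_on_vderiv[OF cD(1)] by simp
  have cont: "continuous_on S c" "continuous_on S (vderiv c)" for S
    using smooth_on_continuous_on[OF cD(1)] smooth_on_continuous_on[OF sm1] continuous_on_subset by blast+
  have per: "vderiv c (x + 1) = vderiv c x" for x
    by (rule vderiv_periodic[OF cD(1) cD(2)])
  obtain x0 where x0: "\<And>x. x \<in> {0..1} \<Longrightarrow> norm (vderiv c x0) \<le> norm (vderiv c x)"
    using continuous_attains_inf[OF compact_Icc _ continuous_on_norm[OF cont(2)], of 0 1] by force
  define m where "m = norm (vderiv c x0)"
  have m: "m > 0" using cD(3) by (simp add: m_def)
  have mle: "m \<le> norm (vderiv c x)" for x
  proof -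
    obtain k where k: "x + of_int k * 1 \<in> {0..1::real}" using periodic_reduce[of 1 x] by auto
    have "vderiv c (x + of_int k * 1) = vderiv c x" by (rule periodic_int) (rule per)
    then show ?thesis using x0[OF k] by (simp add: m_def)
  qed
  have "uniformly_continuous_on {-1..2::real} (vderiv c)"
    by (rule compact_uniformly_continuous) (use cont in auto)
  then obtain d0 where d0: "d0 > 0" "\<And>x y. x \<in> {-1..2::real} \<Longrightarrow> y \<in> {-1..2} \<Longrightarrow> dist x y < d0 \<Longrightarrow>
      dist (vderiv c x) (vderiv c y) < m / 4"
    unfolding uniformly_continuous_on_def using m by (metis divide_pos_pos zero_less_numeral)
  define d where "d = min d0 1"
  have d: "d > 0" "d \<le> 1" "d \<le> d0" using d0 by (auto simp: d_def)
  \<comment> \<open>Pairs at circle distance at least \<open>d\<close>, with representatives within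
    1/2 of each other. This excludes nonzero integer differences, so \<open>c\<close> separates each
    such pair.\<close>
  define F where "F = ({-1..2} \<times> {0..1}) \<inter> {z::real \<times> real. d \<le> \<bar>fst z - snd z\<bar>} \<inter> {z. \<bar>fst z - snd z\<bar> \<le> 1/2}"
  have "compact F" unfolding F_def
    by (intro compact_Int_closed compact_Times compact_Icc closed_Collect_le continuous_intros)
  have Fnz: "c (fst z) - c (snd z) \<noteq> 0" if z: "z \<in> F" for z
  proof
    assume "c (fst z) - c (snd z) = 0"
    then have "fst z - snd z \<in> \<int>" using cD(4) by simp
    then obtain k where k: "fst z - snd z = of_int k" by (elim Ints_cases)
    then have "\<bar>real_of_int k\<bar> \<le> 1/2" "d \<le> \<bar>real_of_int k\<bar>" using z by (auto simp: F_def)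
    then have "real_of_int \<bar>k\<bar> < 1" by simp
    then have "k = 0" by (simp only: of_int_less_1_iff zabs_less_one_iff)
    then show False using d(1) \<open>d \<le> \<bar>real_of_int k\<bar>\<close> by simp
  qed
  have "\<exists>\<mu>>0. \<forall>z\<in>F. \<mu> \<le> norm (c (fst z) - c (snd z))"
  proof (cases "F = {}")
    case True
    then show ?thesis by (intro exI[of _ 1]) simp
  next
    case False
    have "continuous_on F (\<lambda>z. norm (c (fst z) - c (snd z)))"
      by (intro continuous_intros continuous_on_compose2[OF cont(1)[of UNIV]]) auto
    from continuous_attains_inf[OF \<open>compact F\<close> False this] Fnz show ?thesis by (metis zero_less_norm_iff)
  qed
  then obtain \<mu> where \<mu>: "\<mu> > 0" "\<And>z. z \<in> F \<Longrightarrow> \<mu> \<le> norm (c (fst z) - c (snd z))" by blast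
  \<comment> \<open>Near the diagonal the variation of the derivative of \<open>c\<close> and the
    perturbation cost \<open>m / 4\<close> each, together less than \<open>m\<close>. Away from it
    both endpoints move, hence half of \<open>\<mu>\<close>.\<close>
  define e where "e = min (m / 4) (\<mu> / 2)"
  have e: "e > 0" "e \<le> m / 4" "e \<le> \<mu> / 2" using m \<mu> by (auto simp: e_def)
  have "g \<in> knot_embeddings" if g: "smooth_on UNIV g" and gper: "\<And>x. g (x + 1) = g x"
    and ge: "\<And>x. norm (g x - c x) < e" "\<And>x. norm (vderiv g x - vderiv c x) < e" for g
  proof -
    have imm: "vderiv g x \<noteq> 0" for x
      using ge(2)[of x] mle[of x] e(2) m by auto
    have inj: "x - y \<in> \<int>" if xy: "g x = g y" for x y
    proof -
      obtain k where k: "y + of_int k * 1 \<in> {0..1::real}" using periodic_reduce[of 1 y] by auto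
      define y' where "y' = y + of_int k"
      \<comment> \<open>Shifting \<open>x\<close> by this integer brings it within 1/2 of
        \<open>y'\<close>.\<close>
      define j where "j = round (y' - x)"
      define x' where "x' = x + of_int j"
      have "\<bar>x' - y'\<bar> \<le> 1/2"
        using of_int_round_abs_le[of "y' - x"] by (simp add: x'_def j_def abs_minus_commute algebra_simps)
      moreover have y01: "y' \<in> {0..1}" using k by (simp add: y'_def)
      ultimately have bds: "x' \<in> {-1..2}" "y' \<in> {-1..2}" "\<bar>x' - y'\<bar> \<le> 1/2"
        unfolding atLeastAtMost_iff by linarith+
      have "g x' = g x" "g y' = g y"
        using periodic_int[of g 1, OF gper, of x j] periodic_int[of g 1, OF gper, of y k]
        by (simp_all add: x'_def y'_def)
      then have eq: "g x' = g y'" using xy by simp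
      have "x' = y'"
      proof (rule ccontr)
        assume ne: "x' \<noteq> y'"
        show False
        proof (cases "\<bar>x' - y'\<bar> < d")
          case True
          have "norm (g x' - g y' - (x' - y') *\<^sub>R vderiv c y') \<le> (m / 2) * \<bar>x' - y'\<bar>"
          proof (rule secant_bound[OF g])
            fix t assume t: "t \<in> closed_segment x' y'"
            have t1: "t \<in> {-1..2}" using t bds by (auto simp: closed_segment_eq_real_ivl split: if_splits)
            have "\<bar>t - y'\<bar> \<le> \<bar>x' - y'\<bar>" using t by (auto simp: closed_segment_eq_real_ivl split: if_splits)
            then have "dist (vderiv c t) (vderiv c y') < m / 4"
              using True d(3) by (intro d0(2) t1 bds) (simp add: dist_real_def)
            then show "norm (vderiv g t - vderiv c y') \<le> m / 2"
              using ge(2)[of t] e(2) norm_triangle_ineq[of "vderiv g t - vderiv c t" "vderiv c t - vderiv c y'"]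
              by (simp add: dist_norm)
          qed
          then have "\<bar>x' - y'\<bar> * norm (vderiv c y') \<le> (m / 2) * \<bar>x' - y'\<bar>" using eq by simp
          then have "norm (vderiv c y') \<le> m / 2" using ne by (simp add: field_simps)
          then show False using mle[of y'] m by simp
        next
          case False
          then have "(x', y') \<in> F" using bds y01 by (auto simp: F_def)
          then have "\<mu> \<le> norm (c x' - c y')" using \<mu>(2) by force
          also have "c x' - c y' = (g y' - c y') - (g x' - c x')" using eq by simp
          also have "norm \<dots> \<le> norm (g y' - c y') + norm (g x' - c x')" by (rule norm_triangle_ineq4)
          finally show False using ge(1)[of x'] ge(1)[of y'] e(3) by simp
        qed
      qed
      then have "x - y = of_int (k - j)" by (simp add: x'_def y'_def algebra_simps)
      then show ?thesis by (metis Ints_of_int)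
    qed
    show ?thesis unfolding knot_embeddings_def using g gper imm inj by blast
  qed
  then show ?thesis using e(1) by blast
qed

lemma knot_perturbation:
  fixes h :: "'p::euclidean_space \<times> real \<Rightarrow> real^3"
  assumes c: "c \<in> knot_embeddings" and h: "smooth_on UNIV h" and per: "\<And>p x. h (p, x + 1) = h (p, x)"
    and h0: "\<And>x. h (0, x) = 0" and e: "e > 0"
  shows "\<exists>d>0. \<forall>p. norm p < d \<longrightarrow> (\<lambda>x. c x + h (p, x)) \<in> Cinf_ball knot_embeddings n e c"
proof -
  note cD = knot_embeddingsD[OF c]
  obtain e0 where e0: "e0 > 0" "\<And>g. smooth_on UNIV g \<Longrightarrow> (\<And>x. g (x + 1) = g x) \<Longrightarrow>
    (\<And>x. norm (g x - c x) < e0) \<Longrightarrow> (\<And>x. norm (vderiv g x - vderiv c x) < e0) \<Longrightarrow> g \<in> knot_embeddings"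
    using knot_embeddings_C1_open[OF c] by blast
  let ?\<Psi> = "\<lambda>z. c (snd z) + h z"
  have sm\<Psi>: "smooth_on UNIV ?\<Psi>"
    by (intro smooth_on_add open_UNIV h smooth_on_compose[OF open_UNIV open_UNIV cD(1)] smooth_on_snd smooth_on_id) auto
  have smg: "smooth_on UNIV (\<lambda>x. c x + h (p, x))" for p
    by (intro smooth_on_add open_UNIV cD smooth_on_compose[OF open_UNIV open_UNIV h] smooth_on_Pair smooth_on_id smooth_on_const) auto
  \<comment> \<open>At least one derivative is controlled, even for \<open>n = 0\<close>, so that
    C^1-openness keeps the perturbed map an embedding.\<close>
  obtain d where d: "d > 0" "\<And>p k x. norm p < d \<Longrightarrow> k \<le> max n 1 \<Longrightarrow>
      norm ((vderiv ^^ k) (\<lambda>x. c x + h (p, x)) x - (vderiv ^^ k) c x) < min e e0"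
    using smooth_family_close[of 1 ?\<Psi> "min e e0" "max n 1", OF _ sm\<Psi>] cD(2) per e e0(1) h0 by auto
  have "(\<lambda>x. c x + h (p, x)) \<in> Cinf_ball knot_embeddings n e c" if p: "norm p < d" for p
  proof -
    have "(\<lambda>x. c x + h (p, x)) \<in> knot_embeddings"
      by (rule e0(2)[OF smg]) (use d(2)[OF p, of 0] d(2)[OF p, of 1] cD(2) per in auto)
    then show ?thesis using d(2)[OF p] by (auto simp: Cinf_ball_def)
  qed
  then show ?thesis using d(1) by blast
qed

text \<open>The parameters are taken from the target space, one per scalar equation. By
  \<open>sol\<close> a zero at \<open>z\<close> determines its parameter as \<open>k z\<close>, so
  the bad parameters lie in a smooth image of a lower-dimensional space, which is null.
  \<open>W\<close> and \<open>h\<close> are independent of the knot, because density is needed for a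
  fixed \<open>W\<close>.\<close>

lemma knot_residual_avoid:
  fixes \<Phi> :: "(real \<Rightarrow> real^3) \<Rightarrow> 'z::euclidean_space \<Rightarrow> 'e::euclidean_space"
  assumes dim: "DIM('z) < DIM('e)"
    and cont: "\<And>c. c \<in> knot_embeddings \<Longrightarrow> continuous_on UNIV (\<Phi> c)"
    and K: "continuous_on UNIV K"
    and est: "\<And>c g z e. c \<in> knot_embeddings \<Longrightarrow> g \<in> Cinf_ball knot_embeddings n e c \<Longrightarrow> 0 < e \<Longrightarrow>
      norm (\<Phi> g z - \<Phi> c z) \<le> K z * e"
    and sol: "\<And>z0. z0 \<in> D \<Longrightarrow> \<exists>W (h :: 'e \<times> real \<Rightarrow> real^3). open W \<and> z0 \<in> W \<and> smooth_on UNIV h \<and>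
      (\<forall>p x. h (p, x + 1) = h (p, x)) \<and> (\<forall>x. h (0, x) = 0) \<and>
      (\<forall>c\<in>knot_embeddings. \<exists>k. smooth_on W k \<and> (\<forall>z\<in>W. \<forall>p. \<Phi> (\<lambda>x. c x + h (p, x)) z = 0 \<longrightarrow> p = k z))"
  shows "\<exists>R. residual_in (Cinf_topology knot_embeddings) R \<and> (\<forall>c\<in>R. \<forall>z\<in>D. \<Phi> c z \<noteq> 0)"
proof (rule knots.residual_avoid[OF cont K est])
  fix z0 assume "z0 \<in> D"
  then obtain W and h :: "'e \<times> real \<Rightarrow> real^3" where W: "open W" "z0 \<in> W" and h: "smooth_on UNIV h"
    "\<And>p x. h (p, x + 1) = h (p, x)" "\<And>x. h (0, x) = 0"
    and k: "\<And>c. c \<in> knot_embeddings \<Longrightarrow>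
      \<exists>k. smooth_on W k \<and> (\<forall>z\<in>W. \<forall>p. \<Phi> (\<lambda>x. c x + h (p, x)) z = 0 \<longrightarrow> p = k z)"
    using sol by meson
  have "\<exists>g\<in>Cinf_ball knot_embeddings j e c. \<forall>z\<in>W. \<Phi> g z \<noteq> 0"
    if c: "c \<in> knot_embeddings" and e: "0 < e" for c j e
  proof -
    obtain k where k: "smooth_on W k" "\<And>z p. z \<in> W \<Longrightarrow> \<Phi> (\<lambda>x. c x + h (p, x)) z = 0 \<Longrightarrow> p = k z"
      using k[OF c] by blast
    have "negligible (k ` W)"
      by (rule negligible_differentiable_image_lowdim[OF dim smooth_on_differentiable_on[OF k(1)]])
    moreover obtain d where d: "d > 0"
      "\<And>p. norm p < d \<Longrightarrow> (\<lambda>x. c x + h (p, x)) \<in> Cinf_ball knot_embeddings j e c"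
      using knot_perturbation[OF c h e] by blast
    ultimately obtain p where "norm p < d" "p \<notin> k ` W" using negligible_avoid by blast
    then show ?thesis using d(2) k(2) by blast
  qed
  with W show "\<exists>W. open W \<and> z0 \<in> W \<and> (\<forall>c\<in>knot_embeddings. \<forall>j e. 0 < e \<longrightarrow>
      (\<exists>g\<in>Cinf_ball knot_embeddings j e c. \<forall>z\<in>W. \<Phi> g z \<noteq> 0))" by blast
qed

subsection \<open>Linear conditions on jets\<close>

lemma vderiv_funpow_add:
  fixes f g :: "real \<Rightarrow> 'a::real_normed_vector"
  assumes f: "smooth_on UNIV f" and g: "smooth_on UNIV g"
  shows "(vderiv ^^ k) (\<lambda>x. f x + g x) = (\<lambda>x. (vderiv ^^ k) f x + (vderiv ^^ k) g x)"
proof (induction k)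
  case (Suc k)
  have "((\<lambda>x. (vderiv ^^ k) f x + (vderiv ^^ k) g x) has_vector_derivative
     vderiv ((vderiv ^^ k) f) x + vderiv ((vderiv ^^ k) g) x) (at x)" for x
    by (intro has_vector_derivative_add smooth_on_has_vderiv[OF smooth_on_vderiv_funpow] f g UNIV_I)
  then show ?case using vector_derivative_at by (simp add: Suc fun_eq_iff) blast
qed simp

lemma vderiv_funpow_scaleR:
  fixes f :: "real \<Rightarrow> real" and u :: "'a::real_normed_vector"
  assumes f: "smooth_on UNIV f"
  shows "(vderiv ^^ k) (\<lambda>x. f x *\<^sub>R u) = (\<lambda>x. (vderiv ^^ k) f x *\<^sub>R u)"
proof (induction k)
  case (Suc k)
  have "((\<lambda>x. (vderiv ^^ k) f x *\<^sub>R u) has_vector_derivative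
     vderiv ((vderiv ^^ k) f) x *\<^sub>R u) (at x)" for x
    using bounded_linear.has_vector_derivative[OF bounded_linear_scaleR_left
      smooth_on_has_vderiv[OF smooth_on_vderiv_funpow[OF f, of k] UNIV_I]] .
  then show ?case using vector_derivative_at by (simp add: Suc fun_eq_iff) blast
qed simp

text \<open>A list entry \<open>(a, k, x)\<close> stands for the term \<open>a z\<close> times the \<open>k\<close>-th derivative at \<open>x z\<close>. The functional applies
  both to knots and to the scalar functions by which they are perturbed.\<close>

definition jet_sum ::
  "(('z \<Rightarrow> real) \<times> nat \<times> ('z \<Rightarrow> real)) list \<Rightarrow> (real \<Rightarrow> 'a::real_normed_vector) \<Rightarrow> 'z \<Rightarrow> 'a" where
  "jet_sum l f z = (\<Sum>(a, k, x)\<leftarrow>l. a z *\<^sub>R (vderiv ^^ k) f (x z))"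

definition smooth_jet :: "(('z::real_normed_vector \<Rightarrow> real) \<times> nat \<times> ('z \<Rightarrow> real)) list \<Rightarrow> bool" where
  "smooth_jet l \<longleftrightarrow> (\<forall>(a, k, x)\<in>set l. smooth_on UNIV a \<and> k \<le> 2 \<and> smooth_on UNIV x)"

lemma jet_sum_add:
  assumes "smooth_on UNIV f" "smooth_on UNIV g"
  shows "jet_sum l (\<lambda>x. f x + g x) z = jet_sum l f z + jet_sum l g z"
  unfolding jet_sum_def vderiv_funpow_add[OF assms]
  by (induction l) (auto simp: scaleR_add_right)

lemma jet_sum_scaleR:
  assumes "smooth_on UNIV f"
  shows "jet_sum l (\<lambda>x. f x *\<^sub>R u) z = jet_sum l f z *\<^sub>R u"
  unfolding jet_sum_def vderiv_funpow_scaleR[OF assms]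
  by (induction l) (auto simp: scaleR_add_left)

lemma smooth_on_jet_sum:
  assumes "smooth_jet l" "smooth_on UNIV f"
  shows "smooth_on UNIV (jet_sum l f)"
  using assms(1) unfolding jet_sum_def[abs_def]
proof (induction l)
  case (Cons q l)
  obtain a k x where q: "q = (a, k, x)" by (cases q)
  have "smooth_on UNIV a" "smooth_on UNIV x" using Cons.prems by (auto simp: q smooth_jet_def)
  then have "smooth_on UNIV (\<lambda>z. a z *\<^sub>R (vderiv ^^ k) f (x z))"
    by (intro smooth_on_scaleR open_UNIV smooth_on_compose[OF open_UNIV open_UNIV smooth_on_vderiv_funpow[OF assms(2)]]) auto
  moreover have "smooth_jet l" using Cons.prems by (auto simp: smooth_jet_def)
  ultimately show ?case using Cons.IH by (simp add: q smooth_on_add)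
qed simp

lemma jet_sum_est:
  assumes "smooth_jet l" "g \<in> Cinf_ball X 2 e c"
  shows "norm (jet_sum l g z - jet_sum l c z) \<le> (\<Sum>(a, k, x)\<leftarrow>l. \<bar>a z\<bar>) * e"
  using assms(1)
proof (induction l)
  case (Cons q l)
  obtain a k x where q: "q = (a, k, x)" by (cases q)
  have "k \<le> 2" "smooth_jet l" using Cons.prems by (auto simp: q smooth_jet_def)
  then have "norm ((vderiv ^^ k) g (x z) - (vderiv ^^ k) c (x z)) \<le> e"
    using assms(2) by (auto simp: Cinf_ball_def less_imp_le)
  then have "norm (a z *\<^sub>R ((vderiv ^^ k) g (x z) - (vderiv ^^ k) c (x z))) \<le> \<bar>a z\<bar> * e"
    by (simp add: mult_left_mono)
  moreover have "jet_sum (q # l) g z - jet_sum (q # l) c z =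
    a z *\<^sub>R ((vderiv ^^ k) g (x z) - (vderiv ^^ k) c (x z)) + (jet_sum l g z - jet_sum l c z)"
    by (simp add: jet_sum_def q algebra_simps)
  ultimately show ?case
    using Cons.IH[OF \<open>smooth_jet l\<close>] by (auto simp: q distrib_right intro: norm_triangle_le)
qed (simp add: jet_sum_def)

lemma continuous_on_jet_coeffs:
  assumes "smooth_jet l"
  shows "continuous_on UNIV (\<lambda>z. \<Sum>(a, k, x)\<leftarrow>l. \<bar>a z\<bar>)"
  using assms
proof (induction l)
  case (Cons q l)
  obtain a k x where q: "q = (a, k, x)" by (cases q)
  have "smooth_on UNIV a" "smooth_jet l" using Cons.prems by (auto simp: q smooth_jet_def)
  then show ?case using Cons.IH smooth_on_continuous_on by (auto simp: q intro!: continuous_intros)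
qed simp

text \<open>One equation in R^3, perturbed by \<open>B x *\<^sub>R p\<close> with a vector parameter
  \<open>p\<close>. By linearity the equation becomes
  \<open>jet_sum l B z *\<^sub>R p = - jet_sum l c z\<close>, which is solvable for \<open>p\<close>
  wherever the scalar factor is nonzero.\<close>

lemma residual_avoid_jet:
  fixes l :: "(('z::euclidean_space \<Rightarrow> real) \<times> nat \<times> ('z \<Rightarrow> real)) list"
  assumes dim: "DIM('z) < 3" and l: "smooth_jet l"
    and B: "\<And>z. z \<in> D \<Longrightarrow> \<exists>B. smooth_on UNIV B \<and> (\<forall>x. B (x + 1) = B x) \<and> jet_sum l B z \<noteq> (0 :: real)"
  shows "\<exists>R. residual_in (Cinf_topology knot_embeddings) R \<and> (\<forall>c\<in>R. \<forall>z\<in>D. jet_sum l c z \<noteq> 0)"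
proof (rule knot_residual_avoid[where K = "\<lambda>z. \<Sum>(a, k, x)\<leftarrow>l. \<bar>a z\<bar>" and n = 2])
  fix z0 assume "z0 \<in> D"
  then obtain B :: "real \<Rightarrow> real" where B: "smooth_on UNIV B" "\<And>x. B (x + 1) = B x" "jet_sum l B z0 \<noteq> 0"
    using B by blast
  define W where "W = {z. jet_sum l B z \<noteq> 0}"
  note sJ = smooth_on_jet_sum[OF l]
  have W: "open W" unfolding W_def
    by (intro open_Collect_neq smooth_on_continuous_on sJ B continuous_on_const)
  define h :: "(real^3) \<times> real \<Rightarrow> real^3" where "h z = B (snd z) *\<^sub>R fst z" for z
  have "smooth_on UNIV h" unfolding h_def[abs_def]
    by (intro smooth_on_scaleR smooth_on_compose[OF open_UNIV open_UNIV B(1)] smooth_on_fst smooth_on_snd smooth_on_id open_UNIV) auto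
  moreover have "\<exists>k. smooth_on W k \<and> (\<forall>z\<in>W. \<forall>p. jet_sum l (\<lambda>x. c x + h (p, x)) z = 0 \<longrightarrow> p = k z)"
    if c: "c \<in> knot_embeddings" for c
  proof (intro exI conjI ballI allI impI)
    note cs = knot_embeddingsD(1)[OF c]
    show "smooth_on W (\<lambda>z. inverse (jet_sum l B z) *\<^sub>R (- jet_sum l c z))"
      by (intro smooth_on_scaleR smooth_on_inverse smooth_on_minus W smooth_on_subset[OF sJ] B cs)
        (auto simp: W_def)
    fix z p assume z: "z \<in> W" and "jet_sum l (\<lambda>x. c x + h (p, x)) z = 0"
    moreover have "jet_sum l (\<lambda>x. c x + B x *\<^sub>R p) z = jet_sum l c z + jet_sum l B z *\<^sub>R p"
      by (subst jet_sum_add[OF cs]) (auto simp: jet_sum_scaleR[OF B(1)] intro!: smooth_on_scaleR B)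
    ultimately have eq: "jet_sum l B z *\<^sub>R p = - jet_sum l c z"
      by (simp add: h_def eq_neg_iff_add_eq_0 add.commute)
    have "jet_sum l B z \<noteq> 0" using z by (simp add: W_def)
    then show "p = inverse (jet_sum l B z) *\<^sub>R (- jet_sum l c z)" unfolding eq[symmetric] by simp
  qed
  ultimately show "\<exists>W (h :: (real^3) \<times> real \<Rightarrow> real^3). open W \<and> z0 \<in> W \<and> smooth_on UNIV h \<and>
      (\<forall>p x. h (p, x + 1) = h (p, x)) \<and> (\<forall>x. h (0, x) = 0) \<and>
      (\<forall>c\<in>knot_embeddings. \<exists>k. smooth_on W k \<and> (\<forall>z\<in>W. \<forall>p. jet_sum l (\<lambda>x. c x + h (p, x)) z = 0 \<longrightarrow> p = k z))"
    using W B by (intro exI[of _ W] exI[of _ h] conjI) (simp_all add: W_def h_def)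
qed (use dim l in \<open>auto intro!: smooth_on_continuous_on smooth_on_jet_sum knot_embeddingsD
    continuous_on_jet_coeffs jet_sum_est\<close>)

lemma scaleR_cramer:
  fixes u v x y :: "'a::real_vector"
  assumes "x + a *\<^sub>R u + b *\<^sub>R v = 0" "y + c *\<^sub>R u + d *\<^sub>R v = 0" "a * d - b * c \<noteq> 0"
  shows "u = inverse (a * d - b * c) *\<^sub>R (b *\<^sub>R y - d *\<^sub>R x)"
    "v = inverse (a * d - b * c) *\<^sub>R (c *\<^sub>R x - a *\<^sub>R y)"
proof -
  have x: "x = - (a *\<^sub>R u + b *\<^sub>R v)" and y: "y = - (c *\<^sub>R u + d *\<^sub>R v)"
    using assms(1,2) by (simp_all add: eq_neg_iff_add_eq_0 add.assoc del: minus_add_distrib)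
  have "b *\<^sub>R y - d *\<^sub>R x = (a * d - b * c) *\<^sub>R u" "c *\<^sub>R x - a *\<^sub>R y = (a * d - b * c) *\<^sub>R v"
    unfolding x y by (simp_all add: algebra_simps)
  then show "u = inverse (a * d - b * c) *\<^sub>R (b *\<^sub>R y - d *\<^sub>R x)"
    "v = inverse (a * d - b * c) *\<^sub>R (c *\<^sub>R x - a *\<^sub>R y)" using assms(3) by simp_all
qed

text \<open>Two equations in R^3, perturbed by \<open>A\<close> and \<open>B\<close> times two
  vector parameters. The same 2 by 2 scalar system acts on every coordinate, so its determinant is
  the only thing to check.\<close>

lemma residual_avoid_two_jets:
  fixes l m :: "(('z::euclidean_space \<Rightarrow> real) \<times> nat \<times> ('z \<Rightarrow> real)) list"
  assumes dim: "DIM('z) < 6" and l: "smooth_jet l" and m: "smooth_jet m"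
    and B: "\<And>z. z \<in> D \<Longrightarrow> \<exists>A B. smooth_on UNIV A \<and> (\<forall>x. A (x + 1) = A x) \<and>
      smooth_on UNIV B \<and> (\<forall>x. B (x + 1) = B x) \<and>
      jet_sum l A z * jet_sum m B z - jet_sum l B z * jet_sum m A z \<noteq> (0 :: real)"
  shows "\<exists>R. residual_in (Cinf_topology knot_embeddings) R \<and>
    (\<forall>c\<in>R. \<forall>z\<in>D. (jet_sum l c z, jet_sum m c z) \<noteq> 0)"
proof (rule knot_residual_avoid[where K = "\<lambda>z. (\<Sum>(a, k, x)\<leftarrow>l. \<bar>a z\<bar>) + (\<Sum>(a, k, x)\<leftarrow>m. \<bar>a z\<bar>)" and n = 2])
  fix z0 assume "z0 \<in> D"
  then obtain A B :: "real \<Rightarrow> real" where A: "smooth_on UNIV A" "\<And>x. A (x + 1) = A x"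
    and B: "smooth_on UNIV B" "\<And>x. B (x + 1) = B x"
    and AB: "jet_sum l A z0 * jet_sum m B z0 - jet_sum l B z0 * jet_sum m A z0 \<noteq> 0"
    using B by blast
  define dt where "dt z = jet_sum l A z * jet_sum m B z - jet_sum l B z * jet_sum m A z" for z
  define W where "W = {z. dt z \<noteq> 0}"
  note sJ = smooth_on_jet_sum[OF l] smooth_on_jet_sum[OF m]
  have sdt: "smooth_on UNIV dt" unfolding dt_def[abs_def]
    by (intro smooth_on_diff smooth_on_mult open_UNIV sJ A B)
  have W: "open W" unfolding W_def
    by (intro open_Collect_neq smooth_on_continuous_on sdt continuous_on_const)
  define h :: "((real^3) \<times> (real^3)) \<times> real \<Rightarrow> real^3"
    where "h z = A (snd z) *\<^sub>R fst (fst z) + B (snd z) *\<^sub>R snd (fst z)" for z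
  have "smooth_on UNIV h" unfolding h_def[abs_def]
    by (intro smooth_on_add smooth_on_scaleR smooth_on_compose[OF open_UNIV open_UNIV B(1)]
       smooth_on_compose[OF open_UNIV open_UNIV A(1)] smooth_on_fst smooth_on_snd smooth_on_id open_UNIV) auto
  moreover have "\<exists>k. smooth_on W k \<and> (\<forall>z\<in>W. \<forall>p.
      (jet_sum l (\<lambda>x. c x + h (p, x)) z, jet_sum m (\<lambda>x. c x + h (p, x)) z) = 0 \<longrightarrow> p = k z)"
    if c: "c \<in> knot_embeddings" for c
  proof (intro exI conjI ballI allI impI)
    note cs = knot_embeddingsD(1)[OF c]
    show "smooth_on W (\<lambda>z.
      (inverse (dt z) *\<^sub>R (jet_sum l B z *\<^sub>R jet_sum m c z - jet_sum m B z *\<^sub>R jet_sum l c z),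
       inverse (dt z) *\<^sub>R (jet_sum m A z *\<^sub>R jet_sum l c z - jet_sum l A z *\<^sub>R jet_sum m c z)))"
      by (intro smooth_on_Pair smooth_on_scaleR smooth_on_inverse smooth_on_diff W
         smooth_on_subset[OF sJ(1)] smooth_on_subset[OF sJ(2)] smooth_on_subset[OF sdt] A B cs)
        (auto simp: W_def)
    fix z p assume z: "z \<in> W"
      and p: "(jet_sum l (\<lambda>x. c x + h (p, x)) z, jet_sum m (\<lambda>x. c x + h (p, x)) z) = 0"
    have J: "jet_sum j (\<lambda>x. c x + h (p, x)) z = jet_sum j c z + jet_sum j A z *\<^sub>R fst p + jet_sum j B z *\<^sub>R snd p" for j
    proof -
      have sA: "smooth_on UNIV (\<lambda>x. A x *\<^sub>R fst p)" and sB: "smooth_on UNIV (\<lambda>x. B x *\<^sub>R snd p)"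
        by (intro smooth_on_scaleR open_UNIV A B smooth_on_const)+
      have "jet_sum j (\<lambda>x. c x + (A x *\<^sub>R fst p + B x *\<^sub>R snd p)) z =
        jet_sum j c z + (jet_sum j A z *\<^sub>R fst p + jet_sum j B z *\<^sub>R snd p)"
        by (subst jet_sum_add[OF cs smooth_on_add[OF open_UNIV sA sB]], subst jet_sum_add[OF sA sB])
          (simp add: jet_sum_scaleR[OF A(1)] jet_sum_scaleR[OF B(1)])
      then show ?thesis by (simp add: h_def add.assoc)
    qed
    have "fst p = inverse (dt z) *\<^sub>R (jet_sum l B z *\<^sub>R jet_sum m c z - jet_sum m B z *\<^sub>R jet_sum l c z)"
      "snd p = inverse (dt z) *\<^sub>R (jet_sum m A z *\<^sub>R jet_sum l c z - jet_sum l A z *\<^sub>R jet_sum m c z)"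
      unfolding dt_def
      by (rule scaleR_cramer, use p z in \<open>auto simp: J W_def dt_def zero_prod_def\<close>)+
    then show "p = (inverse (dt z) *\<^sub>R (jet_sum l B z *\<^sub>R jet_sum m c z - jet_sum m B z *\<^sub>R jet_sum l c z),
       inverse (dt z) *\<^sub>R (jet_sum m A z *\<^sub>R jet_sum l c z - jet_sum l A z *\<^sub>R jet_sum m c z))"
      by (metis prod.collapse)
  qed
  ultimately show "\<exists>W (h :: ((real^3) \<times> (real^3)) \<times> real \<Rightarrow> real^3). open W \<and> z0 \<in> W \<and> smooth_on UNIV h \<and>
      (\<forall>p x. h (p, x + 1) = h (p, x)) \<and> (\<forall>x. h (0, x) = 0) \<and>
      (\<forall>c\<in>knot_embeddings. \<exists>k. smooth_on W k \<and> (\<forall>z\<in>W. \<forall>p.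
        (jet_sum l (\<lambda>x. c x + h (p, x)) z, jet_sum m (\<lambda>x. c x + h (p, x)) z) = 0 \<longrightarrow> p = k z))"
    using W A B AB by (intro exI[of _ W] exI[of _ h] conjI) (simp_all add: W_def h_def dt_def zero_prod_def)
next
  fix c g z and e :: real
  assume "g \<in> Cinf_ball knot_embeddings 2 e c" 
  then have "norm (jet_sum l g z - jet_sum l c z) \<le> (\<Sum>(a, k, x)\<leftarrow>l. \<bar>a z\<bar>) * e"
    "norm (jet_sum m g z - jet_sum m c z) \<le> (\<Sum>(a, k, x)\<leftarrow>m. \<bar>a z\<bar>) * e"
    using jet_sum_est l m by blast+
  then show "norm ((jet_sum l g z, jet_sum m g z) - (jet_sum l c z, jet_sum m c z))
    \<le> ((\<Sum>(a, k, x)\<leftarrow>l. \<bar>a z\<bar>) + (\<Sum>(a, k, x)\<leftarrow>m. \<bar>a z\<bar>)) * e"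
    using norm_Pair_le[of "jet_sum l g z - jet_sum l c z" "jet_sum m g z - jet_sum m c z"]
    by (simp add: distrib_right)
qed (use dim l m in \<open>auto intro!: continuous_on_Pair continuous_on_add continuous_on_jet_coeffs
    smooth_on_continuous_on[OF smooth_on_jet_sum] knot_embeddingsD(1)\<close>)

subsection \<open>The three genericity conditions\<close>

text \<open>The multipliers are quantified instead of being eliminated by determinants: each failure
  is then linear in the knot, with the multipliers as additional coordinates of the
  configuration.\<close>

definition generic_knot :: "(real \<Rightarrow> real^3) \<Rightarrow> bool" where
  "generic_knot c \<longleftrightarrow>
    (\<forall>x a. vderiv (vderiv c) x \<noteq> a *\<^sub>R vderiv c x) \<and>
    (\<forall>s t a p q. s - t \<notin> \<int> \<longrightarrow> c t - c s = a *\<^sub>R vderiv c s \<longrightarrow>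
      vderiv c t \<noteq> p *\<^sub>R vderiv c s + q *\<^sub>R vderiv (vderiv c) s) \<and>
    (\<forall>s t r a b. s - t \<notin> \<int> \<longrightarrow> s - r \<notin> \<int> \<longrightarrow> t - r \<notin> \<int> \<longrightarrow> c t - c s = a *\<^sub>R vderiv c s \<longrightarrow>
      c r - c s \<noteq> b *\<^sub>R vderiv c s)"

text \<open>The simplest 1-periodic function with a double zero at \<open>s\<close> and no other
  zero modulo 1.\<close>

definition trig_bump :: "real \<Rightarrow> real \<Rightarrow> real" where
  "trig_bump s x = 1 - cos (2 * pi * (x - s))"

lemma smooth_trig [intro]:
  "smooth_on UNIV (\<lambda>x. sin (2 * pi * (x - s)))" "smooth_on UNIV (trig_bump s)"
  unfolding trig_bump_def[abs_def]
  by (intro smooth_on_sin_cos smooth_on_diff smooth_on_mult smooth_on_id smooth_on_const open_UNIV)+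

lemma sin_cos_period: "sin (2 * pi * (x + 1 - s)) = sin (2 * pi * (x - s))"
  "cos (2 * pi * (x + 1 - s)) = cos (2 * pi * (x - s))"
proof -
  have "2 * pi * (x + 1 - s) = 2 * pi * (x - s) + 2 * pi" by (simp add: algebra_simps)
  then show "sin (2 * pi * (x + 1 - s)) = sin (2 * pi * (x - s))"
    "cos (2 * pi * (x + 1 - s)) = cos (2 * pi * (x - s))" by (simp_all only: sin_periodic cos_periodic)
qed

lemma trig_bump_periodic: "trig_bump s (x + 1) = trig_bump s x"
  by (simp only: trig_bump_def sin_cos_period)

lemma trig_bump_nonzero:
  assumes "s - t \<notin> \<int>"
  shows "trig_bump s t \<noteq> 0" "trig_bump t s \<noteq> 0"
proof -
  have *: "x - y \<in> \<int>" if "trig_bump y x = 0" for x y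
  proof -
    have "cos (2 * pi * (x - y)) = 1" using that by (simp add: trig_bump_def)
    then obtain n :: int where "2 * pi * (x - y) = of_int n * 2 * pi" unfolding cos_one_2pi_int by blast
    then have "x - y = of_int n" by simp
    then show ?thesis by (metis Ints_of_int)
  qed
  show "trig_bump t s \<noteq> 0" using *[of t s] assms by blast
  have "t - s \<notin> \<int>" using assms Ints_minus[of "t - s"] by auto
  then show "trig_bump s t \<noteq> 0" using *[of s t] by blast
qed

lemma vderiv_trig:
  "vderiv (trig_bump s) x = 2 * pi * sin (2 * pi * (x - s))"
  "vderiv (\<lambda>x. 2 * pi * sin (2 * pi * (x - s))) x = (2 * pi)\<^sup>2 * cos (2 * pi * (x - s))"
  "vderiv (\<lambda>x. sin (2 * pi * (x - s))) x = 2 * pi * cos (2 * pi * (x - s))"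
proof -
  have 1: "(trig_bump s has_real_derivative 2 * pi * sin (2 * pi * (x - s))) (at x)" for x
    unfolding trig_bump_def[abs_def] by (auto intro!: derivative_eq_intros)
  have 2: "((\<lambda>x. 2 * pi * sin (2 * pi * (x - s))) has_real_derivative (2 * pi)\<^sup>2 * cos (2 * pi * (x - s))) (at x)" for x
    by (auto intro!: derivative_eq_intros simp: power2_eq_square)
  have 3: "((\<lambda>x. sin (2 * pi * (x - s))) has_real_derivative 2 * pi * cos (2 * pi * (x - s))) (at x)" for x
    by (auto intro!: derivative_eq_intros)
  show "vderiv (trig_bump s) x = 2 * pi * sin (2 * pi * (x - s))"
    "vderiv (\<lambda>x. 2 * pi * sin (2 * pi * (x - s))) x = (2 * pi)\<^sup>2 * cos (2 * pi * (x - s))"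
    "vderiv (\<lambda>x. sin (2 * pi * (x - s))) x = 2 * pi * cos (2 * pi * (x - s))"
    using 1 2 3 by (auto intro!: vector_derivative_at simp: has_real_derivative_iff_has_vector_derivative)
qed

lemma vderiv_mult:
  fixes f g :: "real \<Rightarrow> real"
  assumes "smooth_on UNIV f" "smooth_on UNIV g"
  shows "vderiv (\<lambda>x. f x * g x) x = f x * vderiv g x + vderiv f x * g x"
  by (intro vector_derivative_at has_vector_derivative_mult smooth_on_has_vderiv[OF assms(1) UNIV_I]
     smooth_on_has_vderiv[OF assms(2) UNIV_I])

lemma vderiv_add:
  fixes f g :: "real \<Rightarrow> real"
  assumes "smooth_on UNIV f" "smooth_on UNIV g"
  shows "vderiv (\<lambda>x. f x + g x) x = vderiv f x + vderiv g x"
  by (intro vector_derivative_at has_vector_derivative_add smooth_on_has_vderiv[OF assms(1) UNIV_I]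
     smooth_on_has_vderiv[OF assms(2) UNIV_I])

text \<open>A factor \<open>trig_bump s\<close> hides the perturbation from first-order terms at
  \<open>s\<close>, and from second-order terms if the other factor vanishes there as well. This
  decouples the startpoint from the other points of a configuration.\<close>

lemma trig_bump_mult_zero:
  assumes q: "smooth_on UNIV q"
  shows "vderiv (\<lambda>x. trig_bump s x * q x) s = 0"
    "q s = 0 \<Longrightarrow> vderiv (vderiv (\<lambda>x. trig_bump s x * q x)) s = 0"
proof -
  note b = smooth_trig(2)[of s]
  note d = smooth_on_vderiv[OF b open_UNIV] smooth_on_vderiv[OF q open_UNIV]
  have z: "trig_bump s s = 0" "vderiv (trig_bump s) s = 0" by (simp_all add: vderiv_trig) (simp add: trig_bump_def)
  show "vderiv (\<lambda>x. trig_bump s x * q x) s = 0" by (simp add: vderiv_mult[OF b q] z)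
  assume "q s = 0"
  then show "vderiv (vderiv (\<lambda>x. trig_bump s x * q x)) s = 0"
    unfolding vderiv_mult[OF b q]
    by (subst vderiv_add) (auto simp: vderiv_mult b q d z intro!: smooth_on_mult)
qed

lemma funpow_2: "(f ^^ 2) x = f (f x)"
  by (simp add: numeral_2_eq_2)

lemmas smooth_proj = smooth_on_fst smooth_on_snd smooth_on_id smooth_on_minus smooth_on_const open_UNIV

lemma residual_curvature:
  "\<exists>R. residual_in (Cinf_topology knot_embeddings) R \<and>
    (\<forall>c\<in>R. \<forall>x a. vderiv (vderiv c) x \<noteq> a *\<^sub>R vderiv c x)"
proof -
  define l :: "((real \<times> real \<Rightarrow> real) \<times> nat \<times> (real \<times> real \<Rightarrow> real)) list"
    where "l = [(\<lambda>z. 1, 2, \<lambda>z. fst z), (\<lambda>z. - snd z, 1, \<lambda>z. fst z)]"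
  have "\<exists>R. residual_in (Cinf_topology knot_embeddings) R \<and> (\<forall>c\<in>R. \<forall>z\<in>UNIV. jet_sum l c z \<noteq> 0)"
  proof (rule residual_avoid_jet)
    show "DIM(real \<times> real) < 3" by simp
    show "smooth_jet l" by (auto simp: l_def smooth_jet_def intro!: smooth_proj)
    fix z :: "real \<times> real"
    \<comment> \<open>At its own centre the bump has first derivative 0 and second derivative (2
      pi)^2, whatever the multiplier.\<close>
    show "\<exists>B. smooth_on UNIV B \<and> (\<forall>x. B (x + 1) = B x) \<and> jet_sum l B z \<noteq> (0 :: real)"
      by (intro exI[of _ "trig_bump (fst z)"])
        (auto simp: l_def jet_sum_def trig_bump_periodic funpow_2 vderiv_trig)
  qed
  then obtain R where R: "residual_in (Cinf_topology knot_embeddings) R"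
    "\<And>c z. c \<in> R \<Longrightarrow> jet_sum l c z \<noteq> 0" by blast
  have "vderiv (vderiv c) x \<noteq> a *\<^sub>R vderiv c x" if "c \<in> R" for c x a
    using R(2)[OF that, of "(x, a)"] by (simp add: l_def jet_sum_def funpow_2)
  then show ?thesis using R(1) by blast
qed

lemma residual_tangent_transversal:
  "\<exists>R. residual_in (Cinf_topology knot_embeddings) R \<and>
    (\<forall>c\<in>R. \<forall>s t a p q. s - t \<notin> \<int> \<longrightarrow> c t - c s = a *\<^sub>R vderiv c s \<longrightarrow>
      vderiv c t \<noteq> p *\<^sub>R vderiv c s + q *\<^sub>R vderiv (vderiv c) s)"
proof -
  let ?s = "\<lambda>z :: real \<times> real \<times> real \<times> real \<times> real. fst z"
  let ?t = "\<lambda>z :: real \<times> real \<times> real \<times> real \<times> real. fst (snd z)"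
  let ?a = "\<lambda>z :: real \<times> real \<times> real \<times> real \<times> real. fst (snd (snd z))"
  let ?p = "\<lambda>z :: real \<times> real \<times> real \<times> real \<times> real. fst (snd (snd (snd z)))"
  let ?q = "\<lambda>z :: real \<times> real \<times> real \<times> real \<times> real. snd (snd (snd (snd z)))"
  define l where "l = [(\<lambda>z. 1, 0::nat, ?t), (\<lambda>z. - 1, 0, ?s), (\<lambda>z. - ?a z, 1, ?s)]"
  define m where "m = [(\<lambda>z. 1, 1::nat, ?t), (\<lambda>z. - ?p z, 1, ?s), (\<lambda>z. - ?q z, 2, ?s)]"
  have "\<exists>R. residual_in (Cinf_topology knot_embeddings) R \<and>
    (\<forall>c\<in>R. \<forall>z\<in>{z. ?s z - ?t z \<notin> \<int>}. (jet_sum l c z, jet_sum m c z) \<noteq> 0)"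
  proof (rule residual_avoid_two_jets)
    show "DIM(real \<times> real \<times> real \<times> real \<times> real) < 6" by simp
    show "smooth_jet l" "smooth_jet m" by (auto simp: l_def m_def smooth_jet_def intro!: smooth_proj)
    fix z assume "z \<in> {z. ?s z - ?t z \<notin> \<int>}"
    then have st: "?s z - ?t z \<notin> \<int>" by simp
    let ?b = "trig_bump (?s z)"
    \<comment> \<open>Both functions have vanishing 2-jet at the startpoint. At the endpoint
      \<open>?A\<close> is nonzero, whereas \<open>?B\<close> vanishes with nonzero derivative, so
      the system is triangular.\<close>
    let ?q = "\<lambda>x. ?b x * sin (2 * pi * (x - ?t z))"
    let ?A = "\<lambda>x. ?b x * ?b x" and ?B = "\<lambda>x. ?b x * ?q x"
    have sb: "smooth_on UNIV ?b" by blast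
    have sq: "smooth_on UNIV ?q" by (intro smooth_on_mult open_UNIV smooth_trig)
    have b0: "?b (?s z) = 0" by (simp add: trig_bump_def)
    have bt: "?b (?t z) \<noteq> 0" using trig_bump_nonzero(1)[OF st] .
    have "vderiv ?B (?t z) = ?b (?t z) * (?b (?t z) * (2 * pi))"
      by (simp add: vderiv_mult[OF sb sq] vderiv_mult[OF sb smooth_trig(1)] vderiv_trig(3))
    then have "jet_sum l ?A z * jet_sum m ?B z - jet_sum l ?B z * jet_sum m ?A z \<noteq> 0"
      using bt by (simp add: l_def m_def jet_sum_def funpow_2 b0 trig_bump_mult_zero[OF sb] trig_bump_mult_zero[OF sq])
    moreover have "smooth_on UNIV ?A" "smooth_on UNIV ?B" by (intro smooth_on_mult open_UNIV sb sq)+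
    ultimately show "\<exists>A B. smooth_on UNIV A \<and> (\<forall>x. A (x + 1) = A x) \<and> smooth_on UNIV B \<and> (\<forall>x. B (x + 1) = B x) \<and>
      jet_sum l A z * jet_sum m B z - jet_sum l B z * jet_sum m A z \<noteq> (0 :: real)"
      by (intro exI[of _ ?A] exI[of _ ?B]) (simp only: trig_bump_periodic sin_cos_period simp_thms)
  qed
  then obtain R where R: "residual_in (Cinf_topology knot_embeddings) R"
    "\<forall>c\<in>R. \<forall>z\<in>{z. ?s z - ?t z \<notin> \<int>}. (jet_sum l c z, jet_sum m c z) \<noteq> 0" by (elim exE conjE)
  have "vderiv c t \<noteq> p *\<^sub>R vderiv c s + q *\<^sub>R vderiv (vderiv c) s"
    if "c \<in> R" "s - t \<notin> \<int>" "c t - c s = a *\<^sub>R vderiv c s" for c s t a p q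
    using bspec[OF bspec[OF R(2) that(1)], of "(s, t, a, p, q)"] that(2,3)
    by (auto simp: l_def m_def jet_sum_def funpow_2 zero_prod_def algebra_simps)
  then show ?thesis using R(1) by blast
qed

lemma residual_no_tangent_trisecant:
  "\<exists>R. residual_in (Cinf_topology knot_embeddings) R \<and>
    (\<forall>c\<in>R. \<forall>s t r a b. s - t \<notin> \<int> \<longrightarrow> s - r \<notin> \<int> \<longrightarrow> t - r \<notin> \<int> \<longrightarrow> c t - c s = a *\<^sub>R vderiv c s \<longrightarrow>
      c r - c s \<noteq> b *\<^sub>R vderiv c s)"
proof -
  let ?s = "\<lambda>z :: real \<times> real \<times> real \<times> real \<times> real. fst z"
  let ?t = "\<lambda>z :: real \<times> real \<times> real \<times> real \<times> real. fst (snd z)"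
  let ?r = "\<lambda>z :: real \<times> real \<times> real \<times> real \<times> real. fst (snd (snd z))"
  let ?a = "\<lambda>z :: real \<times> real \<times> real \<times> real \<times> real. fst (snd (snd (snd z)))"
  let ?b = "\<lambda>z :: real \<times> real \<times> real \<times> real \<times> real. snd (snd (snd (snd z)))"
  let ?D = "{z. ?s z - ?t z \<notin> \<int> \<and> ?s z - ?r z \<notin> \<int> \<and> ?t z - ?r z \<notin> \<int>}"
  define l where "l = [(\<lambda>z. 1, 0::nat, ?t), (\<lambda>z. - 1, 0, ?s), (\<lambda>z. - ?a z, 1, ?s)]"
  define m where "m = [(\<lambda>z. 1, 0::nat, ?r), (\<lambda>z. - 1, 0, ?s), (\<lambda>z. - ?b z, 1, ?s)]"
  have "\<exists>R. residual_in (Cinf_topology knot_embeddings) R \<and>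
    (\<forall>c\<in>R. \<forall>z\<in>?D. (jet_sum l c z, jet_sum m c z) \<noteq> 0)"
  proof (rule residual_avoid_two_jets)
    show "DIM(real \<times> real \<times> real \<times> real \<times> real) < 6" by simp
    show "smooth_jet l" "smooth_jet m" by (auto simp: l_def m_def smooth_jet_def intro!: smooth_proj)
    fix z assume "z \<in> ?D"
    then have D: "?s z - ?t z \<notin> \<int>" "?s z - ?r z \<notin> \<int>" "?t z - ?r z \<notin> \<int>" by simp_all
    let ?bs = "trig_bump (?s z)" and ?bt = "trig_bump (?t z)" and ?br = "trig_bump (?r z)"
    \<comment> \<open>As in Lagrange interpolation: \<open>?A\<close> lives at t and vanishes at r,
      \<open>?B\<close> conversely, and neither is seen at s to first order. The matrix is
      diagonal.\<close>
    let ?A = "\<lambda>x. ?bs x * ?br x" and ?B = "\<lambda>x. ?bs x * ?bt x"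
    have b0: "trig_bump x x = 0" for x by (simp add: trig_bump_def)
    have "jet_sum l ?A z * jet_sum m ?B z - jet_sum l ?B z * jet_sum m ?A z \<noteq> 0"
      using trig_bump_nonzero[OF D(1)] trig_bump_nonzero[OF D(2)] trig_bump_nonzero[OF D(3)]
      by (simp add: l_def m_def jet_sum_def b0 trig_bump_mult_zero[OF smooth_trig(2)])
    moreover have "smooth_on UNIV ?A" "smooth_on UNIV ?B" by (intro smooth_on_mult open_UNIV smooth_trig)+
    ultimately show "\<exists>A B. smooth_on UNIV A \<and> (\<forall>x. A (x + 1) = A x) \<and> smooth_on UNIV B \<and> (\<forall>x. B (x + 1) = B x) \<and>
      jet_sum l A z * jet_sum m B z - jet_sum l B z * jet_sum m A z \<noteq> (0 :: real)"
      by (intro exI[of _ ?A] exI[of _ ?B]) (simp only: trig_bump_periodic simp_thms)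
  qed
  then obtain R where R: "residual_in (Cinf_topology knot_embeddings) R"
    "\<forall>c\<in>R. \<forall>z\<in>?D. (jet_sum l c z, jet_sum m c z) \<noteq> 0" by (elim exE conjE)
  have "c r - c s \<noteq> b *\<^sub>R vderiv c s"
    if "c \<in> R" "s - t \<notin> \<int>" "s - r \<notin> \<int>" "t - r \<notin> \<int>" "c t - c s = a *\<^sub>R vderiv c s" for c s t r a b
    using bspec[OF bspec[OF R(2) that(1)], of "(s, t, r, a, b)"] that(2-)
    by (auto simp: l_def m_def jet_sum_def zero_prod_def algebra_simps)
  then show ?thesis using R(1) by blast
qed

lemma residual_generic_knot:
  "\<exists>R. residual_in (Cinf_topology knot_embeddings) R \<and> R \<subseteq> knot_embeddings \<and> (\<forall>c\<in>R. generic_knot c)"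
proof -
  obtain R1 R2 R3 where R: "residual_in (Cinf_topology knot_embeddings) R1"
    "residual_in (Cinf_topology knot_embeddings) R2" "residual_in (Cinf_topology knot_embeddings) R3"
    and *: "\<forall>c\<in>R1. \<forall>x a. vderiv (vderiv c) x \<noteq> a *\<^sub>R vderiv c x"
    "\<forall>c\<in>R2. \<forall>s t a p q. s - t \<notin> \<int> \<longrightarrow> c t - c s = a *\<^sub>R vderiv c s \<longrightarrow>
      vderiv c t \<noteq> p *\<^sub>R vderiv c s + q *\<^sub>R vderiv (vderiv c) s"
    "\<forall>c\<in>R3. \<forall>s t r a b. s - t \<notin> \<int> \<longrightarrow> s - r \<notin> \<int> \<longrightarrow> t - r \<notin> \<int> \<longrightarrow> c t - c s = a *\<^sub>R vderiv c s \<longrightarrow>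
      c r - c s \<noteq> b *\<^sub>R vderiv c s"
    using residual_curvature residual_tangent_transversal residual_no_tangent_trisecant by (elim exE conjE)
  have "residual_in (Cinf_topology knot_embeddings) (R1 \<inter> (R2 \<inter> R3))" by (intro residual_in_Int R)
  moreover from this have "R1 \<inter> (R2 \<inter> R3) \<subseteq> knot_embeddings" by (simp add: residual_in_def)
  moreover have "generic_knot c" if "c \<in> R1 \<inter> (R2 \<inter> R3)" for c
    unfolding generic_knot_def using that *[THEN bspec] by simp
  ultimately show ?thesis by blast
qed

subsection \<open>Second-order Taylor expansion with smooth remainder\<close>

lemma has_vector_derivative_shift_left:
  fixes f :: "real \<Rightarrow> 'a::real_normed_vector"
  assumes "(f has_vector_derivative d) (at (s + u))"
  shows "((\<lambda>u. f (s + u)) has_vector_derivative d) (at u)"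
proof -
  have "((\<lambda>u. s + u) has_vector_derivative 1) (at u)" by (auto intro!: derivative_eq_intros)
  from vector_diff_chain_at[OF this assms] show ?thesis by (simp add: o_def)
qed

text \<open>Hadamard's lemma is applied twice, to \<open>f (s + u) - f s\<close> and then to the
  quotient minus its value at \<open>u = 0\<close>. Joint smoothness of the remainder is what
  permits limits along moving base points and division on the diagonal.\<close>

lemma smooth_taylor2:
  fixes f :: "real \<Rightarrow> 'a::banach"
  assumes f: "smooth_on UNIV f"
  obtains G :: "real \<times> real \<Rightarrow> 'a" where "smooth_on UNIV G"
    "\<And>s u. f (s + u) = f s + u *\<^sub>R vderiv f s + u\<^sup>2 *\<^sub>R G (s, u)"
    "\<And>s. G (s, 0) = (1/2) *\<^sub>R vderiv (vderiv f) s"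
proof -
  have f1: "smooth_on UNIV (vderiv f)" by (rule smooth_on_vderiv[OF f open_UNIV])
  have comp: "smooth_on UNIV (\<lambda>z. h (k z))" if "smooth_on UNIV h" "smooth_on UNIV k"
    for h :: "real \<Rightarrow> 'a" and k :: "real \<times> real \<Rightarrow> real"
    by (rule smooth_on_compose[OF open_UNIV open_UNIV that]) simp
  let ?F = "\<lambda>z. f (fst z + snd z) - f (fst z)"
  have "smooth_on UNIV ?F" by (intro smooth_on_diff comp f smooth_on_add smooth_proj)
  then obtain g where g: "smooth_on UNIV g" "\<And>s u. ?F (s, u) = u *\<^sub>R g (s, u)"
    "\<And>s. g (s, 0) = frechet_derivative ?F (at (s, 0)) (0, 1)"
    by (rule Hadamard) auto
  have g0: "g (s, 0) = vderiv f s" for s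
  proof -
    have a: "((\<lambda>z. fst z + snd z) has_derivative (\<lambda>v. fst v + snd v)) (at (s, 0))"
      "(fst has_derivative fst) (at (s, 0 :: real))"
      by (auto intro!: derivative_eq_intros)
    have b: "(f has_derivative (\<lambda>v. v *\<^sub>R vderiv f s)) (at s)"
      using smooth_on_has_vderiv[OF f, of s] by (simp add: has_vector_derivative_def)
    have "(?F has_derivative (\<lambda>v. (fst v + snd v) *\<^sub>R vderiv f s - fst v *\<^sub>R vderiv f s)) (at (s, 0))"
      by (intro has_derivative_diff has_derivative_compose[OF a(1)] has_derivative_compose[OF a(2)]) (simp_all add: b)
    from frechet_derivative_at[OF this] g(3)[of s] show ?thesis by (metis (no_types, lifting) add_0 diff_zero fst_conv scaleR_one scaleR_zero_left snd_conv)
  qed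
  have "smooth_on UNIV (\<lambda>z. g z - vderiv f (fst z))" by (intro smooth_on_diff comp f1 g smooth_proj)
  then obtain G where G: "smooth_on UNIV G" "\<And>s u. g (s, u) - vderiv f (fst (s, u)) = u *\<^sub>R G (s, u)"
    by (rule Hadamard) (auto simp: g0)
  have eq: "f (s + u) = f s + u *\<^sub>R vderiv f s + u\<^sup>2 *\<^sub>R G (s, u)" for s u
  proof -
    have "g (s, u) = vderiv f s + u *\<^sub>R G (s, u)" using G(2)[of s u] by (simp add: algebra_simps)
    then show ?thesis using g(2)[of s u] by (simp add: algebra_simps power2_eq_square)
  qed
  have "G (s, 0) = (1/2) *\<^sub>R vderiv (vderiv f) s" for s
  proof -
    let ?k = "\<lambda>u. G (s, u)"
    have k: "smooth_on UNIV ?k"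
      by (rule smooth_on_compose[OF open_UNIV open_UNIV G(1)]) (auto intro!: smooth_on_Pair smooth_proj)
    note k' = smooth_on_vderiv[OF k open_UNIV]
    \<comment> \<open>The value of \<open>G\<close> at \<open>u = 0\<close> is read off by
      differentiating the expansion twice in \<open>u\<close>.\<close>
    have d1: "vderiv f (s + u) = vderiv f s + (2 * u) *\<^sub>R ?k u + u\<^sup>2 *\<^sub>R vderiv ?k u" for u
    proof -
      have "((\<lambda>u. f s + u *\<^sub>R vderiv f s + u\<^sup>2 *\<^sub>R ?k u) has_vector_derivative
         vderiv f s + (2 * u) *\<^sub>R ?k u + u\<^sup>2 *\<^sub>R vderiv ?k u) (at u)"
        using smooth_on_has_vderiv[OF k, of u] unfolding has_vector_derivative_def
        by (auto intro!: derivative_eq_intros simp: algebra_simps)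
      moreover have "((\<lambda>u. f (s + u)) has_vector_derivative vderiv f (s + u)) (at u)"
        by (rule has_vector_derivative_shift_left[OF smooth_on_has_vderiv[OF f UNIV_I]])
      ultimately show ?thesis unfolding eq by (rule vector_derivative_unique_at[rotated])
    qed
    have "((\<lambda>u. vderiv f s + (2 * u) *\<^sub>R ?k u + u\<^sup>2 *\<^sub>R vderiv ?k u) has_vector_derivative 2 *\<^sub>R ?k 0) (at 0)"
      using smooth_on_has_vderiv[OF k, of 0] smooth_on_has_vderiv[OF k', of 0] unfolding has_vector_derivative_def
      by (auto intro!: derivative_eq_intros simp: algebra_simps)
    moreover have "((\<lambda>u. vderiv f (s + u)) has_vector_derivative vderiv (vderiv f) s) (at 0)"
      by (rule has_vector_derivative_shift_left) (use smooth_on_has_vderiv[OF f1, of s] in simp)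
    ultimately have "2 *\<^sub>R ?k 0 = vderiv (vderiv f) s" unfolding d1 by (rule vector_derivative_unique_at)
    then have "(1/2) *\<^sub>R (2 *\<^sub>R ?k 0) = (1/2) *\<^sub>R vderiv (vderiv f) s" by simp
    then show ?thesis by simp
  qed
  with G(1) eq show ?thesis by (rule that)
qed

subsection \<open>Arclength parametrizations\<close>

text \<open>The conditions on embeddings in geometric form: non-integer differences become distinct
  points, and since \<gamma>'' is orthogonal to \<gamma>' at unit speed, not being a multiple of
  \<gamma>' means being nonzero.\<close>

definition generic_curve :: "(real \<Rightarrow> real^3) \<Rightarrow> bool" where
  "generic_curve \<gamma> \<longleftrightarrow>
    (\<forall>s. vderiv (vderiv \<gamma>) s \<noteq> 0) \<and>
    (\<forall>s t a p q. \<gamma> s \<noteq> \<gamma> t \<longrightarrow> \<gamma> t - \<gamma> s = a *\<^sub>R vderiv \<gamma> s \<longrightarrow>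
      vderiv \<gamma> t \<noteq> p *\<^sub>R vderiv \<gamma> s + q *\<^sub>R vderiv (vderiv \<gamma>) s) \<and>
    (\<forall>s t r a b. \<gamma> s \<noteq> \<gamma> t \<longrightarrow> \<gamma> s \<noteq> \<gamma> r \<longrightarrow> \<gamma> t \<noteq> \<gamma> r \<longrightarrow> \<gamma> t - \<gamma> s = a *\<^sub>R vderiv \<gamma> s \<longrightarrow>
      \<gamma> r - \<gamma> s \<noteq> b *\<^sub>R vderiv \<gamma> s)"

lemma arclength_parametrizationD:
  assumes "arclength_parametrization L \<gamma> K"
  shows "0 < L" "smooth_on UNIV \<gamma>" "\<gamma> (x + L) = \<gamma> x" "norm (vderiv \<gamma> x) = 1"
    "\<gamma> x = \<gamma> y \<Longrightarrow> \<exists>k::int. x - y = of_int k * L" "range \<gamma> = K"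
  using assms by (auto simp: arclength_parametrization_def)

lemma arclength_inj:
  assumes "arclength_parametrization L \<gamma> K" "\<gamma> x = \<gamma> y" "\<bar>x - y\<bar> < L"
  shows "x = y"
proof -
  note D = arclength_parametrizationD[OF assms(1)]
  obtain k :: int where k: "x - y = of_int k * L" using D(5)[OF assms(2)] by blast
  have "\<bar>real_of_int k\<bar> * L < 1 * L" using assms(3) D(1) by (simp add: k abs_mult)
  then have "real_of_int \<bar>k\<bar> < 1" using D(1) by (simp only: mult_less_cancel_right_pos of_int_abs)
  then have "k = 0" by (simp only: of_int_less_1_iff zabs_less_one_iff)
  then show ?thesis using k by simp
qed

lemma parallel_unit:
  assumes "norm u = 1" "cross3 u w = 0"
  shows "w = (u \<bullet> w) *\<^sub>R u"
proof -
  have "cross3 u (cross3 u w) = (u \<bullet> w) *\<^sub>R u - (u \<bullet> u) *\<^sub>R w" by (rule Lagrange)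
  then show ?thesis using assms by (simp add: norm_eq_1 cross_zero_right)
qed

text \<open>Both curves are expanded to second order along a sequence of common points; no smooth
  reparametrization has to be constructed.\<close>

lemma reparametrization_derivatives:
  assumes c: "c \<in> knot_embeddings" and g: "arclength_parametrization L \<gamma> (range c)" and x: "c x = \<gamma> s"
  obtains \<tau> \<kappa> where "\<tau> \<noteq> 0" "vderiv c x = \<tau> *\<^sub>R vderiv \<gamma> s"
    "vderiv (vderiv c) x = \<tau>\<^sup>2 *\<^sub>R vderiv (vderiv \<gamma>) s + \<kappa> *\<^sub>R vderiv \<gamma> s"
proof -
  note cD = knot_embeddingsD[OF c] and gD = arclength_parametrizationD[OF g]
  obtain Gc :: "real \<times> real \<Rightarrow> real^3" where Gc: "smooth_on UNIV Gc" "\<And>s u. c (s + u) = c s + u *\<^sub>R vderiv c s + u\<^sup>2 *\<^sub>R Gc (s, u)"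
    "\<And>s. Gc (s, 0) = (1/2) *\<^sub>R vderiv (vderiv c) s" 
    by (rule smooth_taylor2[OF cD(1)]) (rule that; assumption)
  obtain Gg :: "real \<times> real \<Rightarrow> real^3" where Gg: "smooth_on UNIV Gg" "\<And>s u. \<gamma> (s + u) = \<gamma> s + u *\<^sub>R vderiv \<gamma> s + u\<^sup>2 *\<^sub>R Gg (s, u)"
    "\<And>s. Gg (s, 0) = (1/2) *\<^sub>R vderiv (vderiv \<gamma>) s"
    by (rule smooth_taylor2[OF gD(2)]) (rule that; assumption)
  \<comment> \<open>L / (n + 2) stays strictly between 0 and L, so no point of the sequence
    coincides with \<open>\<gamma> s\<close>.\<close>
  define \<sigma> where "\<sigma> n = L * inverse (real (Suc (Suc n)))" for n
  have \<sigma>0: "0 < \<sigma> n" "\<sigma> n < L" for n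
    using gD(1) by (simp_all add: \<sigma>_def field_simps add_pos_nonneg)
  have \<sigma>lim: "\<sigma> \<longlonglongrightarrow> 0"
    unfolding \<sigma>_def using tendsto_mult_right_zero[OF LIMSEQ_Suc[OF LIMSEQ_inverse_real_of_nat]] .
  have "\<exists>u. c (x + u) = \<gamma> (s + \<sigma> n) \<and> \<bar>u\<bar> \<le> 1/2" for n
  proof -
    have "\<gamma> (s + \<sigma> n) \<in> range c" using gD(6) by blast
    then obtain y where y: "c y = \<gamma> (s + \<sigma> n)" by (metis imageE)
    \<comment> \<open>The representative of the parameter offset of least absolute value; bounded
      offsets are needed for convergence to 0.\<close>
    define u where "u = (y - x) - of_int (round (y - x))"
    have "c (x + u) = c (y + of_int (- round (y - x)) * 1)" by (simp add: u_def)
    also have "\<dots> = c y" by (rule periodic_int) (rule cD(2))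
    finally show ?thesis using of_int_round_abs_le[of "y - x"] y by (intro exI[of _ u]) (simp add: u_def abs_minus_commute)
  qed
  then obtain \<xi> where \<xi>: "\<And>n. c (x + \<xi> n) = \<gamma> (s + \<sigma> n)" "\<And>n. \<bar>\<xi> n\<bar> \<le> 1/2" by metis
  have \<xi>nz: "\<xi> n \<noteq> 0" for n
  proof
    assume "\<xi> n = 0"
    then have "\<gamma> (s + \<sigma> n) = \<gamma> s" using \<xi>(1)[of n] x by simp
    from arclength_inj[OF g this] \<sigma>0[of n] show False by simp
  qed
  have \<xi>lim: "\<xi> \<longlonglongrightarrow> 0"
  proof (rule LIMSEQ_I)
    fix r :: real assume r: "r > 0"
    define F where "F = {-1/2..1/2} \<inter> {u::real. r \<le> \<bar>u\<bar>}"
    have F: "compact F" unfolding F_def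
      by (intro compact_Int_closed compact_Icc closed_Collect_le continuous_intros)
    have nz: "c (x + u) - c x \<noteq> 0" if u: "u \<in> F" for u
    proof
      assume "c (x + u) - c x = 0"
      then have "x + u - x \<in> \<int>" by (intro cD(4)) simp
      then obtain k where k: "u = of_int k" by (auto elim: Ints_cases)
      have "real_of_int \<bar>k\<bar> < 1" using u unfolding F_def k by auto
      then have "k = 0" by (simp only: of_int_less_1_iff zabs_less_one_iff)
      then show False using u r by (simp add: F_def k)
    qed
    have "\<exists>\<mu>>0. \<forall>u\<in>F. \<mu> \<le> norm (c (x + u) - c x)"
    proof (cases "F = {}")
      case True
      then show ?thesis by (intro exI[of _ 1]) simp
    next
      case False
      have "continuous_on F (\<lambda>u. norm (c (x + u) - c x))"
        by (intro continuous_intros continuous_on_compose2[OF smooth_on_continuous_on[OF cD(1)]]) auto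
      from continuous_attains_inf[OF F False this] nz show ?thesis by (metis zero_less_norm_iff)
    qed
    then obtain \<mu> where \<mu>: "\<mu> > 0" "\<And>u. u \<in> F \<Longrightarrow> \<mu> \<le> norm (c (x + u) - c x)" by blast
    have "(\<lambda>n. \<gamma> (s + \<sigma> n)) \<longlonglongrightarrow> \<gamma> (s + 0)"
      using smooth_on_continuous_on[OF gD(2)] \<sigma>lim
      by (intro continuous_on_tendsto_compose[of UNIV \<gamma>] tendsto_add tendsto_const) auto
    then obtain N where N: "\<And>n. n \<ge> N \<Longrightarrow> norm (\<gamma> (s + \<sigma> n) - \<gamma> s) < \<mu>"
      using LIMSEQ_D[OF _ \<mu>(1)] by force
    have "norm (\<xi> n - 0) < r" if n: "n \<ge> N" for n
    proof (rule ccontr)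
      assume "\<not> norm (\<xi> n - 0) < r"
      then have "\<xi> n \<in> F" using \<xi>(2)[of n] by (auto simp: F_def abs_le_iff)
      from \<mu>(2)[OF this] N[OF n] show False by (simp add: \<xi>(1) x)
    qed
    then show "\<exists>N. \<forall>n\<ge>N. norm (\<xi> n - 0) < r" by blast
  qed
  let ?c1 = "vderiv c x" and ?g1 = "vderiv \<gamma> s" and ?c2 = "vderiv (vderiv c) x" and ?g2 = "vderiv (vderiv \<gamma>) s"
  define t where "t n = \<sigma> n / \<xi> n" for n
  define A where "A n = ?c1 + \<xi> n *\<^sub>R Gc (x, \<xi> n)" for n
  define B where "B n = ?g1 + \<sigma> n *\<^sub>R Gg (s, \<sigma> n)" for n
  have limG: "(\<lambda>n. Gc (x, \<xi> n)) \<longlonglongrightarrow> Gc (x, 0)" "(\<lambda>n. Gg (s, \<sigma> n)) \<longlonglongrightarrow> Gg (s, 0)"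
    using \<xi>lim \<sigma>lim
    by (auto intro!: continuous_on_tendsto_compose[OF smooth_on_continuous_on[OF Gc(1)]]
      continuous_on_tendsto_compose[OF smooth_on_continuous_on[OF Gg(1)]] tendsto_Pair)
  have Alim: "A \<longlonglongrightarrow> ?c1" unfolding A_def
    using tendsto_add[OF tendsto_const tendsto_scaleR[OF \<xi>lim limG(1)], of ?c1] by simp
  have Blim: "B \<longlonglongrightarrow> ?g1" unfolding B_def
    using tendsto_add[OF tendsto_const tendsto_scaleR[OF \<sigma>lim limG(2)], of ?g1] by simp
  have exp: "\<xi> n *\<^sub>R ?c1 + (\<xi> n)\<^sup>2 *\<^sub>R Gc (x, \<xi> n) = \<sigma> n *\<^sub>R ?g1 + (\<sigma> n)\<^sup>2 *\<^sub>R Gg (s, \<sigma> n)" for n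
    using \<xi>(1)[of n] Gc(2)[of x "\<xi> n"] Gg(2)[of s "\<sigma> n"] x by (simp add: algebra_simps)
  have AB: "A n = t n *\<^sub>R B n" for n
  proof -
    have "\<xi> n *\<^sub>R A n = \<sigma> n *\<^sub>R B n" using exp[of n] by (simp add: A_def B_def algebra_simps power2_eq_square)
    then have "(1 / \<xi> n) *\<^sub>R (\<xi> n *\<^sub>R A n) = (1 / \<xi> n) *\<^sub>R (\<sigma> n *\<^sub>R B n)" by simp
    then show ?thesis using \<xi>nz[of n] by (simp add: t_def)
  qed
  \<comment> \<open>Since \<open>A n = t n *\<^sub>R B n\<close>, the inner product with the unit
    tangent isolates the ratio \<open>t n\<close> of the parameter steps, whose limit this must
    be.\<close>
  define \<tau> where "\<tau> = ?c1 \<bullet> ?g1"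
  have g11: "?g1 \<bullet> ?g1 = 1" using gD(4) by (simp add: norm_eq_1)
  have lim1: "(\<lambda>n. B n \<bullet> ?g1) \<longlonglongrightarrow> 1" using tendsto_inner[OF Blim tendsto_const[of ?g1]] g11 by simp
  have "(\<lambda>n. (A n \<bullet> ?g1) / (B n \<bullet> ?g1)) \<longlonglongrightarrow> \<tau> / 1"
    unfolding \<tau>_def by (intro tendsto_divide lim1 tendsto_inner[OF Alim tendsto_const]) simp
  moreover have "\<forall>\<^sub>F n in sequentially. (A n \<bullet> ?g1) / (B n \<bullet> ?g1) = t n"
  proof -
    have "\<forall>\<^sub>F n in sequentially. B n \<bullet> ?g1 \<noteq> 0"
      using order_tendstoD(1)[OF lim1, of 0] by (auto elim: eventually_mono)
    then show ?thesis by (rule eventually_mono) (simp add: AB)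
  qed
  ultimately have tlim: "t \<longlonglongrightarrow> \<tau>" by (auto intro: Lim_transform_eventually)
  have c1: "?c1 = \<tau> *\<^sub>R ?g1"
    using LIMSEQ_unique[OF Alim] tendsto_scaleR[OF tlim Blim] by (simp add: AB[abs_def])
  have \<tau>0: "\<tau> \<noteq> 0" using c1 cD(3)[of x] by auto
  \<comment> \<open>The first-order terms are multiples of the tangent, so the cross product with it
    leaves only the second-order terms.\<close>
  have "cross3 ?g1 (Gc (x, \<xi> n)) = (t n)\<^sup>2 *\<^sub>R cross3 ?g1 (Gg (s, \<sigma> n))" for n
  proof -
    have "cross3 ?g1 (\<xi> n *\<^sub>R ?c1 + (\<xi> n)\<^sup>2 *\<^sub>R Gc (x, \<xi> n)) = cross3 ?g1 (\<sigma> n *\<^sub>R ?g1 + (\<sigma> n)\<^sup>2 *\<^sub>R Gg (s, \<sigma> n))"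
      by (simp only: exp)
    then have "(\<xi> n)\<^sup>2 *\<^sub>R cross3 ?g1 (Gc (x, \<xi> n)) = (\<sigma> n)\<^sup>2 *\<^sub>R cross3 ?g1 (Gg (s, \<sigma> n))"
      by (simp add: c1 cross_add_right cross_mult_right)
    then have "(1 / (\<xi> n)\<^sup>2) *\<^sub>R ((\<xi> n)\<^sup>2 *\<^sub>R cross3 ?g1 (Gc (x, \<xi> n))) = (1 / (\<xi> n)\<^sup>2) *\<^sub>R ((\<sigma> n)\<^sup>2 *\<^sub>R cross3 ?g1 (Gg (s, \<sigma> n)))"
      by simp
    then show ?thesis using \<xi>nz[of n] by (simp add: t_def power_divide)
  qed
  moreover have "(\<lambda>n. cross3 ?g1 (Gc (x, \<xi> n))) \<longlonglongrightarrow> cross3 ?g1 (Gc (x, 0))"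
    "(\<lambda>n. (t n)\<^sup>2 *\<^sub>R cross3 ?g1 (Gg (s, \<sigma> n))) \<longlonglongrightarrow> \<tau>\<^sup>2 *\<^sub>R cross3 ?g1 (Gg (s, 0))"
    by (intro bounded_bilinear.tendsto[OF bounded_bilinear_cross3] tendsto_scaleR tendsto_power tlim limG tendsto_const)+
  ultimately have "cross3 ?g1 (Gc (x, 0)) = \<tau>\<^sup>2 *\<^sub>R cross3 ?g1 (Gg (s, 0))"
    using LIMSEQ_unique by simp
  then have "2 *\<^sub>R cross3 ?g1 ((1/2) *\<^sub>R ?c2) = 2 *\<^sub>R \<tau>\<^sup>2 *\<^sub>R cross3 ?g1 ((1/2) *\<^sub>R ?g2)"
    unfolding Gc(3) Gg(3) by simp
  then have "cross3 ?g1 ?c2 = \<tau>\<^sup>2 *\<^sub>R cross3 ?g1 ?g2" by (simp add: cross_mult_right)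
  then have "cross3 ?g1 (?c2 - \<tau>\<^sup>2 *\<^sub>R ?g2) = 0" by (simp add: Cross3.right_diff_distrib cross_mult_right)
  from parallel_unit[OF gD(4) this] obtain \<kappa> where "?c2 - \<tau>\<^sup>2 *\<^sub>R ?g2 = \<kappa> *\<^sub>R ?g1" by blast
  then have "?c2 = \<tau>\<^sup>2 *\<^sub>R ?g2 + \<kappa> *\<^sub>R ?g1" by (simp add: algebra_simps)
  with \<tau>0 c1 show ?thesis by (rule that)
qed

text \<open>Reparametrization multiplies c' by a nonzero number and changes c'' by a nonzero factor
  and a multiple of the tangent. The tangent line and the osculating plane are therefore unchanged,
  and the conditions concern nothing else.\<close>

lemma generic_curve_arclength:
  assumes c: "c \<in> knot_embeddings" "generic_knot c" and g: "arclength_parametrization L \<gamma> (range c)"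
  shows "generic_curve \<gamma>"
proof -
  have ex: "\<exists>x. c x = \<gamma> s" for s using arclength_parametrizationD(6)[OF g] by (metis rangeE rangeI)
  have notint: "x - y \<notin> \<int>" if "c x \<noteq> c y" for x y
  proof
    assume "x - y \<in> \<int>"
    then obtain k where k: "x = y + of_int k * 1" by (auto elim!: Ints_cases simp: algebra_simps)
    have "c x = c y" unfolding k by (rule periodic_int) (rule knot_embeddingsD(2)[OF c(1)])
    then show False using that by simp
  qed
  have G1: "vderiv (vderiv c) x \<noteq> a *\<^sub>R vderiv c x" for x a using c(2) by (simp add: generic_knot_def)
  have G2: "vderiv c t \<noteq> p *\<^sub>R vderiv c s + q *\<^sub>R vderiv (vderiv c) s"
    if "c s \<noteq> c t" "c t - c s = a *\<^sub>R vderiv c s" for s t a p q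
    using c(2) that notint[OF that(1)] unfolding generic_knot_def by blast
  have G3: "c r - c s \<noteq> b *\<^sub>R vderiv c s"
    if "c s \<noteq> c t" "c s \<noteq> c r" "c t \<noteq> c r" "c t - c s = a *\<^sub>R vderiv c s" for s t r a b
    using c(2) that notint[OF that(1)] notint[OF that(2)] notint[OF that(3)] unfolding generic_knot_def by blast
  show ?thesis
    unfolding generic_curve_def
  proof (intro conjI allI impI)
    fix s
    obtain x where x: "c x = \<gamma> s" using ex by blast
    obtain \<tau> \<kappa> where *: "\<tau> \<noteq> 0" "vderiv c x = \<tau> *\<^sub>R vderiv \<gamma> s"
      "vderiv (vderiv c) x = \<tau>\<^sup>2 *\<^sub>R vderiv (vderiv \<gamma>) s + \<kappa> *\<^sub>R vderiv \<gamma> s"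
      by (rule reparametrization_derivatives[OF c(1) g x])
    show "vderiv (vderiv \<gamma>) s \<noteq> 0"
      using G1[of x "\<kappa> / \<tau>"] * by auto
    fix t a
    obtain y where y: "c y = \<gamma> t" using ex by blast
    assume st: "\<gamma> s \<noteq> \<gamma> t" and a: "\<gamma> t - \<gamma> s = a *\<^sub>R vderiv \<gamma> s"
    have a': "c y - c x = (a / \<tau>) *\<^sub>R vderiv c x" using a * by (simp add: x y)
    have ne: "c x \<noteq> c y" using st by (simp add: x y)
    {
      fix p q
      show "vderiv \<gamma> t \<noteq> p *\<^sub>R vderiv \<gamma> s + q *\<^sub>R vderiv (vderiv \<gamma>) s"
      proof
        assume pq: "vderiv \<gamma> t = p *\<^sub>R vderiv \<gamma> s + q *\<^sub>R vderiv (vderiv \<gamma>) s"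
        obtain \<tau>' where t': "vderiv c y = \<tau>' *\<^sub>R vderiv \<gamma> t"
          using reparametrization_derivatives[OF c(1) g y] by metis
        have e1: "vderiv \<gamma> s = (1 / \<tau>) *\<^sub>R vderiv c x" using * by simp
        have "(1 / \<tau>\<^sup>2) *\<^sub>R vderiv (vderiv c) x = vderiv (vderiv \<gamma>) s + (\<kappa> / \<tau>\<^sup>2) *\<^sub>R vderiv \<gamma> s"
          unfolding *(3) using *(1) by (simp add: scaleR_add_right)
        then have e2: "vderiv (vderiv \<gamma>) s = (1 / \<tau>\<^sup>2) *\<^sub>R vderiv (vderiv c) x - (\<kappa> / \<tau>\<^sup>2) *\<^sub>R (1 / \<tau>) *\<^sub>R vderiv c x"
          by (simp add: e1)
        have "vderiv c y = (\<tau>' * (p * (1 / \<tau>)) - \<tau>' * (q * (\<kappa> / \<tau>\<^sup>2 * (1 / \<tau>)))) *\<^sub>R vderiv c x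
            + (\<tau>' * (q * (1 / \<tau>\<^sup>2))) *\<^sub>R vderiv (vderiv c) x"
          unfolding t' pq e1 e2
          by (simp only: scaleR_add_right scaleR_diff_right scaleR_diff_left scaleR_scaleR) (simp add: algebra_simps)
        then show False using G2[OF ne a'] by blast
      qed
    }
    fix r b
    obtain w where w: "c w = \<gamma> r" using ex by blast
    assume "\<gamma> s \<noteq> \<gamma> r" "\<gamma> t \<noteq> \<gamma> r"
    then have "c w - c x \<noteq> (b / \<tau>) *\<^sub>R vderiv c x" using G3[OF ne _ _ a', of w] by (simp add: x y w)
    then show "\<gamma> r - \<gamma> s \<noteq> b *\<^sub>R vderiv \<gamma> s" using * by (simp add: x w)
  qed
qed

section \<open>Generic framings\<close>

definition conormal :: "(real \<Rightarrow> real^3) \<Rightarrow> (real \<Rightarrow> real^3) \<Rightarrow> real \<Rightarrow> real^3" where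
  "conormal \<gamma> \<nu> s = cross3 (vderiv \<gamma> s) (\<nu> s)"

text \<open>The last two expressions of the first clause are the partial derivatives of q in t and
  in s, so the clause says that q is regular at its zeros with p > 0. In the second clause,
  \<open>vderiv (vderiv \<gamma>) s \<bullet> conormal \<gamma> \<nu> s\<close> is twice the value
  of q / (t - s)^2 on the diagonal, which is to have simple zeros.\<close>

definition generic_framing :: "(real \<Rightarrow> real^3) \<Rightarrow> (real \<Rightarrow> real^3) \<Rightarrow> bool" where
  "generic_framing \<gamma> \<nu> \<longleftrightarrow>
    (\<forall>s t. (\<gamma> t - \<gamma> s) \<bullet> \<nu> s > 0 \<longrightarrow> (\<gamma> t - \<gamma> s) \<bullet> conormal \<gamma> \<nu> s = 0 \<longrightarrow>
      vderiv \<gamma> t \<bullet> conormal \<gamma> \<nu> s = 0 \<longrightarrow> (\<gamma> t - \<gamma> s) \<bullet> vderiv (conormal \<gamma> \<nu>) s \<noteq> 0) \<and>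
    (\<forall>s. vderiv (vderiv \<gamma>) s \<bullet> conormal \<gamma> \<nu> s = 0 \<longrightarrow>
      vderiv (\<lambda>s. vderiv (vderiv \<gamma>) s \<bullet> conormal \<gamma> \<nu> s) s \<noteq> 0)"

lemma norm_cross3_le: "norm (cross3 x y) \<le> norm x * norm y"
proof -
  have "(norm (cross3 x y))\<^sup>2 \<le> (norm x * norm y)\<^sup>2" using norm_cross_dot[of x y] by (metis le_add_same_cancel1 zero_le_power2)
  then show ?thesis by (simp add: power2_le_iff_abs_le)
qed

locale arclength_curve =
  fixes L :: real and \<gamma> :: "real \<Rightarrow> real^3" and K
  assumes arclength: "arclength_parametrization L \<gamma> K"
begin

lemmas \<gamma>D = arclength_parametrizationD[OF arclength]

abbreviation "\<gamma>1 \<equiv> vderiv \<gamma>"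
abbreviation "\<gamma>2 \<equiv> vderiv (vderiv \<gamma>)"

lemma smooth_\<gamma>: "smooth_on UNIV \<gamma>" "smooth_on UNIV \<gamma>1" "smooth_on UNIV \<gamma>2"
proof -
  show 0: "smooth_on UNIV \<gamma>" by (rule \<gamma>D)
  show 1: "smooth_on UNIV \<gamma>1" by (rule smooth_on_vderiv[OF 0 open_UNIV])
  show "smooth_on UNIV \<gamma>2" by (rule smooth_on_vderiv[OF 1 open_UNIV])
qed

lemma \<gamma>1_unit: "\<gamma>1 s \<bullet> \<gamma>1 s = 1"
  using \<gamma>D(4)[of s] by (simp add: norm_eq_1)

sublocale framings: smooth_periodic_maps "framings L \<gamma>" L
  by standard (auto simp: framings_def \<gamma>D)

lemma framingD:
  assumes "\<nu> \<in> framings L \<gamma>"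
  shows "smooth_on UNIV \<nu>" "\<nu> (s + L) = \<nu> s" "norm (\<nu> s) = 1" "\<nu> s \<bullet> \<nu> s = 1" "\<nu> s \<bullet> \<gamma>1 s = 0" "\<gamma>1 s \<bullet> \<nu> s = 0"
proof -
  show "smooth_on UNIV \<nu>" "\<nu> (s + L) = \<nu> s" "norm (\<nu> s) = 1" "\<nu> s \<bullet> \<gamma>1 s = 0"
    using assms by (auto simp: framings_def)
  then show "\<nu> s \<bullet> \<nu> s = 1" "\<gamma>1 s \<bullet> \<nu> s = 0" by (simp_all add: norm_eq_1 inner_commute)
qed

lemma conormal_props:
  assumes "\<nu> \<in> framings L \<gamma>"
  shows "smooth_on UNIV (conormal \<gamma> \<nu>)" "conormal \<gamma> \<nu> s \<bullet> \<gamma>1 s = 0" "\<gamma>1 s \<bullet> conormal \<gamma> \<nu> s = 0"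
    "conormal \<gamma> \<nu> s \<bullet> \<nu> s = 0" "\<nu> s \<bullet> conormal \<gamma> \<nu> s = 0" "conormal \<gamma> \<nu> s \<bullet> conormal \<gamma> \<nu> s = 1"
    "cross3 (\<gamma>1 s) (conormal \<gamma> \<nu> s) = - \<nu> s"
    "vderiv (conormal \<gamma> \<nu>) s = cross3 (\<gamma>1 s) (vderiv \<nu> s) + cross3 (\<gamma>2 s) (\<nu> s)"
proof -
  note F = framingD[OF assms]
  show "smooth_on UNIV (conormal \<gamma> \<nu>)"
    unfolding conormal_def[abs_def] by (intro smooth_on_cross3 open_UNIV smooth_\<gamma> F)
  show "conormal \<gamma> \<nu> s \<bullet> \<gamma>1 s = 0" "\<gamma>1 s \<bullet> conormal \<gamma> \<nu> s = 0"
    "conormal \<gamma> \<nu> s \<bullet> \<nu> s = 0" "\<nu> s \<bullet> conormal \<gamma> \<nu> s = 0"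
    by (simp_all add: conormal_def dot_cross_self)
  have "(norm (conormal \<gamma> \<nu> s))\<^sup>2 = 1"
    using norm_cross_dot[of "\<gamma>1 s" "\<nu> s"] F(3,6) \<gamma>D(4) by (simp add: conormal_def)
  then show "conormal \<gamma> \<nu> s \<bullet> conormal \<gamma> \<nu> s = 1" by (simp add: power2_norm_eq_inner)
  show "cross3 (\<gamma>1 s) (conormal \<gamma> \<nu> s) = - \<nu> s"
    unfolding conormal_def Lagrange using F \<gamma>1_unit by simp
  show "vderiv (conormal \<gamma> \<nu>) s = cross3 (\<gamma>1 s) (vderiv \<nu> s) + cross3 (\<gamma>2 s) (\<nu> s)"
    unfolding conormal_def[abs_def]
    by (intro vector_derivative_at bounded_bilinear.has_vector_derivative[OF bounded_bilinear_cross3]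
       smooth_on_has_vderiv[OF smooth_\<gamma>(2) UNIV_I] smooth_on_has_vderiv[OF F(1) UNIV_I])
qed

text \<open>By the Lagrange identity \<open>w\<close> has zero cross product with the conormal, to
  which it is also orthogonal.\<close>

lemma orthogonal_frame_zero:
  assumes "\<nu> \<in> framings L \<gamma>" "w \<bullet> \<gamma>1 s = 0" "w \<bullet> \<nu> s = 0" "w \<bullet> conormal \<gamma> \<nu> s = 0"
  shows "w = 0"
proof -
  have "cross3 w (conormal \<gamma> \<nu> s) = 0" unfolding conormal_def Lagrange using assms(2,3) by simp
  then have "w = 0 \<or> conormal \<gamma> \<nu> s = 0" using assms(4) norm_and_cross_eq_0 by blast
  then show ?thesis using conormal_props(6)[OF assms(1), of s] by auto
qed

lemma \<gamma>1_\<gamma>2: "\<gamma>1 s \<bullet> \<gamma>2 s = 0"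
proof -
  have "((\<lambda>s. \<gamma>1 s \<bullet> \<gamma>1 s) has_vector_derivative (\<gamma>1 s \<bullet> \<gamma>2 s + \<gamma>2 s \<bullet> \<gamma>1 s)) (at s)"
    by (intro bounded_bilinear.has_vector_derivative[OF bounded_bilinear_inner]
       smooth_on_has_vderiv[OF smooth_\<gamma>(2) UNIV_I])
  moreover have "((\<lambda>s. \<gamma>1 s \<bullet> \<gamma>1 s) has_vector_derivative 0) (at s)" by (simp add: \<gamma>1_unit)
  ultimately have "\<gamma>1 s \<bullet> \<gamma>2 s + \<gamma>2 s \<bullet> \<gamma>1 s = 0" by (rule vector_derivative_unique_at)
  then show ?thesis by (simp add: inner_commute)
qed

lemma vderiv_curvature_inner:
  assumes "smooth_on UNIV m"
  shows "vderiv (\<lambda>s. \<gamma>2 s \<bullet> m s) s = \<gamma>2 s \<bullet> vderiv m s + vderiv \<gamma>2 s \<bullet> m s"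
  by (intro vector_derivative_at bounded_bilinear.has_vector_derivative[OF bounded_bilinear_inner]
    smooth_on_has_vderiv[OF smooth_\<gamma>(3) UNIV_I] smooth_on_has_vderiv[OF assms UNIV_I])

lemma smooth_cord_inner:
  assumes "smooth_on UNIV m"
  shows "smooth_on UNIV (\<lambda>z. (\<gamma> (snd z) - \<gamma> (fst z)) \<bullet> m (fst z))"
  by (intro smooth_on_inner smooth_on_diff smooth_proj smooth_on_compose[OF open_UNIV open_UNIV assms]
    smooth_on_compose[OF open_UNIV open_UNIV smooth_\<gamma>(1)]) auto

text \<open>Moving the startpoint changes the cord by a multiple of the tangent there, which is
  orthogonal to \<open>m s\<close>. In the direction of \<open>s\<close> only the derivative of
  \<open>m\<close> remains.\<close>

lemma cord_inner_has_derivative: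
  assumes m: "smooth_on UNIV m" and orth: "\<And>s. \<gamma>1 s \<bullet> m s = 0"
  shows "((\<lambda>z. (\<gamma> (snd z) - \<gamma> (fst z)) \<bullet> m (fst z)) has_derivative
    (\<lambda>v. fst v * ((\<gamma> t - \<gamma> s) \<bullet> vderiv m s) + snd v * (\<gamma>1 t \<bullet> m s))) (at (s, t))"
proof -
  have h: "((\<lambda>z. f (k z)) has_derivative (\<lambda>v. k v *\<^sub>R vderiv f (k (s, t)))) (at (s, t))"
    if "smooth_on UNIV f" "bounded_linear k" for f :: "real \<Rightarrow> real^3" and k :: "real \<times> real \<Rightarrow> real"
    using has_derivative_compose[OF bounded_linear_imp_has_derivative[OF that(2)]
      smooth_on_has_vderiv[OF that(1) UNIV_I, unfolded has_vector_derivative_def]] .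
  note d = h[OF smooth_\<gamma>(1) bounded_linear_snd] h[OF smooth_\<gamma>(1) bounded_linear_fst] h[OF m bounded_linear_fst]
  have "((\<lambda>z. (\<gamma> (snd z) - \<gamma> (fst z)) \<bullet> m (fst z)) has_derivative
    (\<lambda>v. (\<gamma> (snd (s, t)) - \<gamma> (fst (s, t))) \<bullet> (fst v *\<^sub>R vderiv m (fst (s, t))) +
      (snd v *\<^sub>R \<gamma>1 (snd (s, t)) - fst v *\<^sub>R \<gamma>1 (fst (s, t))) \<bullet> m (fst (s, t)))) (at (s, t))"
    by (intro has_derivative_inner has_derivative_diff d)
  moreover have "(\<lambda>v. (\<gamma> (snd (s, t)) - \<gamma> (fst (s, t))) \<bullet> (fst v *\<^sub>R vderiv m (fst (s, t))) +
      (snd v *\<^sub>R \<gamma>1 (snd (s, t)) - fst v *\<^sub>R \<gamma>1 (fst (s, t))) \<bullet> m (fst (s, t))) =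
    (\<lambda>v. fst v * ((\<gamma> t - \<gamma> s) \<bullet> vderiv m s) + snd v * (\<gamma>1 t \<bullet> m s))"
    by (simp add: fun_eq_iff inner_diff_left orth)
  ultimately show ?thesis by simp
qed

end

section \<open>Sard's theorem for plane maps\<close>

lemma vector_2_axis: "vector [x, y] = x *\<^sub>R axis 1 1 + y *\<^sub>R (axis 2 1 :: real^2)"
  by (simp add: vec_eq_iff forall_2 vector_2 axis_def)

text \<open>Singularity is expressed by a nonzero covector annihilating the derivative, which is how
  it arises for \<open>\<Theta>\<close>. The linear maps \<open>P\<close> and \<open>I\<close> only
  carry the plane to \<open>real^2\<close>.\<close>

lemma negligible_singular_image:
  fixes \<Theta> :: "real \<times> real \<Rightarrow> real^2"
  assumes der: "\<And>z. z \<in> E \<Longrightarrow> (\<Theta> has_derivative \<Theta>' z) (at z)"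
    and sing: "\<And>z. z \<in> E \<Longrightarrow> \<exists>u. u \<noteq> 0 \<and> (\<forall>v. u \<bullet> \<Theta>' z v = 0)"
  shows "negligible (\<Theta> ` E)"
proof -
  define P where "P x = (x $ 1, x $ 2)" for x :: "real^2"
  define I :: "real \<times> real \<Rightarrow> real^2" where "I z = vector [fst z, snd z]" for z
  have PI: "P (I z) = z" for z by (simp add: P_def I_def vector_2)
  have P: "bounded_linear P" unfolding P_def[abs_def]
    by (intro bounded_linear_Pair bounded_linear_vec_nth)
  define f where "f x = \<Theta> (P x)" for x
  have "negligible (f ` (I ` E))"
  proof (rule baby_Sard)
    show "CARD(2) \<le> CARD(2)" by simp
    fix x assume "x \<in> I ` E"
    then have PE: "P x \<in> E" using PI by auto
    have d: "(f has_derivative (\<lambda>v. \<Theta>' (P x) (P v))) (at x)"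
      unfolding f_def[abs_def]
      by (rule has_derivative_compose[OF bounded_linear_imp_has_derivative[OF P] der[OF PE]])
    then show "(f has_derivative (\<lambda>v. \<Theta>' (P x) (P v))) (at x within I ` E)"
      by (rule has_derivative_at_withinI)
    have lin: "linear (\<lambda>v. \<Theta>' (P x) (P v))" using d by (rule has_derivative_linear)
    obtain u where u: "u \<noteq> 0" "\<And>v. u \<bullet> \<Theta>' (P x) v = 0" using sing[OF PE] by blast
    have "\<not> inj (\<lambda>v. \<Theta>' (P x) (P v))"
    proof
      assume "inj (\<lambda>v. \<Theta>' (P x) (P v))"
      then have "surj (\<lambda>v. \<Theta>' (P x) (P v))" using linear_injective_imp_surjective[OF lin] by simp
      then obtain v where "u = \<Theta>' (P x) (P v)" by (metis surjD)
      then have "u \<bullet> u = 0" using u(2) by metis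
      then show False using u(1) by simp
    qed
    moreover have "(*v) (matrix (\<lambda>v. \<Theta>' (P x) (P v))) = (\<lambda>v. \<Theta>' (P x) (P v))"
      using matrix_works[OF lin[folded linear_matrix_vector_mul_eq]] lin by (simp add: fun_eq_iff matrix_works)
    ultimately show "rank (matrix (\<lambda>v. \<Theta>' (P x) (P v))) < CARD(2)"
      by (simp only: less_rank_noninjective simp_thms)
  qed
  moreover have "f ` (I ` E) = \<Theta> ` E" by (simp add: f_def image_image PI)
  ultimately show ?thesis by simp
qed

lemma smooth_on_Pair_const: "smooth_on UNIV (\<lambda>s::real. (v, s))"
  by (intro smooth_on_Pair smooth_proj)

locale framed_curve = arclength_curve +
  fixes \<nu> assumes framing: "\<nu> \<in> framings L \<gamma>" and curv: "\<And>s. vderiv (vderiv \<gamma>) s \<noteq> 0"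
begin

abbreviation "\<mu> \<equiv> conormal \<gamma> \<nu>"
abbreviation "\<omega> \<equiv> 2 * pi / L"

lemmas \<nu>D = framingD[OF framing]
lemmas \<mu>D = conormal_props[OF framing]

text \<open>The framing turned by the angle \<open>arctan (\<phi> s)\<close>, where
  \<open>\<phi> s = v\<^sub>1 cos (\<omega> s) + v\<^sub>2 sin (\<omega> s)\<close>; two parameters suffice to prescribe \<open>\<phi>\<close> and \<open>\<phi>'\<close> at a point.\<close>

definition \<phi> :: "real^2 \<Rightarrow> real \<Rightarrow> real" where
  "\<phi> v s = v $ 1 * cos (\<omega> * s) + v $ 2 * sin (\<omega> * s)"

definition \<phi>d :: "real^2 \<Rightarrow> real \<Rightarrow> real" where
  "\<phi>d v s = \<omega> * (v $ 2 * cos (\<omega> * s) - v $ 1 * sin (\<omega> * s))"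

text \<open>This is cos (arctan \<phi>), the factor that makes the turned vector a unit
  vector.\<close>

definition \<iota> :: "real^2 \<Rightarrow> real \<Rightarrow> real" where
  "\<iota> v s = inverse (sqrt (1 + (\<phi> v s)\<^sup>2))"

definition turned :: "real^2 \<Rightarrow> real \<Rightarrow> real^3" where
  "turned v s = \<iota> v s *\<^sub>R (\<nu> s + \<phi> v s *\<^sub>R \<mu> s)"

lemma \<iota>_pos: "\<iota> v s > 0"
  unfolding \<iota>_def by (simp add: add_pos_nonneg)

lemma smooth_turned: "smooth_on UNIV (\<lambda>z. \<iota> (fst z) (snd z))" "smooth_on UNIV (\<lambda>z. turned (fst z) (snd z))"
proof -
  have v: "smooth_on UNIV (\<lambda>z :: (real^2) \<times> real. fst z $ i)" for i
    by (intro bounded_linear.smooth_on_linear[OF bounded_linear_vec_nth] smooth_proj)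
  have \<phi>: "smooth_on UNIV (\<lambda>z. \<phi> (fst z) (snd z))"
    unfolding \<phi>_def[abs_def] by (intro smooth_on_add smooth_on_mult smooth_on_sin_cos v smooth_proj)
  show 1: "smooth_on UNIV (\<lambda>z. \<iota> (fst z) (snd z))"
    unfolding \<iota>_def[abs_def] power2_eq_square
    by (intro smooth_on_inverse smooth_on_sqrt smooth_on_add smooth_on_mult \<phi> smooth_proj)
      (auto simp: add_pos_nonneg add_nonneg_eq_0_iff)
  show "smooth_on UNIV (\<lambda>z. turned (fst z) (snd z))"
    unfolding turned_def[abs_def]
    by (intro smooth_on_scaleR smooth_on_add 1 \<phi> smooth_on_compose[OF open_UNIV open_UNIV \<nu>D(1)]
      smooth_on_compose[OF open_UNIV open_UNIV \<mu>D(1)] smooth_proj) auto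
qed

lemma \<phi>_has_derivative: "(\<phi> v has_vector_derivative \<phi>d v s) (at s)"
proof -
  have "((\<lambda>s. a * cos (w * s) + b * sin (w * s)) has_real_derivative w * (b * cos (w * s) - a * sin (w * s))) (at s)"
    for a b w by (auto intro!: derivative_eq_intros simp: algebra_simps)
  then show ?thesis
    unfolding \<phi>_def[abs_def] \<phi>d_def has_real_derivative_iff_has_vector_derivative[symmetric] .
qed

lemma \<phi>_periodic: "\<phi> v (s + L) = \<phi> v s"
proof -
  have "\<omega> * (s + L) = \<omega> * s + 2 * pi" using \<gamma>D(1) by (simp add: field_simps)
  then show ?thesis by (simp only: \<phi>_def cos_periodic sin_periodic)
qed

lemma \<mu>_periodic: "\<mu> (s + L) = \<mu> s"
  unfolding conormal_def using vderiv_periodic[OF \<gamma>D(2,3)] \<nu>D(2) by simp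

lemma turned_framing: "turned v \<in> framings L \<gamma>"
proof -
  have "smooth_on UNIV (turned v)"
    using smooth_on_compose[OF open_UNIV open_UNIV smooth_turned(2) smooth_on_Pair_const] by simp
  moreover have "turned v (s + L) = turned v s" for s
    by (simp add: turned_def \<iota>_def \<phi>_periodic \<mu>_periodic \<nu>D(2))
  moreover have "norm (turned v s) = 1" for s
  proof -
    have "(norm (\<nu> s + \<phi> v s *\<^sub>R \<mu> s))\<^sup>2 = 1 + (\<phi> v s)\<^sup>2"
      unfolding power2_norm_eq_inner
      by (simp add: inner_add_left inner_add_right \<nu>D \<mu>D power2_eq_square)
    then have "norm (\<nu> s + \<phi> v s *\<^sub>R \<mu> s) = sqrt (1 + (\<phi> v s)\<^sup>2)"
      by (metis norm_ge_zero real_sqrt_unique)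
    moreover have "sqrt (1 + (\<phi> v s)\<^sup>2) > 0" by (simp add: add_pos_nonneg)
    ultimately show ?thesis using \<iota>_pos[of v s] by (simp add: turned_def \<iota>_def)
  qed
  moreover have "turned v s \<bullet> \<gamma>1 s = 0" for s
    by (simp add: turned_def inner_add_left \<nu>D \<mu>D)
  ultimately show ?thesis by (simp add: framings_def)
qed

lemma conormal_turned: "conormal \<gamma> (turned v) s = \<iota> v s *\<^sub>R (\<mu> s - \<phi> v s *\<^sub>R \<nu> s)"
proof -
  have "conormal \<gamma> (turned v) s = \<iota> v s *\<^sub>R (\<mu> s + \<phi> v s *\<^sub>R cross3 (\<gamma>1 s) (\<mu> s))"
    by (simp add: conormal_def turned_def cross_mult_right cross_add_right)
  then show ?thesis by (simp add: \<mu>D(7))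
qed

text \<open>\<open>d\<close> comes from differentiating the normalizing factor. The vector it
  multiplies is proportional to the turned conormal, hence orthogonal to the cord at a zero of q,
  where \<open>d\<close> drops out.\<close>

lemma vderiv_conormal_turned:
  obtains d where "vderiv (conormal \<gamma> (turned v)) s =
    \<iota> v s *\<^sub>R (vderiv \<mu> s - \<phi> v s *\<^sub>R vderiv \<nu> s - \<phi>d v s *\<^sub>R \<nu> s) + d *\<^sub>R (\<mu> s - \<phi> v s *\<^sub>R \<nu> s)"
proof
  have sm: "smooth_on UNIV (\<iota> v)"
    using smooth_on_compose[OF open_UNIV open_UNIV smooth_turned(1) smooth_on_Pair_const] by simp
  have "((\<lambda>s. \<iota> v s *\<^sub>R (\<mu> s - \<phi> v s *\<^sub>R \<nu> s)) has_vector_derivative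
    \<iota> v s *\<^sub>R (vderiv \<mu> s - (\<phi> v s *\<^sub>R vderiv \<nu> s + \<phi>d v s *\<^sub>R \<nu> s)) + vderiv (\<iota> v) s *\<^sub>R (\<mu> s - \<phi> v s *\<^sub>R \<nu> s)) (at s)"
    by (intro bounded_bilinear.has_vector_derivative[OF bounded_bilinear_scaleR] has_vector_derivative_diff
       \<phi>_has_derivative smooth_on_has_vderiv[OF sm UNIV_I] smooth_on_has_vderiv[OF \<nu>D(1) UNIV_I]
       smooth_on_has_vderiv[OF \<mu>D(1) UNIV_I])
  then show "vderiv (conormal \<gamma> (turned v)) s =
    \<iota> v s *\<^sub>R (vderiv \<mu> s - \<phi> v s *\<^sub>R vderiv \<nu> s - \<phi>d v s *\<^sub>R \<nu> s) + vderiv (\<iota> v) s *\<^sub>R (\<mu> s - \<phi> v s *\<^sub>R \<nu> s)"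
    unfolding conormal_turned[abs_def] by (simp add: vector_derivative_at diff_diff_eq)
qed

text \<open>Up to the scale \<omega>, value and derivative are the vector \<open>v\<close> rotated
  by the angle - \<omega> s, and rotating back recovers \<open>v\<close>. Each prescribed 1-jet at
  \<open>s\<close> thus has at most one parameter.\<close>

lemma \<phi>_prescribed:
  assumes "\<phi> v s = a" "\<phi>d v s = b"
  shows "v = vector [a * cos (\<omega> * s) - b / \<omega> * sin (\<omega> * s), a * sin (\<omega> * s) + b / \<omega> * cos (\<omega> * s)]"
proof -
  have L: "L > 0" by (rule \<gamma>D)
  let ?c = "cos (\<omega> * s)" and ?s = "sin (\<omega> * s)"
  have a: "a = v $ 1 * ?c + v $ 2 * ?s" and b: "b / \<omega> = v $ 2 * ?c - v $ 1 * ?s"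
    using assms L by (auto simp: \<phi>_def \<phi>d_def field_simps)
  have cs: "?c * ?c + ?s * ?s = 1" using sin_cos_squared_add3 .
  have "(x * c + y * s) * c - (y * c - x * s) * s = x * (c * c + s * s)"
    "(x * c + y * s) * s + (y * c - x * s) * c = y * (c * c + s * s)" for x y c s :: real
    by (simp_all add: algebra_simps)
  then have "a * ?c - b / \<omega> * ?s = v $ 1 * (?c * ?c + ?s * ?s)" "a * ?s + b / \<omega> * ?c = v $ 2 * (?c * ?c + ?s * ?s)"
    unfolding a b by blast+
  then show ?thesis unfolding cs by (simp only: vec_eq_iff forall_2 vector_2 mult_1_right)
qed

section \<open>Parameters that create a degenerate zero\<close>

definition "p0 z = (\<gamma> (snd z) - \<gamma> (fst z)) \<bullet> \<nu> (fst z)"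
definition "q0 z = (\<gamma> (snd z) - \<gamma> (fst z)) \<bullet> \<mu> (fst z)"

lemma smooth_pq: "smooth_on UNIV p0" "smooth_on UNIV q0"
  unfolding p0_def[abs_def] q0_def[abs_def] by (intro smooth_cord_inner \<nu>D \<mu>D)+

text \<open>The slope of the projected cord in the frame \<nu>, \<mu>: the turned framing points
  along the projection only if \<phi> equals it.\<close>

definition "f0 z = q0 z / p0 z"
definition "g0 z = ((\<gamma> (snd z) - \<gamma> (fst z)) \<bullet> vderiv \<mu> (fst z) -
  f0 z * ((\<gamma> (snd z) - \<gamma> (fst z)) \<bullet> vderiv \<nu> (fst z))) / p0 z"
definition "h0 z = (\<gamma>1 (snd z) \<bullet> \<mu> (fst z) - f0 z * (\<gamma>1 (snd z) \<bullet> \<nu> (fst z))) / p0 z"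

lemma f0_has_derivative:
  assumes "p0 z \<noteq> 0"
  shows "(f0 has_derivative (\<lambda>v. fst v * g0 z + snd v * h0 z)) (at z)"
proof -
  obtain s t where z: "z = (s, t)" by (cases z)
  note p = cord_inner_has_derivative[OF \<nu>D(1) \<nu>D(6), of t s, folded p0_def]
  note q = cord_inner_has_derivative[OF \<mu>D(1) \<mu>D(3), of t s, folded q0_def]
  have "(f0 has_derivative (\<lambda>v. (- (q0 (s, t)) * (inverse (p0 (s, t)) * (fst v * ((\<gamma> t - \<gamma> s) \<bullet> vderiv \<nu> s) + snd v * (\<gamma>1 t \<bullet> \<nu> s)) * inverse (p0 (s, t))) +
     (fst v * ((\<gamma> t - \<gamma> s) \<bullet> vderiv \<mu> s) + snd v * (\<gamma>1 t \<bullet> \<mu> s)) / p0 (s, t)))) (at (s, t))"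
    unfolding f0_def[abs_def] using assms by (intro has_derivative_divide[OF q p]) (simp add: z)
  moreover have "(- (q0 (s, t)) * (inverse (p0 (s, t)) * (fst v * ((\<gamma> t - \<gamma> s) \<bullet> vderiv \<nu> s) + snd v * (\<gamma>1 t \<bullet> \<nu> s)) * inverse (p0 (s, t))) +
     (fst v * ((\<gamma> t - \<gamma> s) \<bullet> vderiv \<mu> s) + snd v * (\<gamma>1 t \<bullet> \<mu> s)) / p0 (s, t)) = fst v * g0 z + snd v * h0 z" for v
    using assms unfolding g0_def h0_def f0_def z by (simp add: field_simps)
  ultimately show ?thesis unfolding z by simp
qed

definition \<Theta> :: "real \<times> real \<Rightarrow> real^2" where
  "\<Theta> z = vector [f0 z * cos (\<omega> * fst z) - g0 z / \<omega> * sin (\<omega> * fst z), f0 z * sin (\<omega> * fst z) + g0 z / \<omega> * cos (\<omega> * fst z)]"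

text \<open>Turning by \<open>\<phi>\<close> makes \<open>(s, t)\<close> a degenerate zero of \<open>q\<close> iff \<open>\<phi> = f0\<close>, \<open>\<phi>' = \<partial>\<^sub>s f0 = g0\<close> and
  \<open>\<partial>\<^sub>t f0 = h0 = 0\<close>; \<open>\<Theta>\<close> is the resulting parameter. Since \<open>f0 = \<Theta>\<^sub>1 cos (\<omega> s) + \<Theta>\<^sub>2 sin (\<omega> s)\<close> has
  \<open>s\<close>-derivative \<open>g0\<close>, the derivative of \<open>\<Theta>\<close> is orthogonal to \<open>(cos (\<omega> s), sin (\<omega> s))\<close> where \<open>h0 = 0\<close>.\<close>

lemma negligible_\<Theta>: "negligible (\<Theta> ` {z. p0 z > 0 \<and> h0 z = 0})"
proof (rule negligible_singular_image)
  fix z assume "z \<in> {z. p0 z > 0 \<and> h0 z = 0}"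
  then have z: "p0 z > 0" "h0 z = 0" by auto
  have L: "L > 0" by (rule \<gamma>D)
  let ?U = "{z. p0 z > 0}"
  have U: "open ?U" by (intro open_Collect_less smooth_on_continuous_on smooth_pq continuous_on_const)
  have sub: "smooth_on ?U f" if "smooth_on UNIV f" for f :: "real \<times> real \<Rightarrow> real"
    using smooth_on_subset[OF that] by simp
  have f: "smooth_on ?U f0" unfolding f0_def[abs_def]
    by (intro smooth_on_divide U sub smooth_pq) auto
  have g: "smooth_on ?U g0" unfolding g0_def[abs_def]
    by (intro smooth_on_divide smooth_on_diff smooth_on_mult U f sub smooth_pq smooth_cord_inner
       smooth_on_vderiv \<nu>D \<mu>D open_UNIV) auto
  have dg: "(g0 has_derivative frechet_derivative g0 (at z)) (at z)"
    using smooth_on_has_derivative[OF g] z(1) by simp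
  let ?Dg = "frechet_derivative g0 (at z)"
  let ?c = "cos (\<omega> * fst z)" and ?s = "sin (\<omega> * fst z)"
  define \<Theta>1 where "\<Theta>1 v = f0 z * (- (?s * (\<omega> * fst v))) + (fst v * g0 z + snd v * h0 z) * ?c
      - (g0 z / \<omega> * (?c * (\<omega> * fst v)) + ?Dg v / \<omega> * ?s)" for v
  define \<Theta>2 where "\<Theta>2 v = f0 z * (?c * (\<omega> * fst v)) + (fst v * g0 z + snd v * h0 z) * ?s
      + (g0 z / \<omega> * (- (?s * (\<omega> * fst v))) + ?Dg v / \<omega> * ?c)" for v
  have dc: "((\<lambda>z. cos (\<omega> * fst z)) has_derivative (\<lambda>v. - (?s * (\<omega> * fst v)))) (at z)"
    "((\<lambda>z. sin (\<omega> * fst z)) has_derivative (\<lambda>v. ?c * (\<omega> * fst v))) (at z)"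
  proof -
    have "((\<lambda>z. cos (w * fst z)) has_derivative (\<lambda>v. - (sin (w * fst z) * (w * fst v)))) (at z)"
      "((\<lambda>z. sin (w * fst z)) has_derivative (\<lambda>v. cos (w * fst z) * (w * fst v))) (at z)" for w :: real
      by (auto intro!: derivative_eq_intros)
    then show "((\<lambda>z. cos (\<omega> * fst z)) has_derivative (\<lambda>v. - (?s * (\<omega> * fst v)))) (at z)"
      "((\<lambda>z. sin (\<omega> * fst z)) has_derivative (\<lambda>v. ?c * (\<omega> * fst v))) (at z)" by blast+
  qed
  have dgw: "((\<lambda>z. g0 z / \<omega>) has_derivative (\<lambda>v. ?Dg v / \<omega>)) (at z)"
    using has_derivative_mult_left[OF dg, of "1 / \<omega>"] by simp
  have df: "(f0 has_derivative (\<lambda>v. fst v * g0 z + snd v * h0 z)) (at z)"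
    using f0_has_derivative z(1) by simp
  have d1: "((\<lambda>z. f0 z * cos (\<omega> * fst z) - g0 z / \<omega> * sin (\<omega> * fst z)) has_derivative \<Theta>1) (at z)"
    unfolding \<Theta>1_def[abs_def] by (intro has_derivative_diff has_derivative_mult df dc dgw)
  have d2: "((\<lambda>z. f0 z * sin (\<omega> * fst z) + g0 z / \<omega> * cos (\<omega> * fst z)) has_derivative \<Theta>2) (at z)"
    unfolding \<Theta>2_def[abs_def] by (intro has_derivative_add has_derivative_mult df dc dgw)
  have d\<Theta>: "(\<Theta> has_derivative (\<lambda>v. \<Theta>1 v *\<^sub>R axis 1 1 + \<Theta>2 v *\<^sub>R axis 2 1)) (at z)"
    unfolding \<Theta>_def[abs_def] vector_2_axis by (intro has_derivative_add has_derivative_scaleR_left d1 d2)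
  note \<Theta>' = frechet_derivative_at[OF d\<Theta>, symmetric]
  show "(\<Theta> has_derivative frechet_derivative \<Theta> (at z)) (at z)"
    unfolding \<Theta>' by (rule d\<Theta>)
  have cs: "?c * ?c + ?s * ?s = 1" using sin_cos_squared_add3 .
  have "?c * \<Theta>1 v + ?s * \<Theta>2 v = 0" for v
  proof -
    have "?c * \<Theta>1 v + ?s * \<Theta>2 v = (fst v * g0 z) * (?c * ?c + ?s * ?s) - (g0 z / \<omega> * (\<omega> * fst v)) * (?c * ?c + ?s * ?s)"
    proof -
      \<comment> \<open>Here f is the slope, k is g0 / \<omega> and D the differential of g0. The
        terms in f and D cancel because \<open>(- s, c)\<close> is orthogonal to
        \<open>(c, s)\<close>; the remaining two cancel because k \<omega> = g0.\<close>
      have "c * (f * (- (s * (w * x))) + (x * g + y * 0) * c - (k * (c * (w * x)) + D * s)) +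
          s * (f * (c * (w * x)) + (x * g + y * 0) * s + (k * (- (s * (w * x))) + D * c)) =
          (x * g) * (c * c + s * s) - (k * (w * x)) * (c * c + s * s)" for c s f w x g y k D :: real
        by (simp add: algebra_simps)
      then show ?thesis unfolding \<Theta>1_def \<Theta>2_def z(2) by blast
    qed
    then show ?thesis unfolding cs using L by simp
  qed
  then have "vector [?c, ?s] \<bullet> frechet_derivative \<Theta> (at z) v = (0 :: real)" for v
    unfolding \<Theta>' by (simp add: inner_vec_def sum_2 vector_2 axis_def)
  moreover have "vector [?c, ?s] \<noteq> (0 :: real^2)"
  proof
    assume "vector [?c, ?s] = (0 :: real^2)"
    then have "?c = 0" "?s = 0" by (simp_all add: vec_eq_iff forall_2 vector_2)
    then show False using cs by (simp only: mult_zero_right add_0_right zero_neq_one)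
  qed
  ultimately show "\<exists>u. u \<noteq> 0 \<and> (\<forall>v. u \<bullet> frechet_derivative \<Theta> (at z) v = 0)" by blast
qed

lemma turned_0: "turned 0 = \<nu>"
  by (simp add: fun_eq_iff turned_def \<iota>_def \<phi>_def)

text \<open>The counterpart of \<open>f0\<close> on the diagonal, where \<gamma>'' replaces the cord
  because the first-order part of a short cord is tangential. \<open>gb\<close> is its derivative.
  With one variable \<open>s\<close> against two parameters, a dimension count suffices.\<close>

definition "fb s = (\<gamma>2 s \<bullet> \<mu> s) / (\<gamma>2 s \<bullet> \<nu> s)"
definition "gb s = ((\<gamma>2 s \<bullet> vderiv \<mu> s + vderiv \<gamma>2 s \<bullet> \<mu> s) -
  fb s * (\<gamma>2 s \<bullet> vderiv \<nu> s + vderiv \<gamma>2 s \<bullet> \<nu> s)) / (\<gamma>2 s \<bullet> \<nu> s)"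
definition \<Theta>b :: "real \<Rightarrow> real^2" where
  "\<Theta>b s = vector [fb s * cos (\<omega> * s) - gb s / \<omega> * sin (\<omega> * s), fb s * sin (\<omega> * s) + gb s / \<omega> * cos (\<omega> * s)]"

lemma negligible_\<Theta>b: "negligible (\<Theta>b ` {s. \<gamma>2 s \<bullet> \<nu> s \<noteq> 0})"
proof (rule negligible_differentiable_image_lowdim)
  show "DIM(real) < DIM(real^2)" by simp
  let ?U = "{s. \<gamma>2 s \<bullet> \<nu> s \<noteq> 0}"
  have y: "smooth_on UNIV (\<lambda>s. \<gamma>2 s \<bullet> \<nu> s)" by (intro smooth_on_inner open_UNIV smooth_\<gamma> \<nu>D)
  have U: "open ?U" by (intro open_Collect_neq smooth_on_continuous_on y continuous_on_const)
  have sub: "smooth_on ?U f" if "smooth_on UNIV f" for f :: "real \<Rightarrow> real"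
    using smooth_on_subset[OF that] by simp
  note i = smooth_on_inner[OF open_UNIV] smooth_on_vderiv[OF _ open_UNIV]
  have f: "smooth_on ?U fb" unfolding fb_def[abs_def]
    by (intro smooth_on_divide U sub y i smooth_\<gamma> \<mu>D) auto
  have g: "smooth_on ?U gb" unfolding gb_def[abs_def]
    by (intro smooth_on_divide[OF U] smooth_on_diff[OF U] smooth_on_add[OF U] smooth_on_mult[OF U] U f sub y i smooth_\<gamma> \<mu>D \<nu>D) auto
  have gw: "smooth_on ?U (\<lambda>s. gb s / w)" for w
    unfolding divide_inverse by (intro smooth_on_mult[OF U] g smooth_on_const)
  have tr: "smooth_on ?U (\<lambda>s. sin (w * s))" "smooth_on ?U (\<lambda>s. cos (w * s))" for w
    by (intro smooth_on_sin_cos smooth_on_mult U smooth_on_const smooth_on_id)+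
  have "smooth_on ?U \<Theta>b" unfolding \<Theta>b_def[abs_def] vector_2_axis
    by (intro smooth_on_add[OF U] smooth_on_scaleR[OF U] smooth_on_diff[OF U] smooth_on_mult[OF U] f gw tr smooth_on_const)
  then show "\<Theta>b differentiable_on ?U" by (rule smooth_on_differentiable_on)
qed

text \<open>A degenerate zero for the turned framing prescribes value and derivative of \<phi> at
  \<open>s\<close>, hence the whole of \<open>v\<close>, which then lies in one of the two excluded
  images.\<close>

lemma generic_turned:
  assumes A: "v \<notin> \<Theta> ` {z. p0 z > 0 \<and> h0 z = 0}" and B: "v \<notin> \<Theta>b ` {s. \<gamma>2 s \<bullet> \<nu> s \<noteq> 0}"
  shows "generic_framing \<gamma> (turned v)"
  unfolding generic_framing_def
proof (intro conjI allI impI notI)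
  fix s t
  let ?w = "\<gamma> t - \<gamma> s" and ?\<phi> = "\<phi> v s"
  assume 1: "0 < ?w \<bullet> turned v s" and 2: "?w \<bullet> conormal \<gamma> (turned v) s = 0"
    and 3: "\<gamma>1 t \<bullet> conormal \<gamma> (turned v) s = 0" and 4: "?w \<bullet> vderiv (conormal \<gamma> (turned v)) s = 0"
  note i = \<iota>_pos[of v s]
  have q: "q0 (s, t) = ?\<phi> * p0 (s, t)"
    using 2 i by (simp add: conormal_turned q0_def p0_def inner_diff_right)
  \<comment> \<open>At a zero of the turned q, the turned p is a positive multiple of
    \<open>p0\<close>, so the old cord also has \<open>p0 > 0\<close> and \<open>f0\<close> is
    defined.\<close>
  have "?w \<bullet> turned v s = \<iota> v s * ((1 + ?\<phi>\<^sup>2) * p0 (s, t))"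
  proof -
    have "?w \<bullet> turned v s = \<iota> v s * (p0 (s, t) + ?\<phi> * q0 (s, t))"
      by (simp add: turned_def q0_def p0_def inner_add_right)
    then show ?thesis unfolding q by (simp add: algebra_simps power2_eq_square)
  qed
  then have "0 < (1 + ?\<phi>\<^sup>2) * p0 (s, t)" using 1 i by (simp add: zero_less_mult_iff)
  moreover have "0 < 1 + ?\<phi>\<^sup>2" by (simp add: add_pos_nonneg)
  ultimately have p: "p0 (s, t) > 0" by (simp only: zero_less_mult_pos)
  have f: "?\<phi> = f0 (s, t)" using p q by (simp add: f0_def)
  have "\<gamma>1 t \<bullet> \<mu> s - ?\<phi> * (\<gamma>1 t \<bullet> \<nu> s) = 0"
    using 3 i by (simp add: conormal_turned inner_diff_right)
  then have h: "h0 (s, t) = 0" by (simp add: h0_def f)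
  obtain d where d: "vderiv (conormal \<gamma> (turned v)) s =
    \<iota> v s *\<^sub>R (vderiv \<mu> s - \<phi> v s *\<^sub>R vderiv \<nu> s - \<phi>d v s *\<^sub>R \<nu> s) + d *\<^sub>R (\<mu> s - \<phi> v s *\<^sub>R \<nu> s)"
    by (rule vderiv_conormal_turned)
  have "?w \<bullet> (\<mu> s - ?\<phi> *\<^sub>R \<nu> s) = 0" using q by (simp add: q0_def p0_def inner_diff_right)
  then have "\<iota> v s * (?w \<bullet> (vderiv \<mu> s - ?\<phi> *\<^sub>R vderiv \<nu> s - \<phi>d v s *\<^sub>R \<nu> s)) = 0"
    using 4 unfolding d by (simp only: inner_add_right inner_scaleR_right mult_zero_right add_0_right)
  then have "?w \<bullet> vderiv \<mu> s - ?\<phi> * (?w \<bullet> vderiv \<nu> s) - \<phi>d v s * p0 (s, t) = 0"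
    using i by (simp add: inner_diff_right p0_def)
  then have "\<phi>d v s = g0 (s, t)" using p by (simp add: g0_def f field_simps)
  from \<phi>_prescribed[OF f this] have "v = \<Theta> (s, t)" by (simp add: \<Theta>_def)
  then show False using A p h by blast
next
  fix s
  let ?\<phi> = "\<phi> v s"
  assume 1: "\<gamma>2 s \<bullet> conormal \<gamma> (turned v) s = 0" and 2: "vderiv (\<lambda>s. \<gamma>2 s \<bullet> conormal \<gamma> (turned v) s) s = 0"
  note i = \<iota>_pos[of v s]
  have x: "\<gamma>2 s \<bullet> \<mu> s = ?\<phi> * (\<gamma>2 s \<bullet> \<nu> s)"
    using 1 i by (simp add: conormal_turned inner_diff_right)
  \<comment> \<open>Otherwise \<gamma>'' would be orthogonal to the entire frame; nonvanishing
    curvature excludes this and allows division by this component.\<close>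
  have y: "\<gamma>2 s \<bullet> \<nu> s \<noteq> 0"
  proof
    assume 0: "\<gamma>2 s \<bullet> \<nu> s = 0"
    then have "\<gamma>2 s = 0"
      using orthogonal_frame_zero[OF framing, of "\<gamma>2 s" s] x \<gamma>1_\<gamma>2[of s] by (simp add: inner_commute)
    then show False using curv by blast
  qed
  have f: "?\<phi> = fb s" using x y by (simp add: fb_def)
  obtain d where d: "vderiv (conormal \<gamma> (turned v)) s =
    \<iota> v s *\<^sub>R (vderiv \<mu> s - \<phi> v s *\<^sub>R vderiv \<nu> s - \<phi>d v s *\<^sub>R \<nu> s) + d *\<^sub>R (\<mu> s - \<phi> v s *\<^sub>R \<nu> s)"
    by (rule vderiv_conormal_turned)
  have "\<gamma>2 s \<bullet> (\<mu> s - ?\<phi> *\<^sub>R \<nu> s) = 0" using x by (simp add: inner_diff_right)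
  then have "\<iota> v s * (\<gamma>2 s \<bullet> (vderiv \<mu> s - ?\<phi> *\<^sub>R vderiv \<nu> s - \<phi>d v s *\<^sub>R \<nu> s) +
      vderiv \<gamma>2 s \<bullet> (\<mu> s - ?\<phi> *\<^sub>R \<nu> s)) = 0"
    using 2 unfolding vderiv_curvature_inner[OF conormal_props(1)[OF turned_framing]] d
    by (simp only: conormal_turned inner_add_right inner_scaleR_right mult_zero_right add_0_right distrib_left)
  then have "\<gamma>2 s \<bullet> (vderiv \<mu> s - ?\<phi> *\<^sub>R vderiv \<nu> s - \<phi>d v s *\<^sub>R \<nu> s) +
      vderiv \<gamma>2 s \<bullet> (\<mu> s - ?\<phi> *\<^sub>R \<nu> s) = 0" using i by simp
  then have "(\<gamma>2 s \<bullet> vderiv \<mu> s + vderiv \<gamma>2 s \<bullet> \<mu> s) - ?\<phi> * (\<gamma>2 s \<bullet> vderiv \<nu> s + vderiv \<gamma>2 s \<bullet> \<nu> s)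
      = \<phi>d v s * (\<gamma>2 s \<bullet> \<nu> s)" by (simp add: inner_diff_right algebra_simps)
  then have "\<phi>d v s = gb s" using y by (simp add: gb_def f)
  from \<phi>_prescribed[OF f this] have "v = \<Theta>b s" by (simp add: \<Theta>b_def)
  then show False using B y by blast
qed

lemma generic_framing_nearby:
  assumes e: "e > 0"
  shows "\<exists>g\<in>Cinf_ball (framings L \<gamma>) k e \<nu>. generic_framing \<gamma> g"
proof -
  obtain d where d: "d > 0" "\<And>v. norm v < d \<Longrightarrow>
    \<forall>j\<le>k. \<forall>x. norm ((vderiv ^^ j) (\<lambda>x. turned v x) x - (vderiv ^^ j) (\<lambda>x. turned 0 x) x) < e"
    using smooth_family_close[OF \<gamma>D(1) smooth_turned(2) _ e, of k] framingD(2)[OF turned_framing] by auto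
  obtain v where v: "norm v < d" "v \<notin> \<Theta> ` {z. p0 z > 0 \<and> h0 z = 0} \<union> \<Theta>b ` {s. \<gamma>2 s \<bullet> \<nu> s \<noteq> 0}"
    by (rule negligible_avoid[OF negligible_Un[OF negligible_\<Theta> negligible_\<Theta>b] d(1)])
  have "turned v \<in> Cinf_ball (framings L \<gamma>) k e \<nu>"
    using d(2)[OF v(1)] turned_framing by (simp add: Cinf_ball_def turned_0)
  then show ?thesis using generic_turned v(2) by blast
qed

end

section \<open>Openness of the framing conditions\<close>

context arclength_curve
begin

text \<open>The conormal is linear in the framing, so C^1-closeness passes to it and to its
  derivative by the bound on cross products.\<close>

lemma conormal_est:
  assumes "c \<in> framings L \<gamma>" "g \<in> Cinf_ball (framings L \<gamma>) 1 e c"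
  shows "norm (g s - c s) \<le> e" "norm (conormal \<gamma> g s - conormal \<gamma> c s) \<le> e"
    "norm (vderiv (conormal \<gamma> g) s - vderiv (conormal \<gamma> c) s) \<le> (1 + norm (\<gamma>2 s)) * e"
proof -
  have g: "g \<in> framings L \<gamma>" and *: "\<And>k x. k \<le> 1 \<Longrightarrow> norm ((vderiv ^^ k) g x - (vderiv ^^ k) c x) < e"
    using assms(2) by (auto simp: Cinf_ball_def)
  show 0: "norm (g s - c s) \<le> e" using *[of 0 s] by simp
  have 1: "norm (vderiv g s - vderiv c s) \<le> e" using *[of 1 s] by simp
  have "conormal \<gamma> g s - conormal \<gamma> c s = cross3 (\<gamma>1 s) (g s - c s)"
    by (simp add: conormal_def Cross3.right_diff_distrib)
  then show "norm (conormal \<gamma> g s - conormal \<gamma> c s) \<le> e"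
    using norm_cross3_le[of "\<gamma>1 s" "g s - c s"] 0 by (simp add: \<gamma>D(4))
  have "vderiv (conormal \<gamma> g) s - vderiv (conormal \<gamma> c) s =
    cross3 (\<gamma>1 s) (vderiv g s - vderiv c s) + cross3 (\<gamma>2 s) (g s - c s)"
    by (simp add: conormal_props(8)[OF g] conormal_props(8)[OF assms(1)] Cross3.right_diff_distrib)
  also have "norm \<dots> \<le> norm (vderiv g s - vderiv c s) + norm (\<gamma>2 s) * norm (g s - c s)"
    using norm_cross3_le[of "\<gamma>1 s" "vderiv g s - vderiv c s"] norm_cross3_le[of "\<gamma>2 s" "g s - c s"]
    by (intro norm_triangle_le) (simp add: \<gamma>D(4))
  also have "\<dots> \<le> e + norm (\<gamma>2 s) * e" by (intro add_mono 1 mult_left_mono 0) simp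
  finally show "norm (vderiv (conormal \<gamma> g) s - vderiv (conormal \<gamma> c) s) \<le> (1 + norm (\<gamma>2 s)) * e"
    by (simp add: distrib_right)
qed

lemma inner_est: "norm (a - b) \<le> C \<Longrightarrow> \<bar>w \<bullet> a - w \<bullet> b\<bar> \<le> norm w * C" for a b w :: "real^3"
proof -
  assume C: "norm (a - b) \<le> C"
  have "\<bar>w \<bullet> a - w \<bullet> b\<bar> = \<bar>w \<bullet> (a - b)\<bar>" by (simp add: inner_diff_right)
  also have "\<dots> \<le> norm w * norm (a - b)" by (rule Cauchy_Schwarz_ineq2)
  also have "\<dots> \<le> norm w * C" by (intro mult_left_mono C) simp
  finally show ?thesis .
qed

text \<open>\<open>FA n \<nu> z = 0\<close> says that \<open>z\<close> is a degenerate zero of \<open>q\<close> with \<open>p \<ge> 1 / (n + 1)\<close>; the threshold makes the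
  condition closed.\<close>

definition FA :: "nat \<Rightarrow> (real \<Rightarrow> real^3) \<Rightarrow> real \<times> real \<Rightarrow> real \<times> real \<times> real \<times> real" where
  "FA n \<nu> z = (max 0 (inverse (real (Suc n)) - (\<gamma> (snd z) - \<gamma> (fst z)) \<bullet> \<nu> (fst z)),
    (\<gamma> (snd z) - \<gamma> (fst z)) \<bullet> conormal \<gamma> \<nu> (fst z), \<gamma>1 (snd z) \<bullet> conormal \<gamma> \<nu> (fst z),
    (\<gamma> (snd z) - \<gamma> (fst z)) \<bullet> vderiv (conormal \<gamma> \<nu>) (fst z))"

text \<open>The condition on the diagonal is closed as it stands and requires no threshold.\<close>

definition FB :: "(real \<Rightarrow> real^3) \<Rightarrow> real \<Rightarrow> real \<times> real" where
  "FB \<nu> s = (\<gamma>2 s \<bullet> conormal \<gamma> \<nu> s, vderiv (\<lambda>s. \<gamma>2 s \<bullet> conormal \<gamma> \<nu> s) s)"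

lemma continuous_compose_smooth:
  fixes f :: "real \<Rightarrow> 'a::real_normed_vector" and k :: "'b::topological_space \<Rightarrow> real"
  assumes "smooth_on UNIV f" "continuous_on S k"
  shows "continuous_on S (\<lambda>z. f (k z))"
  by (rule continuous_on_compose2[OF smooth_on_continuous_on[OF assms(1)] assms(2)]) simp

lemma openin_FA:
  "openin (Cinf_topology (framings L \<gamma>)) {\<nu>\<in>framings L \<gamma>. \<forall>z\<in>cball 0 r. FA n \<nu> z \<noteq> 0}"
proof (rule framings.open_avoid_compact[where n = 1])
  let ?w = "\<lambda>z. \<gamma> (snd z) - \<gamma> (fst z)"
  let ?K = "\<lambda>z. norm (?w z) + (norm (?w z) + (norm (\<gamma>1 (snd z)) + norm (?w z) * (1 + norm (\<gamma>2 (fst z)))))"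
  show "compact (cball (0 :: real \<times> real) r)" by simp
  show "continuous_on (cball 0 r) (FA n c)" if "c \<in> framings L \<gamma>" for c
    unfolding FA_def[abs_def]
    using framingD(1)[OF that] conormal_props(1)[OF that] smooth_on_vderiv[OF conormal_props(1)[OF that] open_UNIV]
    by (intro continuous_intros continuous_compose_smooth smooth_\<gamma>)
  show "continuous_on (cball 0 r) ?K"
    by (intro continuous_intros continuous_compose_smooth smooth_\<gamma>)
  fix c g and z :: "real \<times> real" and e :: real
  assume c: "c \<in> framings L \<gamma>" and g: "g \<in> Cinf_ball (framings L \<gamma>) 1 e c"
  note est = conormal_est[OF c g, of "fst z"]
  have trip: "norm (a, b, p, q) \<le> \<bar>a\<bar> + (\<bar>b\<bar> + (\<bar>p\<bar> + \<bar>q\<bar>))" for a b p q :: real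
    using norm_Pair_le[of a "(b, p, q)"] norm_Pair_le[of b "(p, q)"] norm_Pair_le[of p q] by simp
  have mx: "\<bar>max 0 (x - y) - max 0 (x - y')\<bar> \<le> \<bar>y - y'\<bar>" for x y y' :: real by linarith
  have "norm (FA n g z - FA n c z) \<le> norm (?w z) * e + (norm (?w z) * e +
      (norm (\<gamma>1 (snd z)) * e + norm (?w z) * ((1 + norm (\<gamma>2 (fst z))) * e)))"
    unfolding FA_def diff_Pair
    by (intro order_trans[OF trip] add_mono inner_est est order_trans[OF mx])
  then show "norm (FA n g z - FA n c z) \<le> ?K z * e" by (simp add: algebra_simps)
qed

lemma openin_FB:
  "openin (Cinf_topology (framings L \<gamma>)) {\<nu>\<in>framings L \<gamma>. \<forall>s\<in>cball 0 r. FB \<nu> s \<noteq> 0}"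
proof (rule framings.open_avoid_compact[where n = 1])
  let ?K = "\<lambda>s. norm (\<gamma>2 s) + (norm (\<gamma>2 s) * (1 + norm (\<gamma>2 s)) + norm (vderiv \<gamma>2 s))"
  have s3: "smooth_on UNIV (vderiv \<gamma>2)" by (rule smooth_on_vderiv[OF smooth_\<gamma>(3) open_UNIV])
  show "compact (cball (0 :: real) r)" by simp
  show "continuous_on (cball 0 r) (FB c)" if "c \<in> framings L \<gamma>" for c
    unfolding FB_def[abs_def] vderiv_curvature_inner[OF conormal_props(1)[OF that]]
    using conormal_props(1)[OF that] smooth_on_vderiv[OF conormal_props(1)[OF that] open_UNIV]
    by (intro continuous_intros continuous_compose_smooth[OF _ continuous_on_id] smooth_\<gamma> s3)
  show "continuous_on (cball 0 r) ?K"
    by (intro continuous_intros continuous_compose_smooth[OF _ continuous_on_id] smooth_\<gamma> s3)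
  fix c g and s e :: real
  assume c: "c \<in> framings L \<gamma>" and g: "g \<in> Cinf_ball (framings L \<gamma>) 1 e c"
  have g': "g \<in> framings L \<gamma>" using g by (simp add: Cinf_ball_def)
  note est = conormal_est[OF c g, of s]
  have pr: "norm (a, b + p) \<le> \<bar>a\<bar> + (\<bar>b\<bar> + \<bar>p\<bar>)" for a b p :: real
    using norm_Pair_le[of a "b + p"] by simp
  have e: "FB g s - FB c s = (\<gamma>2 s \<bullet> conormal \<gamma> g s - \<gamma>2 s \<bullet> conormal \<gamma> c s,
    (\<gamma>2 s \<bullet> vderiv (conormal \<gamma> g) s - \<gamma>2 s \<bullet> vderiv (conormal \<gamma> c) s) +
    (vderiv \<gamma>2 s \<bullet> conormal \<gamma> g s - vderiv \<gamma>2 s \<bullet> conormal \<gamma> c s))"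
    by (simp add: FB_def vderiv_curvature_inner[OF conormal_props(1)[OF c]] vderiv_curvature_inner[OF conormal_props(1)[OF g']])
  have "norm (FB g s - FB c s) \<le> norm (\<gamma>2 s) * e + (norm (\<gamma>2 s) * ((1 + norm (\<gamma>2 s)) * e) + norm (vderiv \<gamma>2 s) * e)"
    unfolding e by (intro order_trans[OF pr] add_mono inner_est est)
  then show "norm (FB g s - FB c s) \<le> ?K s * e" by (simp add: algebra_simps)
qed

text \<open>Genericity is exhausted by countably many conditions over compact balls, each of them
  open by the preceding estimates.\<close>

lemma generic_framing_iff:
  "generic_framing \<gamma> \<nu> \<longleftrightarrow> (\<forall>n. \<forall>z\<in>cball 0 (real n). FA n \<nu> z \<noteq> 0) \<and> (\<forall>n. \<forall>s\<in>cball 0 (real n). FB \<nu> s \<noteq> 0)"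
proof (intro iffI conjI)
  assume g: "generic_framing \<gamma> \<nu>"
  show "\<forall>n. \<forall>z\<in>cball 0 (real n). FA n \<nu> z \<noteq> 0"
  proof (intro allI ballI notI)
    fix n z assume "FA n \<nu> z = 0"
    then have z: "max 0 (inverse (real (Suc n)) - (\<gamma> (snd z) - \<gamma> (fst z)) \<bullet> \<nu> (fst z)) = 0"
      "(\<gamma> (snd z) - \<gamma> (fst z)) \<bullet> conormal \<gamma> \<nu> (fst z) = 0" "\<gamma>1 (snd z) \<bullet> conormal \<gamma> \<nu> (fst z) = 0"
      "(\<gamma> (snd z) - \<gamma> (fst z)) \<bullet> vderiv (conormal \<gamma> \<nu>) (fst z) = 0"
      by (simp_all add: FA_def zero_prod_def)
    have "0 < inverse (real (Suc n))" by simp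
    then have "0 < (\<gamma> (snd z) - \<gamma> (fst z)) \<bullet> \<nu> (fst z)" using z(1) by linarith
    then show False using g z(2-4) unfolding generic_framing_def by blast
  qed
  show "\<forall>n. \<forall>s\<in>cball 0 (real n). FB \<nu> s \<noteq> 0"
    using g by (auto simp: generic_framing_def FB_def zero_prod_def)
next
  assume h: "(\<forall>n. \<forall>z\<in>cball 0 (real n). FA n \<nu> z \<noteq> 0) \<and> (\<forall>n. \<forall>s\<in>cball 0 (real n). FB \<nu> s \<noteq> 0)"
  show "generic_framing \<gamma> \<nu>"
    unfolding generic_framing_def
  proof (intro conjI allI impI notI)
    fix s t
    assume 1: "0 < (\<gamma> t - \<gamma> s) \<bullet> \<nu> s" and 2: "(\<gamma> t - \<gamma> s) \<bullet> conormal \<gamma> \<nu> s = 0"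
      "\<gamma>1 t \<bullet> conormal \<gamma> \<nu> s = 0" "(\<gamma> t - \<gamma> s) \<bullet> vderiv (conormal \<gamma> \<nu>) s = 0"
    obtain m where m: "inverse (real (Suc m)) < (\<gamma> t - \<gamma> s) \<bullet> \<nu> s" using reals_Archimedean[OF 1] by blast
    obtain k where k: "norm (s, t) \<le> real k" using real_arch_simple by blast
    \<comment> \<open>A single index serves as radius and as threshold, so it must be large enough
      for both.\<close>
    have "inverse (real (Suc (max m k))) \<le> inverse (real (Suc m))" by (intro le_imp_inverse_le) simp_all
    then have "max 0 (inverse (real (Suc (max m k))) - (\<gamma> t - \<gamma> s) \<bullet> \<nu> s) = 0" using m by linarith
    then have "FA (max m k) \<nu> (s, t) = 0" using 2 by (simp only: FA_def zero_prod_def fst_conv snd_conv)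
    moreover have "(s, t) \<in> cball 0 (real (max m k))" using k by simp
    ultimately show False using h by blast
  next
    fix s
    assume "\<gamma>2 s \<bullet> conormal \<gamma> \<nu> s = 0" "vderiv (\<lambda>s. \<gamma>2 s \<bullet> conormal \<gamma> \<nu> s) s = 0"
    then have "FB \<nu> s = 0" by (simp add: FB_def zero_prod_def)
    moreover obtain k where "norm s \<le> real k" using real_arch_simple by blast
    then have "s \<in> cball 0 (real k)" by simp
    ultimately show False using h by blast
  qed
qed

text \<open>Every one of these open conditions contains all generic framings, so density of the
  generic framings settles all of them at once. Curvature enters through the density.\<close>

lemma residual_generic_framing:
  assumes curv: "\<And>s. \<gamma>2 s \<noteq> 0"
  shows "residual_in (Cinf_topology (framings L \<gamma>)) {\<nu>\<in>framings L \<gamma>. generic_framing \<gamma> \<nu>}"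
proof -
  let ?T = "Cinf_topology (framings L \<gamma>)"
  let ?A = "\<lambda>n. {\<nu>\<in>framings L \<gamma>. \<forall>z\<in>cball 0 (real n). FA n \<nu> z \<noteq> 0}"
  let ?B = "\<lambda>n. {\<nu>\<in>framings L \<gamma>. \<forall>s\<in>cball 0 (real n). FB \<nu> s \<noteq> 0}"
  have dense: "?T closure_of W = framings L \<gamma>"
    if "W \<subseteq> framings L \<gamma>" "\<And>\<nu>. \<nu> \<in> framings L \<gamma> \<Longrightarrow> generic_framing \<gamma> \<nu> \<Longrightarrow> \<nu> \<in> W" for W
  proof (rule framings.Cinf_dense[OF that(1)])
    fix \<nu> and k :: nat and e :: real assume \<nu>: "\<nu> \<in> framings L \<gamma>" and e: "e > 0"
    interpret framed_curve L \<gamma> K \<nu> by standard (use \<nu> curv in auto)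
    obtain g where "g \<in> Cinf_ball (framings L \<gamma>) k e \<nu>" "generic_framing \<gamma> g"
      using generic_framing_nearby[OF e] by blast
    then have "g \<in> Cinf_ball (framings L \<gamma>) k e \<nu> \<inter> W" using that(2) by (auto simp: Cinf_ball_def)
    then show "Cinf_ball (framings L \<gamma>) k e \<nu> \<inter> W \<noteq> {}" by blast
  qed
  have "residual_in ?T W" if "W \<subseteq> framings L \<gamma>" "openin ?T W" "?T closure_of W = framings L \<gamma>" for W
    unfolding residual_in_def using that by (intro conjI exI[of _ "{W}"]) auto
  then have "residual_in ?T (?A n)" "residual_in ?T (?B n)" for n
    using openin_FA openin_FB dense[of "?A n"] dense[of "?B n"] generic_framing_iff by (simp_all add: subset_iff)
  then have "residual_in ?T ((\<Inter>n. ?A n) \<inter> (\<Inter>n. ?B n))"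
    by (intro residual_in_Int residual_in_INT_countable)
  moreover have "(\<Inter>n. ?A n) \<inter> (\<Inter>n. ?B n) = {\<nu>\<in>framings L \<gamma>. generic_framing \<gamma> \<nu>}"
    unfolding generic_framing_iff by blast
  ultimately show ?thesis by simp
qed

end

section \<open>The set of cords meeting the framing\<close>

locale generic_arclength_curve = arclength_curve +
  assumes generic: "generic_curve \<gamma>"
begin

lemma curvature_nonzero: "\<gamma>2 s \<noteq> 0"
  using generic by (simp add: generic_curve_def)

lemma tangent_transversal:
  "\<gamma> s \<noteq> \<gamma> t \<Longrightarrow> \<gamma> t - \<gamma> s = a *\<^sub>R \<gamma>1 s \<Longrightarrow> \<gamma>1 t \<noteq> p *\<^sub>R \<gamma>1 s + q *\<^sub>R \<gamma>2 s"
  using generic unfolding generic_curve_def by blast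

lemma no_tangent_trisecant:
  "\<gamma> s \<noteq> \<gamma> t \<Longrightarrow> \<gamma> s \<noteq> \<gamma> r \<Longrightarrow> \<gamma> t \<noteq> \<gamma> r \<Longrightarrow> \<gamma> t - \<gamma> s = a *\<^sub>R \<gamma>1 s \<Longrightarrow> \<gamma> r - \<gamma> s \<noteq> b *\<^sub>R \<gamma>1 s"
  using generic unfolding generic_curve_def by blast

lemma inner_vderiv_orthogonal:
  assumes m: "smooth_on UNIV m" and orth: "\<And>s. \<gamma>1 s \<bullet> m s = 0"
  shows "\<gamma>1 s \<bullet> vderiv m s = - (\<gamma>2 s \<bullet> m s)"
proof -
  have "((\<lambda>s. \<gamma>1 s \<bullet> m s) has_vector_derivative (\<gamma>1 s \<bullet> vderiv m s + \<gamma>2 s \<bullet> m s)) (at s)"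
    by (intro bounded_bilinear.has_vector_derivative[OF bounded_bilinear_inner]
       smooth_on_has_vderiv[OF smooth_\<gamma>(2) UNIV_I] smooth_on_has_vderiv[OF m UNIV_I])
  moreover have "((\<lambda>s. \<gamma>1 s \<bullet> m s) has_vector_derivative 0) (at s)" by (simp add: orth)
  ultimately have "\<gamma>1 s \<bullet> vderiv m s + \<gamma>2 s \<bullet> m s = 0" by (rule vector_derivative_unique_at)
  then show ?thesis by simp
qed

text \<open>At a tangent cord the derivative in s of its component along \<open>m\<close> is
  \<open>- a * (\<gamma>2 s \<bullet> m s)\<close>, by differentiating
  \<open>\<gamma>1 s \<bullet> m s = 0\<close>. A common kernel vector \<open>v\<close> thus makes
  \<open>?x\<close> tangential; transversality at the endpoint forces its second entry to vanish,
  and curvature the first. The pair \<open>m\<close>, \<open>n\<close> is left free so that it can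
  be a framing with its conormal or the curvature frame.\<close>

lemma tangent_cord_independent:
  assumes m: "smooth_on UNIV m" "\<And>s. \<gamma>1 s \<bullet> m s = 0" and n: "smooth_on UNIV n" "\<And>s. \<gamma>1 s \<bullet> n s = 0"
    and span: "\<And>x. x \<bullet> m s = 0 \<Longrightarrow> x \<bullet> n s = 0 \<Longrightarrow> \<exists>k. x = k *\<^sub>R \<gamma>1 s"
    and st: "\<gamma> s \<noteq> \<gamma> t" "\<gamma> t - \<gamma> s = a *\<^sub>R \<gamma>1 s"
    and 1: "fst v * ((\<gamma> t - \<gamma> s) \<bullet> vderiv m s) + snd v * (\<gamma>1 t \<bullet> m s) = 0"
    and 2: "fst v * ((\<gamma> t - \<gamma> s) \<bullet> vderiv n s) + snd v * (\<gamma>1 t \<bullet> n s) = 0"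
  shows "v = 0"
proof -
  have a: "a \<noteq> 0" using st by auto
  let ?x = "snd v *\<^sub>R \<gamma>1 t - (fst v * a) *\<^sub>R \<gamma>2 s"
  have "?x \<bullet> m s = 0" "?x \<bullet> n s = 0"
    using 1 2 unfolding st(2) by (simp_all add: inner_vderiv_orthogonal m n inner_diff_left)
  then obtain k where k: "?x = k *\<^sub>R \<gamma>1 s" using span by blast
  have v2: "snd v = 0"
  proof (rule ccontr)
    assume s: "snd v \<noteq> 0"
    have "snd v *\<^sub>R \<gamma>1 t = k *\<^sub>R \<gamma>1 s + (fst v * a) *\<^sub>R \<gamma>2 s" using k by (simp add: algebra_simps)
    then have "(1 / snd v) *\<^sub>R (snd v *\<^sub>R \<gamma>1 t) = (1 / snd v) *\<^sub>R (k *\<^sub>R \<gamma>1 s + (fst v * a) *\<^sub>R \<gamma>2 s)" by simp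
    then have "\<gamma>1 t = (1 / snd v * k) *\<^sub>R \<gamma>1 s + (1 / snd v * (fst v * a)) *\<^sub>R \<gamma>2 s"
      using s by (simp add: scaleR_add_right)
    then show False using tangent_transversal[OF st] by blast
  qed
  have "?x \<bullet> \<gamma>2 s = 0" unfolding k by (simp add: \<gamma>1_\<gamma>2)
  then have "fst v * a * (\<gamma>2 s \<bullet> \<gamma>2 s) = 0" by (simp add: v2)
  then have "fst v = 0" using a curvature_nonzero[of s] by simp
  then show "v = 0" using v2 by (simp add: prod_eq_iff)
qed

end

locale generic_framed_curve = generic_arclength_curve +
  fixes \<nu> assumes framing0: "\<nu> \<in> framings L \<gamma>" and generic_framing: "generic_framing \<gamma> \<nu>"
begin

sublocale framed_curve L \<gamma> K \<nu>
  by standard (use framing0 curvature_nonzero in auto)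

definition "F0 = {z. p0 z > 0 \<and> q0 z = 0}"

lemma span_frame: "x \<bullet> \<nu> s = 0 \<Longrightarrow> x \<bullet> \<mu> s = 0 \<Longrightarrow> \<exists>k. x = k *\<^sub>R \<gamma>1 s"
proof -
  assume x: "x \<bullet> \<nu> s = 0" "x \<bullet> \<mu> s = 0"
  have "x - (x \<bullet> \<gamma>1 s) *\<^sub>R \<gamma>1 s = 0"
    by (rule orthogonal_frame_zero[OF framing, where s = s]) (simp_all add: inner_diff_left x \<gamma>1_unit \<nu>D \<mu>D)
  then show ?thesis by (intro exI[of _ "x \<bullet> \<gamma>1 s"]) simp
qed

lemma F_start_eq: "F_start \<gamma> \<nu> = closure F0"
proof -
  have "(\<exists>\<alpha>>0. normal_proj \<gamma> s (\<gamma> t - \<gamma> s) = \<alpha> *\<^sub>R \<nu> s) \<longleftrightarrow> (s, t) \<in> F0" for s t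
  proof
    assume "\<exists>\<alpha>>0. normal_proj \<gamma> s (\<gamma> t - \<gamma> s) = \<alpha> *\<^sub>R \<nu> s"
    then obtain \<alpha> where \<alpha>: "\<alpha> > 0" "\<gamma> t - \<gamma> s = ((\<gamma> t - \<gamma> s) \<bullet> \<gamma>1 s) *\<^sub>R \<gamma>1 s + \<alpha> *\<^sub>R \<nu> s"
      by (auto simp: normal_proj_def diff_eq_eq add.commute)
    have "p0 (s, t) = \<alpha>" "q0 (s, t) = 0"
      by (simp_all add: p0_def q0_def, (subst \<alpha>(2), simp add: inner_add_left \<nu>D \<mu>D)+)
    then show "(s, t) \<in> F0" using \<alpha>(1) by (simp add: F0_def)
  next
    assume st: "(s, t) \<in> F0"
    let ?w = "\<gamma> t - \<gamma> s"
    have "normal_proj \<gamma> s ?w - (?w \<bullet> \<nu> s) *\<^sub>R \<nu> s = 0"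
      by (rule orthogonal_frame_zero[OF framing, where s = s])
        (use st in \<open>simp_all add: normal_proj_def inner_diff_left \<gamma>1_unit \<nu>D \<mu>D F0_def q0_def\<close>)
    moreover have "?w \<bullet> \<nu> s > 0" using st by (simp add: F0_def p0_def)
    ultimately show "\<exists>\<alpha>>0. normal_proj \<gamma> s ?w = \<alpha> *\<^sub>R \<nu> s" by (intro exI[of _ "?w \<bullet> \<nu> s"]) simp
  qed
  then have "{(s, t). \<exists>\<alpha>>0. normal_proj \<gamma> s (\<gamma> t - \<gamma> s) = \<alpha> *\<^sub>R \<nu> s} = F0"
    by (simp add: set_eq_iff split_paired_all)
  then show ?thesis unfolding F_start_def by simp
qed

lemma p0_q0_derivative:
  "frechet_derivative p0 (at (s, t)) v = fst v * ((\<gamma> t - \<gamma> s) \<bullet> vderiv \<nu> s) + snd v * (\<gamma>1 t \<bullet> \<nu> s)"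
  "frechet_derivative q0 (at (s, t)) v = fst v * ((\<gamma> t - \<gamma> s) \<bullet> vderiv \<mu> s) + snd v * (\<gamma>1 t \<bullet> \<mu> s)"
  using frechet_derivative_at[OF cord_inner_has_derivative[OF \<nu>D(1) \<nu>D(6), of t s, folded p0_def]]
    frechet_derivative_at[OF cord_inner_has_derivative[OF \<mu>D(1) \<mu>D(3), of t s, folded q0_def]]
  by (simp_all add: fun_eq_iff)

lemma closure_F0: "z \<in> closure F0 \<Longrightarrow> p0 z \<ge> 0 \<and> q0 z = 0"
proof -
  have "closed {z. 0 \<le> p0 z}" "closed {z. q0 z = 0}"
    by (intro closed_Collect_le closed_Collect_eq smooth_on_continuous_on smooth_pq continuous_on_const)+
  then have "closed ({z. 0 \<le> p0 z} \<inter> {z. q0 z = 0})" by (rule closed_Int)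
  moreover have "F0 \<subseteq> {z. 0 \<le> p0 z} \<inter> {z. q0 z = 0}" by (auto simp: F0_def)
  ultimately have "closure F0 \<subseteq> {z. 0 \<le> p0 z} \<inter> {z. q0 z = 0}" by (rule closure_minimal[rotated])
  then show "z \<in> closure F0 \<Longrightarrow> p0 z \<ge> 0 \<and> q0 z = 0" by blast
qed

lemma tangent_boundary:
  assumes "z \<in> tangent_at_start \<gamma>"
  shows "z \<in> curve_boundary (closure F0)"
proof -
  obtain s t a where z: "z = (s, t)" "\<gamma> s \<noteq> \<gamma> t" "\<gamma> t - \<gamma> s = a *\<^sub>R \<gamma>1 s"
    using assms by (auto simp: tangent_at_start_def)
  show ?thesis
  proof (rule half_arc_closure[OF open_UNIV smooth_pq UNIV_I])
    show "p0 z = 0" "q0 z = 0" by (simp_all add: z(1,3) p0_def q0_def \<nu>D \<mu>D)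
    fix v assume 1: "frechet_derivative p0 (at z) v = 0" and 2: "frechet_derivative q0 (at z) v = 0"
    show "v = 0"
      by (rule tangent_cord_independent[OF \<nu>D(1) \<nu>D(6) \<mu>D(1) \<mu>D(3) _ z(2,3)
          1[unfolded z(1) p0_q0_derivative] 2[unfolded z(1) p0_q0_derivative]]) (rule span_frame)
  qed (simp add: F0_def)
qed

lemma transversal_point:
  assumes z: "z \<in> closure F0" "p0 z > 0"
  shows "z \<in> curve_interior (closure F0) \<and> z \<notin> curve_boundary (closure F0)"
proof -
  obtain s t where st: "z = (s, t)" by (cases z)
  have q: "q0 z = 0" using closure_F0 z by blast
  have "\<gamma>1 t \<bullet> \<mu> s \<noteq> 0 \<or> (\<gamma> t - \<gamma> s) \<bullet> vderiv \<mu> s \<noteq> 0"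
    using generic_framing z(2) q unfolding generic_framing_def st p0_def q0_def by auto
  then obtain v where v: "frechet_derivative q0 (at z) v \<noteq> 0"
  proof
    assume "\<gamma>1 t \<bullet> \<mu> s \<noteq> 0"
    then show ?thesis by (intro that[of "(0, 1)"]) (simp add: st p0_q0_derivative)
  next
    assume "(\<gamma> t - \<gamma> s) \<bullet> vderiv \<mu> s \<noteq> 0"
    then show ?thesis by (intro that[of "(1, 0)"]) (simp add: st p0_q0_derivative)
  qed
  let ?U = "{z. p0 z > 0}"
  have U: "open ?U" by (intro open_Collect_less smooth_on_continuous_on smooth_pq continuous_on_const)
  have A: "w \<in> closure F0 \<longleftrightarrow> q0 w = 0" if "w \<in> ?U" for w
    using closure_F0[of w] closure_subset[of F0] that by (auto simp: F0_def)
  have h: "smooth_on ?U q0" by (rule smooth_on_subset[OF smooth_pq(2) subset_UNIV])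
  have "z \<in> ?U" using z by simp
  from regular_point_arc[OF U h this q v A] show ?thesis by blast
qed

lemma smooth_cord_remainder:
  assumes G: "smooth_on UNIV G" and m: "smooth_on UNIV m"
  shows "smooth_on UNIV (\<lambda>z :: real \<times> real. G (fst z, snd z - fst z - c) \<bullet> (m (fst z) :: real^3))"
  by (intro smooth_on_inner smooth_on_compose[OF open_UNIV open_UNIV G] smooth_on_compose[OF open_UNIV open_UNIV m]
    smooth_on_Pair smooth_on_diff smooth_proj) auto

text \<open>Besides regularity of \<open>Q\<close>, it must be shown that no other diagonal point
  nearby satisfies \<open>Q = 0\<close>: diagonal points never belong to \<open>F0\<close>, so such
  a zero would not obviously lie in the closure.\<close>

lemma diagonal_point:
  assumes z: "(s, t) \<in> closure F0" and st: "\<gamma> s = \<gamma> t"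
  shows "(s, t) \<in> curve_interior (closure F0) \<and> (s, t) \<notin> curve_boundary (closure F0)"
proof -
  obtain k :: int where k: "t - s = of_int k * L" using \<gamma>D(5)[of t s] st by auto
  obtain G :: "real \<times> real \<Rightarrow> real^3" where G: "smooth_on UNIV G"
    "\<And>s u. \<gamma> (s + u) = \<gamma> s + u *\<^sub>R \<gamma>1 s + u\<^sup>2 *\<^sub>R G (s, u)" "\<And>s. G (s, 0) = (1/2) *\<^sub>R \<gamma>2 s"
    by (rule smooth_taylor2[OF smooth_\<gamma>(1)]) (rule that; assumption)
  \<comment> \<open>In the plane the diagonal of the torus lifts to the lines t = s + k L;
    \<open>c\<close> selects the one through the given point.\<close>
  define c where "c = of_int k * L"
  define Q where "Q z = G (fst z, snd z - fst z - c) \<bullet> \<mu> (fst z)" for z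
  define R where "R z = G (fst z, snd z - fst z - c) \<bullet> \<nu> (fst z)" for z
  have QR: "smooth_on UNIV Q" "smooth_on UNIV R"
    unfolding Q_def[abs_def] R_def[abs_def] by (intro smooth_cord_remainder G \<mu>D \<nu>D)+
  have shift: "\<gamma> y = \<gamma> x + (y - x - c) *\<^sub>R \<gamma>1 x + (y - x - c)\<^sup>2 *\<^sub>R G (x, y - x - c)" for x y
  proof -
    have "\<gamma> y = \<gamma> (y + of_int (- k) * L)" by (rule periodic_int[symmetric]) (rule \<gamma>D)
    also have "y + of_int (- k) * L = x + (y - x - c)" by (simp add: c_def)
    finally show ?thesis using G(2) by metis
  qed
  have pq: "p0 z = (snd z - fst z - c)\<^sup>2 * R z" "q0 z = (snd z - fst z - c)\<^sup>2 * Q z" for z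
    unfolding p0_def q0_def R_def Q_def
    by (subst shift[of "snd z" "fst z"], simp add: inner_add_left \<nu>D \<mu>D)+
  have F0: "z \<in> F0 \<longleftrightarrow> snd z - fst z - c \<noteq> 0 \<and> R z > 0 \<and> Q z = 0" for z
  proof (cases "snd z - fst z - c = 0")
    case False
    then have "(snd z - fst z - c)\<^sup>2 > 0" by simp
    then show ?thesis unfolding F0_def mem_Collect_eq pq using False by (simp only: zero_less_mult_iff mult_eq_0_iff) auto
  qed (simp add: F0_def pq)
  have "closed {z. 0 \<le> R z}" "closed {z. Q z = 0}"
    by (intro closed_Collect_le closed_Collect_eq smooth_on_continuous_on QR continuous_on_const)+
  then have "closed ({z. 0 \<le> R z} \<inter> {z. Q z = 0})" by (rule closed_Int)
  moreover have "F0 \<subseteq> {z. 0 \<le> R z} \<inter> {z. Q z = 0}" using F0 by auto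
  ultimately have sub: "closure F0 \<subseteq> {z. 0 \<le> R z} \<inter> {z. Q z = 0}" by (rule closure_minimal[rotated])
  have diag: "Q (x, x + c) = (1/2) * (\<gamma>2 x \<bullet> \<mu> x)" "R (x, x + c) = (1/2) * (\<gamma>2 x \<bullet> \<nu> x)" for x
    by (simp_all add: Q_def R_def G(3))
  have t: "t = s + c" using k by (simp add: c_def)
  have Q0: "Q (s, t) = 0" and R0: "R (s, t) \<ge> 0" using sub z by auto
  have x0: "\<gamma>2 s \<bullet> \<mu> s = 0" using Q0 diag t by simp
  \<comment> \<open>\<gamma>'' is nonzero and orthogonal to the tangent and the conormal, so it has
    a component along \<nu>. The closure gives \<open>R \<ge> 0\<close>, and this improves it to a
    strict inequality.\<close>
  have y0: "\<gamma>2 s \<bullet> \<nu> s \<noteq> 0"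
    using orthogonal_frame_zero[OF framing, of "\<gamma>2 s" s] x0 \<gamma>1_\<gamma>2[of s] curvature_nonzero[of s]
    by (auto simp: inner_commute)
  have "R (s, t) = (1/2) * (\<gamma>2 s \<bullet> \<nu> s)" unfolding t by (rule diag)
  then have Rpos: "R (s, t) > 0" using R0 y0 by simp
  let ?x = "\<lambda>s. \<gamma>2 s \<bullet> \<mu> s"
  have x': "vderiv ?x s \<noteq> 0" using generic_framing x0 unfolding generic_framing_def by blast
  have "smooth_on UNIV ?x" by (intro smooth_on_inner open_UNIV smooth_\<gamma> \<mu>D)
  then have dx: "(?x has_real_derivative vderiv ?x s) (at s)"
    unfolding has_real_derivative_iff_has_vector_derivative by (rule smooth_on_has_vderiv) simp
  then have "\<forall>\<^sub>F y in at s. (?x y - ?x s) / (y - s) \<noteq> 0"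
    unfolding has_field_derivative_iff using x' by (rule tendsto_imp_eventually_ne)
  \<comment> \<open>A simple zero is isolated, which keeps other diagonal points of
    \<open>Q = 0\<close> out of the neighbourhood.\<close>
  then obtain e where e: "e > 0" "\<And>y. y \<noteq> s \<Longrightarrow> dist y s < e \<Longrightarrow> ?x y \<noteq> 0"
    unfolding eventually_at using x0 by auto
  let ?U = "{z. R z > 0} \<inter> {z. dist (fst z) s < e}"
  have U: "open ?U"
    by (intro open_Int open_Collect_less smooth_on_continuous_on QR continuous_intros)
  have zU: "(s, t) \<in> ?U" using Rpos e by simp
  \<comment> \<open>Along the diagonal direction \<open>(1, 1)\<close>, \<open>Q\<close> restricts
    to half of \<open>?x\<close>, whose derivative at \<open>s\<close> is nonzero by
    genericity.\<close>
  have dQ: "frechet_derivative Q (at (s, t)) (1, 1) \<noteq> 0"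
  proof
    assume 0: "frechet_derivative Q (at (s, t)) (1, 1) = 0"
    have "((\<lambda>x. (x, x + c)) has_derivative (\<lambda>v. (v, v))) (at s)" by (auto intro!: derivative_eq_intros)
    moreover have dQ: "(Q has_derivative frechet_derivative Q (at (s, t))) (at (s, s + c))"
      unfolding t by (rule smooth_on_has_derivative[OF QR(1) UNIV_I])
    ultimately have "((\<lambda>x. Q (x, x + c)) has_derivative (\<lambda>v. frechet_derivative Q (at (s, t)) (v, v))) (at s)"
      by (rule has_derivative_compose)
    moreover have "frechet_derivative Q (at (s, t)) (v, v) = 0" for v
      using linear_scale[OF has_derivative_linear[OF dQ], of v "(1, 1)"] 0 by simp
    ultimately have "((\<lambda>x. (1/2) * ?x x) has_derivative (\<lambda>v. 0)) (at s)" by (simp add: diag)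
    then have "((\<lambda>x. (1/2) * ?x x) has_real_derivative 0) (at s)"
      unfolding has_field_derivative_def by (simp only: mult_zero_left[abs_def])
    moreover have "((\<lambda>x. (1/2) * ?x x) has_real_derivative (1/2) * vderiv ?x s) (at s)"
      by (rule DERIV_cmult[OF dx])
    ultimately have "(1/2) * vderiv ?x s = 0" using DERIV_unique by blast
    then show False using x' by simp
  qed
  have A: "w \<in> closure F0 \<longleftrightarrow> Q w = 0" if w: "w \<in> ?U" for w
  proof
    show "w \<in> closure F0 \<Longrightarrow> Q w = 0" using sub by blast
    assume Qw: "Q w = 0"
    show "w \<in> closure F0"
    proof (cases "snd w - fst w - c = 0")
      case False
      then show ?thesis using F0[of w] Qw w closure_subset by blast
    next
      case True
      then have w': "w = (fst w, fst w + c)" by (simp add: prod_eq_iff)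
      then have "?x (fst w) = 0" using Qw diag(1)[of "fst w"] by simp
      then have "fst w = s" using e(2)[of "fst w"] w by blast
      then show ?thesis using z w' t by simp
    qed
  qed
  from regular_point_arc[OF U smooth_on_subset[OF QR(1) subset_UNIV] zU Q0 dQ A] show ?thesis by blast
qed

text \<open>Where p and q both vanish the cord is parallel to the tangent at its startpoint, hence
  constant or tangent. With p > 0 this makes three cases.\<close>

lemma F_start_submanifold:
  "one_dim_submanifold_with_boundary (F_start \<gamma> \<nu>)" "curve_boundary (F_start \<gamma> \<nu>) = tangent_at_start \<gamma>"
proof -
  have *: "z \<in> tangent_at_start \<gamma> \<or> (z \<in> curve_interior (closure F0) \<and> z \<notin> curve_boundary (closure F0))"
    if z: "z \<in> closure F0" for z
  proof -
    obtain s t where st: "z = (s, t)" by (cases z)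
    show ?thesis
    proof (cases "p0 z = 0")
      case False
      then have "p0 z > 0" using closure_F0[OF z] by simp
      then show ?thesis using transversal_point[OF z] by blast
    next
      case True
      then obtain a where a: "\<gamma> t - \<gamma> s = a *\<^sub>R \<gamma>1 s"
        using span_frame[of "\<gamma> t - \<gamma> s" s] closure_F0[OF z] by (auto simp: st p0_def q0_def)
      show ?thesis
      proof (cases "\<gamma> s = \<gamma> t")
        case True
        then show ?thesis using diagonal_point z st by blast
      next
        case False
        then show ?thesis using a by (auto simp: st tangent_at_start_def)
      qed
    qed
  qed
  show "one_dim_submanifold_with_boundary (F_start \<gamma> \<nu>)"
    unfolding one_dim_submanifold_with_boundary_def F_start_eq using * tangent_boundary by blast
  show "curve_boundary (F_start \<gamma> \<nu>) = tangent_at_start \<gamma>"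
    unfolding F_start_eq using * tangent_boundary curve_boundary_subset by blast
qed

end

section \<open>Cords meeting the knot near a tangent cord\<close>

lemma has_derivative_mult_zeros:
  fixes f g :: "'a::real_normed_vector \<Rightarrow> real"
  assumes "(f has_derivative f') (at x)" "(g has_derivative g') (at x)" "f x = 0" "g x = 0"
  shows "((\<lambda>x. f x * g x) has_derivative (\<lambda>v. 0)) (at x)"
  using has_derivative_mult[OF assms(1,2)] assms(3,4) by simp

context generic_arclength_curve
begin

abbreviation "w1 \<equiv> \<gamma>2"
text \<open>A multiple of the binormal. Together with \<gamma>'' it spans the normal plane without
  any framing, as suits a set of cords that depends on the knot alone.\<close>

definition "w2 s = cross3 (\<gamma>1 s) (\<gamma>2 s)"

lemma w2: "smooth_on UNIV w2" "\<gamma>1 s \<bullet> w2 s = 0" "w2 s \<bullet> \<gamma>1 s = 0" "\<gamma>2 s \<bullet> w2 s = 0"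
proof -
  show "smooth_on UNIV w2" unfolding w2_def[abs_def] by (intro smooth_on_cross3 open_UNIV smooth_\<gamma>)
  show "\<gamma>1 s \<bullet> w2 s = 0" "w2 s \<bullet> \<gamma>1 s = 0" "\<gamma>2 s \<bullet> w2 s = 0"
    by (simp_all add: w2_def dot_cross_self)
qed

lemma curvature_frame_zero:
  assumes "x \<bullet> \<gamma>1 s = 0" "x \<bullet> w1 s = 0" "x \<bullet> w2 s = 0"
  shows "x = 0"
proof -
  have "cross3 x (w2 s) = 0" unfolding w2_def Lagrange using assms(1,2) by simp
  then have "x = 0 \<or> w2 s = 0" using assms(3) norm_and_cross_eq_0 by blast
  moreover have "w2 s \<noteq> 0"
  proof
    assume "w2 s = 0"
    then have "\<gamma>2 s = (\<gamma>1 s \<bullet> \<gamma>2 s) *\<^sub>R \<gamma>1 s" unfolding w2_def by (rule parallel_unit[OF \<gamma>D(4)])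
    then show False using curvature_nonzero[of s] by (simp add: \<gamma>1_\<gamma>2)
  qed
  ultimately show ?thesis by blast
qed

lemma span_curvature_frame: "x \<bullet> w1 s = 0 \<Longrightarrow> x \<bullet> w2 s = 0 \<Longrightarrow> \<exists>k. x = k *\<^sub>R \<gamma>1 s"
proof -
  assume x: "x \<bullet> w1 s = 0" "x \<bullet> w2 s = 0"
  have "x - (x \<bullet> \<gamma>1 s) *\<^sub>R \<gamma>1 s = 0"
    by (rule curvature_frame_zero[where s = s]) (simp_all add: inner_diff_left x \<gamma>1_unit \<gamma>1_\<gamma>2 w2)
  then show ?thesis by (intro exI[of _ "x \<bullet> \<gamma>1 s"]) simp
qed

lemma smooth_compose_UNIV:
  fixes f :: "real \<Rightarrow> 'b::real_normed_vector" and k :: "real \<times> real \<Rightarrow> real"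
  shows "smooth_on UNIV f \<Longrightarrow> smooth_on UNIV k \<Longrightarrow> smooth_on UNIV (\<lambda>z. f (k z))"
  by (rule smooth_on_compose[OF open_UNIV open_UNIV]) auto

text \<open>Near a tangent cord, every intersection point of the cord with the curve lies close to the startpoint:
  any other limit would be a tangent trisecant or force a second tangency at the endpoint.\<close>

lemma intersections_near_start:
  assumes st: "\<gamma> s0 \<noteq> \<gamma> t0" "\<gamma> t0 - \<gamma> s0 = a *\<^sub>R \<gamma>1 s0"
    and W: "open W" "(s0, 0) \<in> W"
  shows "\<exists>U. open U \<and> (s0, t0) \<in> U \<and>
    (\<forall>s t r. (s, t) \<in> U \<longrightarrow> \<gamma> r \<in> open_segment (\<gamma> s) (\<gamma> t) \<longrightarrow> (\<exists>k::int. (s, r + of_int k * L - s) \<in> W))"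
proof (rule ccontr)
  note L = \<gamma>D(1)
  assume neg: "\<not> ?thesis"
  have "\<exists>s t r. (s, t) \<in> ball (s0, t0) (inverse (real (Suc n))) \<and> \<gamma> r \<in> open_segment (\<gamma> s) (\<gamma> t) \<and>
      (\<forall>k::int. (s, r + of_int k * L - s) \<notin> W)" for n
  proof (rule ccontr)
    assume "\<not> ?thesis"
    then have "\<forall>s t r. (s, t) \<in> ball (s0, t0) (inverse (real (Suc n))) \<longrightarrow> \<gamma> r \<in> open_segment (\<gamma> s) (\<gamma> t) \<longrightarrow>
      (\<exists>k::int. (s, r + of_int k * L - s) \<in> W)" by blast
    moreover have "(s0, t0) \<in> ball (s0, t0) (inverse (real (Suc n)))" by simp
    ultimately show False using neg open_ball by blast
  qed
  then obtain s t r' where *: "\<And>n. (s n, t n) \<in> ball (s0, t0) (inverse (real (Suc n)))"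
    "\<And>n. \<gamma> (r' n) \<in> open_segment (\<gamma> (s n)) (\<gamma> (t n))" "\<And>n k. (s n, r' n + of_int k * L - s n) \<notin> W" by metis
  have "\<exists>k::int. r' n + of_int k * L \<in> {0..L}" for n using periodic_reduce[OF L] by metis
  then obtain j where j: "\<And>n. r' n + of_int (j n) * L \<in> {0..L}" by metis
  \<comment> \<open>Reduction to one period bounds the intersection parameters, so that a
    subsequence converges.\<close>
  define r where "r n = r' n + of_int (j n) * L" for n
  have "\<gamma> (r n) = \<gamma> (r' n)" for n unfolding r_def by (rule periodic_int) (rule \<gamma>D)
  then have r: "r n \<in> {0..L}" "\<gamma> (r n) \<in> open_segment (\<gamma> (s n)) (\<gamma> (t n))" for n
    using j *(2) by (simp_all add: r_def)
  have rW: "(s n, r n + of_int k * L - s n) \<notin> W" for n and k :: int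
  proof -
    have "r n + of_int k * L - s n = r' n + of_int (j n + k) * L - s n" by (simp add: r_def algebra_simps)
    then show ?thesis using *(3)[of n "j n + k"] by simp
  qed
  have "\<exists>l. 0 < l \<and> l < 1 \<and> \<gamma> (r n) = \<gamma> (s n) + l *\<^sub>R (\<gamma> (t n) - \<gamma> (s n)) \<and> \<gamma> (s n) \<noteq> \<gamma> (t n)" for n
  proof -
    obtain l where "0 < l" "l < 1" "\<gamma> (r n) = (1 - l) *\<^sub>R \<gamma> (s n) + l *\<^sub>R \<gamma> (t n)" "\<gamma> (s n) \<noteq> \<gamma> (t n)"
      using r(2)[of n] unfolding in_segment by blast
    then show ?thesis by (intro exI[of _ l]) (simp add: algebra_simps)
  qed
  then obtain l where l: "\<And>n. 0 < l n" "\<And>n. l n < 1"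
    "\<And>n. \<gamma> (r n) = \<gamma> (s n) + l n *\<^sub>R (\<gamma> (t n) - \<gamma> (s n))" "\<And>n. \<gamma> (s n) \<noteq> \<gamma> (t n)" by metis
  have "compact ({0..L} \<times> {0..1::real})" by (intro compact_Times compact_Icc)
  then have "seq_compact ({0..L} \<times> {0..1::real})" by (rule compact_imp_seq_compact)
  moreover have "\<forall>n. (r n, l n) \<in> {0..L} \<times> {0..1}" using r(1) l(1,2) by (auto simp: less_imp_le)
  ultimately obtain p \<sigma> where p: "p \<in> {0..L} \<times> {0..1}" "strict_mono \<sigma>" "((\<lambda>n. (r n, l n)) \<circ> \<sigma>) \<longlonglongrightarrow> p"
    by (rule seq_compactE)
  define r0 l0 where "r0 = fst p" and "l0 = snd p"
  have rlim: "(\<lambda>n. r (\<sigma> n)) \<longlonglongrightarrow> r0" and llim: "(\<lambda>n. l (\<sigma> n)) \<longlonglongrightarrow> l0"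
    using tendsto_fst[OF p(3)] tendsto_snd[OF p(3)] by (simp_all add: r0_def l0_def o_def)
  have "(\<lambda>n. (s n, t n)) \<longlonglongrightarrow> (s0, t0)"
  proof (rule metric_LIMSEQ_I)
    fix e :: real assume "e > 0"
    then obtain N where N: "inverse (real (Suc N)) < e" using reals_Archimedean by blast
    have "dist (s n, t n) (s0, t0) < e" if "n \<ge> N" for n
    proof -
      have "dist (s n, t n) (s0, t0) < inverse (real (Suc n))" using *(1)[of n] by (simp add: dist_commute)
      also have "\<dots> \<le> inverse (real (Suc N))" using that by (intro le_imp_inverse_le) simp_all
      finally show ?thesis using N by simp
    qed
    then show "\<exists>N. \<forall>n\<ge>N. dist (s n, t n) (s0, t0) < e" by blast
  qed
  from LIMSEQ_subseq_LIMSEQ[OF tendsto_fst[OF this] p(2)] LIMSEQ_subseq_LIMSEQ[OF tendsto_snd[OF this] p(2)]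
  have slim: "(\<lambda>n. s (\<sigma> n)) \<longlonglongrightarrow> s0" and tlim: "(\<lambda>n. t (\<sigma> n)) \<longlonglongrightarrow> t0" by (simp_all add: o_def)
  have cont: "(\<lambda>n. f (k n)) \<longlonglongrightarrow> f k0" if "smooth_on UNIV f" "k \<longlonglongrightarrow> k0"
    for f :: "real \<Rightarrow> real^3" and k k0
    by (rule continuous_on_tendsto_compose[OF smooth_on_continuous_on[OF that(1)] that(2)]) auto
  have "(\<lambda>n. \<gamma> (r (\<sigma> n))) \<longlonglongrightarrow> \<gamma> r0" by (rule cont[OF smooth_\<gamma>(1) rlim])
  moreover have "(\<lambda>n. \<gamma> (r (\<sigma> n))) \<longlonglongrightarrow> \<gamma> s0 + l0 *\<^sub>R (\<gamma> t0 - \<gamma> s0)"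
    unfolding l(3) by (intro tendsto_intros cont[OF smooth_\<gamma>(1)] slim tlim llim)
  ultimately have r0: "\<gamma> r0 = \<gamma> s0 + l0 *\<^sub>R (\<gamma> t0 - \<gamma> s0)" by (rule LIMSEQ_unique)
  \<comment> \<open>The limit lies on the tangent line at the startpoint, and the trisecant
    condition leaves only the two ends of the cord.\<close>
  have "\<gamma> r0 - \<gamma> s0 = (l0 * a) *\<^sub>R \<gamma>1 s0" unfolding r0 st(2) by simp
  then consider "\<gamma> s0 = \<gamma> r0" | "\<gamma> t0 = \<gamma> r0" using no_tangent_trisecant[OF st(1) _ _ st(2)] by blast
  then show False
  proof cases
    case 1
    then obtain k :: int where k: "s0 - r0 = of_int k * L" using \<gamma>D(5) by blast
    have "(\<lambda>n. (s (\<sigma> n), r (\<sigma> n) + of_int k * L - s (\<sigma> n))) \<longlonglongrightarrow> (s0, r0 + of_int k * L - s0)"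
      by (intro tendsto_intros slim rlim)
    also have "(s0, r0 + of_int k * L - s0) = (s0, 0)" using k by simp
    finally have "\<forall>\<^sub>F n in sequentially. (s (\<sigma> n), r (\<sigma> n) + of_int k * L - s (\<sigma> n)) \<in> W"
      using W by (rule topological_tendstoD)
    then show False using rW by simp
  next
    case 2
    then obtain k :: int where k: "t0 - r0 = of_int k * L" using \<gamma>D(5) by blast
    obtain G :: "real \<times> real \<Rightarrow> real^3" where G: "smooth_on UNIV G"
      "\<And>s u. \<gamma> (s + u) = \<gamma> s + u *\<^sub>R \<gamma>1 s + u\<^sup>2 *\<^sub>R G (s, u)" "\<And>s. G (s, 0) = (1/2) *\<^sub>R \<gamma>2 s"
      by (rule smooth_taylor2[OF smooth_\<gamma>(1)]) (rule that; assumption)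
    define u where "u n = r n + of_int k * L - t n" for n
    have \<gamma>u: "\<gamma> (t n + u n) = \<gamma> (r n)" for n
    proof -
      have "\<gamma> (t n + u n) = \<gamma> (r n + of_int k * L)" by (simp add: u_def)
      also have "\<dots> = \<gamma> (r n)" by (rule periodic_int) (rule \<gamma>D)
      finally show ?thesis .
    qed
    \<comment> \<open>The difference quotient of \<gamma> between the endpoint and the intersection
      point. It is parallel to the cord and tends to the tangent at the endpoint, which would have
      to be parallel to the tangent at the startpoint. That \<open>l n\<close> is less than 1
      ensures \<open>u n \<noteq> 0\<close>.\<close>
    let ?V = "\<lambda>n. \<gamma>1 (t n) + u n *\<^sub>R G (t n, u n)"
    have cz: "cross3 (?V n) (\<gamma> (t n) - \<gamma> (s n)) = 0" for n
    proof -
      have "u n *\<^sub>R ?V n = \<gamma> (r n) - \<gamma> (t n)"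
        using G(2)[of "t n" "u n"] \<gamma>u[of n] by (simp add: algebra_simps power2_eq_square)
      also have "\<dots> = (l n - 1) *\<^sub>R (\<gamma> (t n) - \<gamma> (s n))" unfolding l(3) by (simp add: algebra_simps)
      finally have e: "u n *\<^sub>R ?V n = (l n - 1) *\<^sub>R (\<gamma> (t n) - \<gamma> (s n))" .
      have "u n *\<^sub>R cross3 (?V n) (\<gamma> (t n) - \<gamma> (s n)) = cross3 (u n *\<^sub>R ?V n) (\<gamma> (t n) - \<gamma> (s n))"
        by (simp only: cross_mult_left)
      also have "\<dots> = 0" unfolding e by (simp only: cross_mult_left cross_refl scaleR_zero_right)
      finally have "u n = 0 \<or> cross3 (?V n) (\<gamma> (t n) - \<gamma> (s n)) = 0" by simp
      moreover have "u n \<noteq> 0"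
      proof
        assume "u n = 0"
        then have "(l n - 1) *\<^sub>R (\<gamma> (t n) - \<gamma> (s n)) = 0" using e by simp
        then show False using l(2)[of n] l(4)[of n] by simp
      qed
      ultimately show ?thesis by blast
    qed
    have ulim: "(\<lambda>n. u (\<sigma> n)) \<longlonglongrightarrow> 0"
    proof -
      have "(\<lambda>n. u (\<sigma> n)) \<longlonglongrightarrow> r0 + of_int k * L - t0" unfolding u_def by (intro tendsto_intros rlim tlim)
      moreover have "r0 + of_int k * L - t0 = 0" using k by linarith
      ultimately show ?thesis by (simp only:)
    qed
    have "(\<lambda>n. G (t (\<sigma> n), u (\<sigma> n))) \<longlonglongrightarrow> G (t0, 0)"
      by (rule continuous_on_tendsto_compose[OF smooth_on_continuous_on[OF G(1)]]) (auto intro!: tendsto_intros tlim ulim)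
    then have "(\<lambda>n. cross3 (?V (\<sigma> n)) (\<gamma> (t (\<sigma> n)) - \<gamma> (s (\<sigma> n)))) \<longlonglongrightarrow>
        cross3 (\<gamma>1 t0 + 0 *\<^sub>R G (t0, 0)) (\<gamma> t0 - \<gamma> s0)"
      by (intro bounded_bilinear.tendsto[OF bounded_bilinear_cross3] tendsto_intros ulim
        cont[OF smooth_\<gamma>(1)] cont[OF smooth_\<gamma>(2)] slim tlim)
    then have "(\<lambda>n. 0) \<longlonglongrightarrow> cross3 (\<gamma>1 t0 + 0 *\<^sub>R G (t0, 0)) (\<gamma> t0 - \<gamma> s0)" unfolding cz .
    from LIMSEQ_unique[OF this tendsto_const] have "a *\<^sub>R cross3 (\<gamma>1 t0) (\<gamma>1 s0) = 0"
      unfolding st(2) by (simp add: cross_mult_right)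
    moreover have "a \<noteq> 0" using st by auto
    ultimately have "cross3 (\<gamma>1 t0) (\<gamma>1 s0) = 0" by simp
    then have "cross3 (\<gamma>1 s0) (\<gamma>1 t0) = 0" by (subst cross_skew) simp
    from parallel_unit[OF \<gamma>D(4) this] have "\<gamma>1 t0 = (\<gamma>1 s0 \<bullet> \<gamma>1 t0) *\<^sub>R \<gamma>1 s0 + 0 *\<^sub>R \<gamma>2 s0" by simp
    then show False using tangent_transversal[OF st] by blast
  qed
qed

text \<open>The secant from \<open>\<gamma> s\<close> to \<open>\<gamma> (s + u)\<close> has slopes \<open>x\<close> and \<open>u g2 / d\<close> in the directions \<open>w1\<close> and \<open>w2\<close>. As
  \<open>\<partial>\<^sub>u x > 0\<close>, \<open>u\<close> is a function of \<open>s\<close> and the first slope, so meeting the knot becomes the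
  single equation \<open>h = 0\<close> between the slopes of the cord; \<open>p1 > 0\<close> puts \<open>\<gamma> (s + u)\<close> on the side of \<open>\<gamma> t\<close>.\<close>

lemma tangent_cord_secant_boundary:
  assumes z0: "z0 \<in> tangent_at_start \<gamma>"
  shows "z0 \<in> curve_boundary (closure (S_cords \<gamma>))"
proof -
  obtain s0 t0 a where st0: "z0 = (s0, t0)" and st: "\<gamma> s0 \<noteq> \<gamma> t0" "\<gamma> t0 - \<gamma> s0 = a *\<^sub>R \<gamma>1 s0"
    using z0 by (auto simp: tangent_at_start_def)
  have a: "a \<noteq> 0" using st by auto
  obtain G :: "real \<times> real \<Rightarrow> real^3" where G: "smooth_on UNIV G"
    "\<And>s u. \<gamma> (s + u) = \<gamma> s + u *\<^sub>R \<gamma>1 s + u\<^sup>2 *\<^sub>R G (s, u)" "\<And>s. G (s, 0) = (1/2) *\<^sub>R \<gamma>2 s"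
    by (rule smooth_taylor2[OF smooth_\<gamma>(1)]) (rule that; assumption)
  have Gm: "smooth_on UNIV (\<lambda>z. G z \<bullet> m (fst z))" if "smooth_on UNIV m" for m
    by (rule smooth_on_inner[OF open_UNIV G(1) smooth_compose_UNIV[OF that]]) (intro smooth_proj)
  define d where "d z = 1 + snd z * (G z \<bullet> \<gamma>1 (fst z))" for z
  define g1 where "g1 z = G z \<bullet> w1 (fst z)" for z
  define g2 where "g2 z = G z \<bullet> w2 (fst z)" for z
  have sm: "smooth_on UNIV d" "smooth_on UNIV g1" "smooth_on UNIV g2"
    unfolding d_def[abs_def] g1_def[abs_def] g2_def[abs_def]
    by (intro smooth_on_add smooth_on_mult Gm smooth_\<gamma> w2 smooth_proj)+
  have comp: "(\<gamma> (s + u) - \<gamma> s) \<bullet> \<gamma>1 s = u * d (s, u)" "(\<gamma> (s + u) - \<gamma> s) \<bullet> w1 s = u\<^sup>2 * g1 (s, u)"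
    "(\<gamma> (s + u) - \<gamma> s) \<bullet> w2 s = u\<^sup>2 * g2 (s, u)" for s u
    by (simp_all add: G(2) d_def g1_def g2_def inner_add_left \<gamma>1_unit \<gamma>1_\<gamma>2 w2 algebra_simps power2_eq_square)
  \<comment> \<open>Positivity of \<open>d\<close> permits division, that of \<open>g1\<close> fixes
    a side. The bound \<open>\<bar>a\<bar> / 2\<close> on tangential progress is matched by
    \<open>?E\<close>, where the cord is tangentially longer than this: the secant point then lies
    before the endpoint.\<close>
  let ?D = "{z. 0 < d z} \<inter> ({z. 0 < g1 z} \<inter> {z. \<bar>snd z * d z\<bar> < \<bar>a\<bar> / 2})"
  have D: "open ?D"
    using smooth_on_continuous_on sm by (intro open_Int open_Collect_less continuous_intros) blast+
  have sub: "smooth_on ?D f" if "smooth_on UNIV f" for f :: "real \<times> real \<Rightarrow> real"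
    using smooth_on_subset[OF that] by simp
  have at0: "d (s, 0) = 1" "g1 (s0, 0) = (1/2) * (\<gamma>2 s0 \<bullet> \<gamma>2 s0)" "g2 (s0, 0) = 0" for s
    by (simp_all add: d_def g1_def g2_def G(3) w2)
  have g10: "g1 (s0, 0) > 0" unfolding at0(2) using curvature_nonzero[of s0] by simp
  have D0: "(s0, 0) \<in> ?D" using g10 a by (simp add: at0(1))
  define x where "x z = snd z * (g1 z / d z)" for z
  have gd: "smooth_on ?D (\<lambda>z. g1 z / d z)" "smooth_on ?D (\<lambda>z. g2 z / d z)"
    by (rule smooth_on_divide[OF D sub sub]; use sm in auto)+
  have sx: "smooth_on ?D x" unfolding x_def[abs_def]
    by (intro smooth_on_mult gd D smooth_on_snd smooth_on_id)
  have s1: "smooth_on ?D fst" using smooth_on_fst[OF D smooth_on_id[OF D]] by simp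
  have dfst: "frechet_derivative fst (at z) v = fst v" for z v :: "real \<times> real"
    using frechet_derivative_at[OF bounded_linear_imp_has_derivative[OF bounded_linear_fst]] by metis
  have dx: "frechet_derivative x (at (s0, 0)) v = snd v * (g1 (s0, 0) / d (s0, 0))" for v
  proof -
    have "(snd has_derivative snd) (at (s0, 0 :: real))" by (rule bounded_linear_imp_has_derivative[OF bounded_linear_snd])
    from has_derivative_mult[OF this smooth_on_has_derivative[OF gd(1) D0]]
    have "(x has_derivative (\<lambda>v. snd v * (g1 (s0, 0) / d (s0, 0)))) (at (s0, 0))" by (simp add: x_def[abs_def])
    then show ?thesis using frechet_derivative_at by metis
  qed
  have ind: "v = 0" if "frechet_derivative fst (at (s0, 0)) v = 0" "frechet_derivative x (at (s0, 0)) v = 0"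
    for v :: "real \<times> real"
    using that g10 by (simp add: dfst dx at0(1) prod_eq_iff)
  obtain U' V \<psi> where U': "open U'" "U' \<subseteq> ?D" "(s0, 0) \<in> U'" "open V"
    "homeomorphism U' V (\<lambda>z. (fst z, x z)) \<psi>" "smooth_on V \<psi>"
    by (rule plane_chart[OF D s1 sx D0 ind])
  have \<psi>: "\<psi> y \<in> U'" "fst (\<psi> y) = fst y" "x (\<psi> y) = snd y" if "y \<in> V" for y
    using homeomorphism_apply2[OF U'(5) that] homeomorphism_image2[OF U'(5)] that by (auto simp: prod_eq_iff)
  have \<phi>: "(fst z, x z) \<in> V" "\<psi> (fst z, x z) = z" if "z \<in> U'" for z
    using homeomorphism_apply1[OF U'(5) that] homeomorphism_image1[OF U'(5)] that by auto
  have x0: "x (s, 0) = 0" for s by (simp add: x_def)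
  have V0: "(s0, 0) \<in> V" "\<psi> (s0, 0) = (s0, 0)" using \<phi>[OF U'(3)] by (simp_all add: x0)
  \<comment> \<open>For fixed \<open>s\<close>, the directions of short secants from
    \<open>\<gamma> s\<close> form a curve in the plane of slopes, of which \<open>Z (s, _)\<close>
    is the graph.\<close>
  define Z where "Z y = snd (\<psi> y) * (g2 (\<psi> y) / d (\<psi> y))" for y
  have s\<psi>: "smooth_on V (\<lambda>y. snd (\<psi> y))" by (rule smooth_on_snd[OF U'(4,6)])
  have sg: "smooth_on V (\<lambda>y. g2 (\<psi> y) / d (\<psi> y))"
  proof (rule smooth_on_compose[OF U'(4) D gd(2) U'(6)])
    show "\<psi> ` V \<subseteq> ?D" using \<psi>(1) U'(2) by (intro image_subsetI) (rule subsetD)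
  qed
  have sZ: "smooth_on V Z" unfolding Z_def[abs_def] by (intro smooth_on_mult U'(4) s\<psi> sg)
  \<comment> \<open>Both factors vanish at the base point: the step \<open>u\<close>, and
    \<open>g2\<close> because \<gamma>'' is orthogonal to \<open>w2\<close>.\<close>
  have dZ: "(Z has_derivative (\<lambda>v. 0)) (at (s0, 0))"
    unfolding Z_def[abs_def]
    by (rule has_derivative_mult_zeros[OF smooth_on_has_derivative[OF s\<psi> V0(1)] smooth_on_has_derivative[OF sg V0(1)]])
      (simp_all add: V0 at0)
  define e where "e z = (\<gamma> (snd z) - \<gamma> (fst z)) \<bullet> \<gamma>1 (fst z)" for z
  define p1 where "p1 z = (\<gamma> (snd z) - \<gamma> (fst z)) \<bullet> w1 (fst z)" for z
  define p2 where "p2 z = (\<gamma> (snd z) - \<gamma> (fst z)) \<bullet> w2 (fst z)" for z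
  have sp: "smooth_on UNIV e" "smooth_on UNIV p1" "smooth_on UNIV p2"
    unfolding e_def[abs_def] p1_def[abs_def] p2_def[abs_def] by (intro smooth_cord_inner smooth_\<gamma> w2)+
  have z00: "e z0 = a" "p1 z0 = 0" "p2 z0 = 0"
    unfolding e_def p1_def p2_def st0 fst_conv snd_conv st(2) by (simp_all add: \<gamma>1_unit \<gamma>1_\<gamma>2 w2)
  let ?E = "{z. \<bar>a\<bar> / 2 < \<bar>e z\<bar>}"
  have E: "open ?E" by (intro open_Collect_less continuous_intros smooth_on_continuous_on sp)
  have subE: "smooth_on ?E f" if "smooth_on UNIV f" for f :: "real \<times> real \<Rightarrow> real"
    using smooth_on_subset[OF that] by simp
  have E0: "z0 \<in> ?E" using a by (simp add: z00)
  define X where "X z = p1 z / e z" for z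
  define Y where "Y z = p2 z / e z" for z
  have sXY: "smooth_on ?E X" "smooth_on ?E Y"
    unfolding X_def[abs_def] Y_def[abs_def] by (intro smooth_on_divide E subE sp; force)+
  have sP: "smooth_on ?E (\<lambda>z. (fst z, X z))" by (intro smooth_on_Pair smooth_on_fst smooth_on_id E sXY)
  let ?U2 = "?E \<inter> (\<lambda>z. (fst z, X z)) -` V"
  have U2: "open ?U2" by (rule continuous_open_preimage[OF smooth_on_continuous_on[OF sP] E U'(4)])
  have z0U2: "z0 \<in> ?U2" using E0 V0(1) by (simp add: X_def z00) (simp add: st0)
  define h where "h z = Y z - Z (fst z, X z)" for z
  have sZc: "smooth_on ?U2 (\<lambda>z. Z (fst z, X z))"
    by (rule smooth_on_compose[OF U2 U'(4) sZ smooth_on_subset[OF sP]]) auto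
  have sh: "smooth_on ?U2 h" unfolding h_def[abs_def]
    by (intro smooth_on_diff U2 sZc smooth_on_subset[OF sXY(2)]) simp
  have dp: "frechet_derivative p1 (at z0) v = fst v * ((\<gamma> t0 - \<gamma> s0) \<bullet> vderiv w1 s0) + snd v * (\<gamma>1 t0 \<bullet> w1 s0)"
    "frechet_derivative p2 (at z0) v = fst v * ((\<gamma> t0 - \<gamma> s0) \<bullet> vderiv w2 s0) + snd v * (\<gamma>1 t0 \<bullet> w2 s0)" for v
    using frechet_derivative_at[OF cord_inner_has_derivative[OF smooth_\<gamma>(3) \<gamma>1_\<gamma>2, of t0 s0, folded p1_def]]
      frechet_derivative_at[OF cord_inner_has_derivative[OF w2(1,2), of t0 s0, folded p2_def]]
    by (simp_all add: fun_eq_iff st0)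
  \<comment> \<open>\<open>Z\<close> contributes nothing to first order, and the variation of the
    denominator \<open>e\<close> is multiplied by \<open>p2 z0 = 0\<close>. Up to the factor 1 / a,
    \<open>h\<close> has the differential of \<open>p2\<close>, which brings in the independence at
    tangent cords.\<close>
  have dh: "frechet_derivative h (at z0) v = frechet_derivative p2 (at z0) v / a" for v
  proof -
    have d2: "(p2 has_derivative frechet_derivative p2 (at z0)) (at z0)"
      and de: "(e has_derivative frechet_derivative e (at z0)) (at z0)"
      using smooth_on_has_derivative[OF sp(3)] smooth_on_has_derivative[OF sp(1)] by simp_all
    have dY: "(Y has_derivative (\<lambda>v. frechet_derivative p2 (at z0) v / a)) (at z0)"
      using has_derivative_divide[OF d2 de] a by (simp add: Y_def[abs_def] z00)
    have "((\<lambda>z. Z (fst z, X z)) has_derivative (\<lambda>v. 0)) (at z0)"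
    proof -
      have "(Z has_derivative (\<lambda>v. 0)) (at (fst z0, X z0))" using dZ by (simp add: X_def z00) (simp add: st0)
      from has_derivative_compose[OF smooth_on_has_derivative[OF sP E0] this] show ?thesis .
    qed
    from has_derivative_diff[OF dY this]
    have "(h has_derivative (\<lambda>v. frechet_derivative p2 (at z0) v / a)) (at z0)" by (simp add: h_def[abs_def])
    then show ?thesis using frechet_derivative_at by metis
  qed
  obtain U3 where U3: "open U3" "(s0, t0) \<in> U3"
    "\<And>s t r. (s, t) \<in> U3 \<Longrightarrow> \<gamma> r \<in> open_segment (\<gamma> s) (\<gamma> t) \<Longrightarrow> \<exists>k::int. (s, r + of_int k * L - s) \<in> U'"
    using intersections_near_start[OF st U'(1,3)] by blast
  let ?U = "?U2 \<inter> U3"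
  have U: "open ?U" by (intro open_Int[OF U2] U3)
  have zU: "z0 \<in> ?U" using z0U2 U3(2) st0 by simp
  have h0: "h z0 = 0"
  proof -
    have "Z (s0, 0) = 0" by (simp add: Z_def V0)
    then show ?thesis by (simp add: h_def X_def Y_def z00) (simp add: st0)
  qed
  have forward: "p1 (s, t) > 0 \<and> h (s, t) = 0" if zs: "(s, t) \<in> ?U" "(s, t) \<in> S_cords \<gamma>" for s t
  proof -
    obtain r where r: "\<gamma> r \<in> open_segment (\<gamma> s) (\<gamma> t)" using zs(2) by (auto simp: S_cords_def)
    have "(s, t) \<in> U3" using zs(1) by simp
    then obtain k :: int where k: "(s, r + of_int k * L - s) \<in> U'" using U3(3) r by blast
    define u where "u = r + of_int k * L - s"
    have "\<gamma> (s + u) = \<gamma> (r + of_int k * L)" by (simp add: u_def)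
    also have "\<dots> = \<gamma> r" by (rule periodic_int) (rule \<gamma>D)
    finally have \<gamma>u: "\<gamma> (s + u) \<in> open_segment (\<gamma> s) (\<gamma> t)" using r by simp
    have uU: "(s, u) \<in> U'" using k by (simp add: u_def)
    then have uD: "d (s, u) > 0" "g1 (s, u) > 0" using U'(2) by auto
    obtain l where l: "0 < l" "l < 1" "\<gamma> (s + u) = (1 - l) *\<^sub>R \<gamma> s + l *\<^sub>R \<gamma> t"
      using \<gamma>u unfolding in_segment by blast
    have e: "\<gamma> (s + u) - \<gamma> s = l *\<^sub>R (\<gamma> t - \<gamma> s)" unfolding l(3) by (simp add: algebra_simps)
    have i: "u * d (s, u) = l * e (s, t)" "u\<^sup>2 * g1 (s, u) = l * p1 (s, t)" "u\<^sup>2 * g2 (s, u) = l * p2 (s, t)"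
      using comp[of s u] unfolding e by (simp_all add: e_def p1_def p2_def)
    have enz: "e (s, t) \<noteq> 0" using zs(1) a by auto
    have unz: "u \<noteq> 0" using i(1) l(1) enz by auto
    \<comment> \<open>Near its startpoint the knot bends to the side of \<gamma>'' for both signs of
      \<open>u\<close>, so a cord through such a point leans to that side.\<close>
    have "l * p1 (s, t) > 0" using i(2) unz uD(2) by (metis zero_less_mult_iff zero_less_power2)
    then have p: "p1 (s, t) > 0" using l(1) by (simp add: zero_less_mult_iff)
    have ratio: "P / e (s, t) = u * (g / d (s, u))" if "u\<^sup>2 * g = l * P" for P g :: real
    proof -
      have "P / e (s, t) = (l * P) / (l * e (s, t))" using l(1) by simp
      also have "\<dots> = (u\<^sup>2 * g) / (u * d (s, u))" using that i(1) by simp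
      also have "\<dots> = u * (g / d (s, u))" using unz by (simp add: power2_eq_square)
      finally show ?thesis .
    qed
    have X: "X (s, t) = x (s, u)" using ratio[OF i(2)] by (simp add: X_def x_def)
    have Y: "Y (s, t) = u * (g2 (s, u) / d (s, u))" using ratio[OF i(3)] by (simp add: Y_def)
    have "Z (s, X (s, t)) = u * (g2 (s, u) / d (s, u))"
      using \<phi>(2)[OF uU] by (simp add: Z_def X)
    then show ?thesis using p Y by (simp add: h_def)
  qed
  have backward: "(s, t) \<in> S_cords \<gamma>" if zs: "(s, t) \<in> ?U" and p: "p1 (s, t) > 0" and hz: "h (s, t) = 0" for s t
  proof -
    have XV: "(s, X (s, t)) \<in> V" and eb: "\<bar>a\<bar> / 2 < \<bar>e (s, t)\<bar>" using zs by auto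
    define u where "u = snd (\<psi> (s, X (s, t)))"
    have su: "\<psi> (s, X (s, t)) = (s, u)" using \<psi>(2)[OF XV] by (simp add: u_def prod_eq_iff)
    then have uU: "(s, u) \<in> U'" using \<psi>(1)[OF XV] by simp
    then have uD: "d (s, u) > 0" "g1 (s, u) > 0" "\<bar>u * d (s, u)\<bar> < \<bar>a\<bar> / 2" using U'(2) by auto
    have X: "X (s, t) = u * (g1 (s, u) / d (s, u))" using \<psi>(3)[OF XV] by (simp add: su x_def)
    have Y: "Y (s, t) = u * (g2 (s, u) / d (s, u))" using hz by (simp add: h_def Z_def su)
    have enz: "e (s, t) \<noteq> 0" using eb a by auto
    define l where "l = u * d (s, u) / e (s, t)"
    have p12: "p1 (s, t) = e (s, t) * (u * (g1 (s, u) / d (s, u)))" "p2 (s, t) = e (s, t) * (u * (g2 (s, u) / d (s, u)))"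
      using X Y enz by (simp_all add: X_def Y_def field_simps)
    have i: "u * d (s, u) = l * e (s, t)" "u\<^sup>2 * g1 (s, u) = l * p1 (s, t)" "u\<^sup>2 * g2 (s, u) = l * p2 (s, t)"
      using enz uD(1) unfolding p12 l_def by (simp_all add: power2_eq_square)
    \<comment> \<open>The ratio \<open>l\<close> matches the tangential components, and the equal
      slopes match the two normal ones.\<close>
    have "\<gamma> (s + u) - \<gamma> s - l *\<^sub>R (\<gamma> t - \<gamma> s) = 0"
      by (rule curvature_frame_zero[where s = s])
        (simp_all add: inner_diff_left[of "\<gamma> (s + u) - \<gamma> s"] comp i e_def p1_def p2_def)
    then have e: "\<gamma> (s + u) = (1 - l) *\<^sub>R \<gamma> s + l *\<^sub>R \<gamma> t" by (simp add: algebra_simps)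
    have unz: "u \<noteq> 0" using p unfolding p12 by auto
    have "u\<^sup>2 * g1 (s, u) > 0" using unz uD(2) by simp
    then have "l > 0" using i(2) p by (metis zero_less_mult_iff less_asym)
    moreover have "\<bar>l\<bar> < 1"
    proof -
      have "\<bar>u * d (s, u)\<bar> < \<bar>e (s, t)\<bar>" using uD(3) eb by linarith
      then show ?thesis using enz by (simp add: l_def)
    qed
    moreover have "\<gamma> s \<noteq> \<gamma> t" using enz by (auto simp: e_def)
    ultimately have "\<gamma> (s + u) \<in> open_segment (\<gamma> s) (\<gamma> t)" unfolding in_segment using e by auto
    then show ?thesis by (auto simp: S_cords_def)
  qed
  show ?thesis
  proof (rule half_arc_closure[OF U smooth_on_subset[OF sp(2) subset_UNIV] smooth_on_subset[OF sh Int_lower1] zU z00(2) h0])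
    fix v assume 1: "frechet_derivative p1 (at z0) v = 0" and "frechet_derivative h (at z0) v = 0"
    then have 2: "frechet_derivative p2 (at z0) v = 0" using a by (simp add: dh)
    show "v = 0"
      by (rule tangent_cord_independent[OF smooth_\<gamma>(3) \<gamma>1_\<gamma>2 w2(1,2) _ st 1[unfolded dp] 2[unfolded dp]])
        (rule span_curvature_frame)
  next
    fix z assume "z \<in> ?U"
    then show "z \<in> S_cords \<gamma> \<longleftrightarrow> 0 < p1 z \<and> h z = 0"
      using forward backward by (cases z) blast
  qed
qed

text \<open>One inclusion is built into the definition; for the other, the half-arc at a tangent
  cord is a boundary branch of the immersed curve.\<close>

lemma boundary_S_start_eq: "boundary_S_start \<gamma> = tangent_at_start \<gamma>"
  unfolding boundary_S_start_def boundary_S_def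
  using tangent_cord_secant_boundary curve_boundary_subset_immersed by blast

end

theorem lemma2p14:
  shows "\<exists>R. residual_in (Cinf_topology knot_embeddings) R \<and>
    (\<forall>c\<in>R. \<forall>L \<gamma>. arclength_parametrization L \<gamma> (range c) \<longrightarrow>
      (\<exists>Q. residual_in (Cinf_topology (framings L \<gamma>)) Q \<and>
        (\<forall>\<nu>\<in>Q. one_dim_submanifold_with_boundary (F_start \<gamma> \<nu>) \<and>
                 curve_boundary (F_start \<gamma> \<nu>) = boundary_S_start \<gamma>)))"
proof -
  obtain R where R: "residual_in (Cinf_topology knot_embeddings) R" "R \<subseteq> knot_embeddings"
    "\<forall>c\<in>R. generic_knot c" using residual_generic_knot by (elim exE conjE)
  show ?thesis
  proof (rule exI[of _ R], intro conjI ballI allI impI)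
    show "residual_in (Cinf_topology knot_embeddings) R" by (rule R)
    fix c L \<gamma> assume c: "c \<in> R" and \<gamma>: "arclength_parametrization L \<gamma> (range c)"
    interpret generic_arclength_curve L \<gamma> "range c"
    proof
      show "arclength_parametrization L \<gamma> (range c)" by (rule \<gamma>)
      show "generic_curve \<gamma>" using generic_curve_arclength[OF _ _ \<gamma>] c R(2,3) by blast
    qed
    show "\<exists>Q. residual_in (Cinf_topology (framings L \<gamma>)) Q \<and>
        (\<forall>\<nu>\<in>Q. one_dim_submanifold_with_boundary (F_start \<gamma> \<nu>) \<and>
                 curve_boundary (F_start \<gamma> \<nu>) = boundary_S_start \<gamma>)"
    proof (intro exI conjI ballI)
      show "residual_in (Cinf_topology (framings L \<gamma>)) {\<nu>\<in>framings L \<gamma>. generic_framing \<gamma> \<nu>}"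
        by (rule residual_generic_framing[OF curvature_nonzero])
      fix \<nu> assume "\<nu> \<in> {\<nu>\<in>framings L \<gamma>. generic_framing \<gamma> \<nu>}"
      then interpret generic_framed_curve L \<gamma> "range c" \<nu> by unfold_locales simp_all
      show "one_dim_submanifold_with_boundary (F_start \<gamma> \<nu>)" by (rule F_start_submanifold)
      show "curve_boundary (F_start \<gamma> \<nu>) = boundary_S_start \<gamma>"
        unfolding boundary_S_start_eq by (rule F_start_submanifold)
    qed
  qed
qed

end
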